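(* Let $\Delta$ be a thick masure such that the type of $\partial\Delta$ has no direct factor of affine type (i.e. no indecomposable component of the generalized Cartan matrix $(\alpha_j(\alpha_i^\vee))_{i,j\in I}$ is of affine type). If a vectorially Weyl subgroup $G\le\mathrm{Aut}(\Delta)$ is strongly transitive on $\Delta$, then $G$ contains a strongly regular hyperbolic element.
   Context: \emph{Model apartment.} Let $V$ be a finite-dimensional real vector space, $I$ a nonempty finite set, $(\alpha_i)_{i\in I}$ a linearly independent family in $V^*$, $(\alpha_i^\vee)_{i\in I}$ a family in $V$ such that $(\alpha_j(\alpha_i^\vee))_{i,j}$ is a (possibly decomposable) generalized Cartan matrix. Put $r_i(v)=v-\alpha_i(v)\alpha_i^\vee$, $S=\{r_i\}_{i\in I}$, $W^v=\langle S\rangle\subset GL(V)$ (a Coxeter group), $\Phi=\{w\alpha_i\}$ (real roots; for $\alpha=w\alpha_i$, $\alpha^\vee=w\alpha_i^\vee$, $r_\alpha=wr_iw^{-1}$), $\Phi_{im}$ = imaginary roots of the associated Kac--Moody algebra. For $J\subset I$ (identified with a subset of $S$): $W^v(J)=\langle r_i: i\in J\rangle$ and $F^v(J)=\{v:\alpha_i(v)=0\ (i\in J),\ \alpha_i(v)>0\ (i\notin J)\}$; $C^v_f=F^v(\emptyset)$. Vectorial faces of sign $\pm$ and type $J$ are the $\pm wF^v(J)$, $w\in W^v$; chambers: $J=\emptyset$; panels: $|J|=1$; $J$ and the face are spherical if $W^v(J)$ is finite. $\mathcal T$ (resp. $\mathcal T^\circ$) is the union of positive (resp. positive spherical) faces.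 The model apartment $\mathbb A$ is $V$ as an affine space with walls $M(\alpha,k)=\{v:\alpha(v)+k=0\}$, $\alpha\in\Phi$, $k\in\Lambda_\alpha$, where $0\in\Lambda_\alpha\subset\mathbb R$ is infinite; put $\Lambda_\alpha=\mathbb R$ for $\alpha\in\Phi_{im}$. $D(\alpha,k)=\{v:\alpha(v)+k\ge0\}$. $W^a$ is generated by the affine reflections in the walls $M(\alpha,k)$ with linear part $r_\alpha$, and is assumed to permute the walls. $\mathrm{Aut}(\mathbb A)$: affine bijections permuting the pairs ($M(\alpha,k)$ a wall, $\alpha^\vee$). $x\le y$ iff $y-x\in\mathcal T$; $x\overset{\circ}{<}y$ iff $y-x\in\mathcal T^\circ$. \emph{Filters.} Subsets are identified with the filter of their supersets; a set contains a filter if it is a member of it. The enclosure $cl_{\mathbb A}(F)$ of a filter $F$ consists of the sets containing some member of $F$ of the form $\bigcap_{\alpha\in\Phi\cup\Phi_{im}}D(\alpha,k_\alpha)$, $k_\alpha\in\Lambda_\alpha\cup\{\infty\}$. The support of $F$ is the smallest affine subspace containing it. Local face: $F^\ell(x,F^v)=\mathrm{germ}_x(x+F^v)$ (local chamber, local panel if $F^v$ is a chamber, panel); closed face: enclosure of a local face. Sector-face: $x+F^v$ (base point $x$, direction $F^v$). Chimney: $\mathfrak r(F,F^v)=cl_{\mathbb A}(F+F^v)$, $F$ a local face; splayed if $F^v$ is spherical, solid if the direction of its support has finite pointwise stabilizer in $W^v$; its germ is the filter of sets containing some $\mathfrak r(F+\xi,F^v)$, $\xi\in F^v$. A ray or segment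 from $x$ through $y\ne x$ is preordered if $x\le y$ or $y\le x$, generic if $x\overset{\circ}{<}y$ or $y\overset{\circ}{<}x$. \emph{Masures.} An apartment is a set $A$ with a set $Isom^w(\mathbb A,A)$ of bijections of the form $\{f_0\circ w: w\in W^a\}$. A bijection $\varphi:A\to A'$ of apartments is an isomorphism (resp. Weyl, resp. vectorially Weyl) if $f'^{-1}\varphi f$ lies in $\mathrm{Aut}(\mathbb A)$ (resp. $W^a$, resp. $(W^v\ltimes V)\cap\mathrm{Aut}(\mathbb A)$) for $f\in Isom^w(\mathbb A,A)$, $f'\in Isom^w(\mathbb A,A')$. All notions transfer from $\mathbb A$ to apartments. A masure $(\Delta,\mathcal A)$ is a set $\Delta$ covered by a family $\mathcal A$ of subsets (apartments) with: (MA1) each $A\in\mathcal A$ has a structure of apartment; (MA2) if $F$ is a point, germ of preordered interval, generic ray or solid chimney in $A$ and $A'$ is another apartment containing $F$, then $A\cap A'\supset cl_A(F)$ and some Weyl-isomorphism $A\to A'$ fixes $cl_A(F)$ pointwise; (MA3) if $\mathfrak R$ is the germ of a splayed chimney and $F$ a closed face or germ of a solid chimney, some apartment contains $\mathfrak R$ and $F$; (MA4) if $A,A'$ both contain $\mathfrak R,F$ as in (MA3), then $A\cap A'\supset cl_A(\mathfrak R\cup F)$ and some Weyl-isomorphism $A\to A'$ fixes $cl_A(\mathfrak R\cup F)$ pointwise; (MAO) if $x,y\in A\cap A'$ and $x\le_A y$, then $[x,y]_A=[x,y]_{A'}$. $\Delta$ is thick if each local panel is contained in (the closure of) at least three local chambers.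 $\mathrm{Aut}(\Delta)$: bijections $\varphi$ of $\Delta$ permuting $\mathcal A$ such that each $\varphi|_A:A\to\varphi(A)$ is an isomorphism; $\varphi$ is vectorially Weyl if all $\varphi|_A$ are; a vectorially Weyl subgroup consists of vectorially Weyl automorphisms. The twin building at infinity $\partial\Delta$ has type $(W^v,S)$. \emph{Strong transitivity on $\Delta$.} $G\le\mathrm{Aut}(\Delta)$ acts strongly transitively on $\Delta$ if every isomorphism whose existence is asserted in (MA2) and (MA4) may be chosen to be the restriction of an element of $G$. \emph{Strongly regular hyperbolic.} $\gamma\in\mathrm{Aut}(\Delta)$ is hyperbolic if there is an apartment $A$ and a line in $A$ (a translation axis) along which $\gamma$ acts as a (nontrivial) translation. It is strongly regular if moreover the axis can be chosen strongly regular, i.e. the direction of the line lies in $\mathcal T^\circ\cup-\mathcal T^\circ$ and in no wall direction $\ker\alpha$, $\alpha\in\Phi$ (its two ends lie in the interiors of opposite ideal chambers). *)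

theory Defs
  imports "HOL-Analysis.Analysis" "HOL-Algebra.Bij" "HOL-Algebra.Generated_Groups"
begin

text \<open>The finite-dimensional real vector space \<open>V\<close> is a type \<open>'v\<close> of class \<open>euclidean_space\<close>; only
  its vector space structure and its topology are used, never the inner product. Elements of the
  dual space are linear functions \<open>'v \<Rightarrow> real\<close>. The finite nonempty index set is the type \<open>'i\<close>.

  Filters of subsets are HOL filters. A set \<open>S\<close> is a member of \<open>F\<close> (``\<open>S\<close> contains \<open>F\<close>'')
  iff \<open>F \<le> principal S\<close>; an inclusion of filters is \<open>\<le>\<close>, the union of two filters is \<open>sup\<close>,
  and a map fixes \<open>F\<close> pointwise if it fixes pointwise some member of \<open>F\<close>.\<close>


section \<open>Kac--Moody algebra\<close>

text \<open>Terms over the generators \<open>h \<in> V\<close>, \<open>e\<^sub>i\<close>, \<open>f\<^sub>i\<close> of the Lie algebra.\<close>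

datatype ('v, 'i) lie_term =
    LH 'v
  | LE 'i
  | LF 'i
  | LZero
  | LAdd "('v, 'i) lie_term" "('v, 'i) lie_term"
  | LScale real "('v, 'i) lie_term"
  | LBr "('v, 'i) lie_term" "('v, 'i) lie_term"

locale apartment_data =
  fixes \<alpha> :: "'i::finite \<Rightarrow> 'v::euclidean_space \<Rightarrow> real"
    and \<alpha>v :: "'i \<Rightarrow> 'v"
    and \<Lambda> :: "('v \<Rightarrow> real) \<Rightarrow> real set"
begin

definition cartan :: "'i \<Rightarrow> 'i \<Rightarrow> real"
  where "cartan i j = \<alpha> j (\<alpha>v i)"

text \<open>Equality in the auxiliary Lie algebra \<open>\<gg>\<^sup>~(A)\<close> of Kac: the least congruence containing the Lie
  algebra axioms, the linear relations of \<open>V\<close> and the defining relations. The Serre relations are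
  not imposed; they follow in the quotient below.\<close>

inductive lie_eq :: "('v, 'i) lie_term \<Rightarrow> ('v, 'i) lie_term \<Rightarrow> bool"  (infix "\<doteq>" 50) where
  lie_refl: "x \<doteq> x"
| lie_sym: "x \<doteq> y \<Longrightarrow> y \<doteq> x"
| lie_trans: "x \<doteq> y \<Longrightarrow> y \<doteq> z \<Longrightarrow> x \<doteq> z"
| cong_add: "x \<doteq> x' \<Longrightarrow> y \<doteq> y' \<Longrightarrow> LAdd x y \<doteq> LAdd x' y'"
| cong_scale: "x \<doteq> x' \<Longrightarrow> LScale c x \<doteq> LScale c x'"
| cong_br: "x \<doteq> x' \<Longrightarrow> y \<doteq> y' \<Longrightarrow> LBr x y \<doteq> LBr x' y'"
| add_assoc: "LAdd (LAdd x y) z \<doteq> LAdd x (LAdd y z)"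
| add_comm: "LAdd x y \<doteq> LAdd y x"
| add_zero: "LAdd LZero x \<doteq> x"
| add_neg: "LAdd x (LScale (- 1) x) \<doteq> LZero"
| scale_add: "LScale c (LAdd x y) \<doteq> LAdd (LScale c x) (LScale c y)"
| add_scale: "LScale (c + d) x \<doteq> LAdd (LScale c x) (LScale d x)"
| scale_scale: "LScale c (LScale d x) \<doteq> LScale (c * d) x"
| scale_one: "LScale 1 x \<doteq> x"
| br_add: "LBr (LAdd x y) z \<doteq> LAdd (LBr x z) (LBr y z)"
| br_scale: "LBr (LScale c x) y \<doteq> LScale c (LBr x y)"
| br_add_right: "LBr x (LAdd y z) \<doteq> LAdd (LBr x y) (LBr x z)"
| br_scale_right: "LBr x (LScale c y) \<doteq> LScale c (LBr x y)"
| br_alt: "LBr x x \<doteq> LZero"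
| jacobi: "LAdd (LBr x (LBr y z)) (LAdd (LBr y (LBr z x)) (LBr z (LBr x y))) \<doteq> LZero"
| h_add: "LH (u + v) \<doteq> LAdd (LH u) (LH v)"
| h_scale: "LH (c *\<^sub>R v) \<doteq> LScale c (LH v)"
| h_h: "LBr (LH u) (LH v) \<doteq> LZero"
| h_e: "LBr (LH v) (LE i) \<doteq> LScale (\<alpha> i v) (LE i)"
| h_f: "LBr (LH v) (LF i) \<doteq> LScale (- \<alpha> i v) (LF i)"
| e_f: "LBr (LE i) (LF i) \<doteq> LH (\<alpha>v i)"
| e_f_neq: "i \<noteq> j \<Longrightarrow> LBr (LE i) (LF j) \<doteq> LZero"

definition lie_ideal :: "('v, 'i) lie_term set \<Rightarrow> bool"
  where "lie_ideal N \<longleftrightarrow> LZero \<in> N \<and>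
     (\<forall>x y. x \<doteq> y \<longrightarrow> x \<in> N \<longrightarrow> y \<in> N) \<and>
     (\<forall>x\<in>N. \<forall>y\<in>N. LAdd x y \<in> N) \<and>
     (\<forall>c. \<forall>x\<in>N. LScale c x \<in> N) \<and>
     (\<forall>x\<in>N. \<forall>y. LBr y x \<in> N)"

text \<open>The largest ideal meeting the Cartan subalgebra trivially. The Kac--Moody algebra
  \<open>\<gg>(A)\<close> is the quotient of \<open>\<gg>\<^sup>~(A)\<close> by it.\<close>

definition kac_radical :: "('v, 'i) lie_term set"
  where "kac_radical = \<Union>{N. lie_ideal N \<and> (\<forall>h. LH h \<in> N \<longrightarrow> LH h \<doteq> LZero)}"

definition kac_moody_roots :: "('v \<Rightarrow> real) set"
  where "kac_moody_roots = {\<beta>. linear \<beta> \<and> (\<exists>v. \<beta> v \<noteq> 0) \<and>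
     (\<exists>x. x \<notin> kac_radical \<and>
          (\<forall>h. LAdd (LBr (LH h) x) (LScale (- \<beta> h) x) \<in> kac_radical))}"


section \<open>Vectorial data\<close>

definition simple_refl :: "'i \<Rightarrow> 'v \<Rightarrow> 'v"
  where "simple_refl i v = v - \<alpha> i v *\<^sub>R \<alpha>v i"

definition Wv :: "('v \<Rightarrow> 'v) set"
  where "Wv = generate (BijGroup UNIV) (range simple_refl)"

definition Wv_par :: "'i set \<Rightarrow> ('v \<Rightarrow> 'v) set"
  where "Wv_par J = generate (BijGroup UNIV) (simple_refl ` J)"

text \<open>\<open>w \<alpha>\<^sub>i\<close> is the linear form \<open>\<alpha>\<^sub>i \<circ> w\<^sup>-\<^sup>1\<close>.\<close>

definition real_roots :: "('v \<Rightarrow> real) set"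
  where "real_roots = {\<alpha> i \<circ> inv_into UNIV w |w i. w \<in> Wv}"

definition coroot :: "('v \<Rightarrow> real) \<Rightarrow> 'v"
  where "coroot \<beta> = (THE c. \<exists>w\<in>Wv. \<exists>i. \<beta> = \<alpha> i \<circ> inv_into UNIV w \<and> c = w (\<alpha>v i))"

definition imaginary_roots :: "('v \<Rightarrow> real) set"
  where "imaginary_roots = kac_moody_roots - real_roots"

definition Fv :: "'i set \<Rightarrow> 'v set"
  where "Fv J = {v. (\<forall>i\<in>J. \<alpha> i v = 0) \<and> (\<forall>i. i \<notin> J \<longrightarrow> \<alpha> i v > 0)}"

definition spherical :: "'i set \<Rightarrow> bool"
  where "spherical J \<longleftrightarrow> finite (Wv_par J)"

definition positive_faces :: "'i set \<Rightarrow> 'v set set"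
  where "positive_faces J = {w ` Fv J |w. w \<in> Wv}"

definition faces_of_type :: "'i set \<Rightarrow> 'v set set"
  where "faces_of_type J = positive_faces J \<union> (\<lambda>F. uminus ` F) ` positive_faces J"

definition vectorial_faces :: "'v set set"
  where "vectorial_faces = (\<Union>J. faces_of_type J)"

definition spherical_faces :: "'v set set"
  where "spherical_faces = (\<Union>J\<in>{J. spherical J}. faces_of_type J)"

definition vectorial_chambers :: "'v set set"
  where "vectorial_chambers = faces_of_type {}"

definition vectorial_panels :: "'v set set"
  where "vectorial_panels = (\<Union>i. faces_of_type {i})"

definition tits_cone :: "'v set"
  where "tits_cone = (\<Union>J. \<Union>(positive_faces J))"

definition open_tits_cone :: "'v set"
  where "open_tits_cone = (\<Union>J\<in>{J. spherical J}. \<Union>(positive_faces J))"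

definition le_apt :: "'v \<Rightarrow> 'v \<Rightarrow> bool"
  where "le_apt x y \<longleftrightarrow> y - x \<in> tits_cone"

definition less_apt :: "'v \<Rightarrow> 'v \<Rightarrow> bool"
  where "less_apt x y \<longleftrightarrow> y - x \<in> open_tits_cone"


section \<open>Types of the components of the Cartan matrix\<close>

definition component :: "'i set \<Rightarrow> bool"
  where "component J \<longleftrightarrow> J \<noteq> {} \<and>
     (\<forall>i\<in>J. \<forall>j\<in>- J. cartan i j = 0 \<and> cartan j i = 0) \<and>
     (\<forall>K. K \<noteq> {} \<and> K \<subset> J \<longrightarrow> (\<exists>i\<in>K. \<exists>j\<in>J - K. cartan i j \<noteq> 0 \<or> cartan j i \<noteq> 0))"

text \<open>Affine type for an indecomposable submatrix \<open>A\<^sub>J\<close> in the sense of Kac: \<open>A\<^sub>J\<close> has corank 1,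
  \<open>A\<^sub>J u = 0\<close> for some \<open>u > 0\<close>, and \<open>A\<^sub>J u \<ge> 0\<close> implies \<open>A\<^sub>J u = 0\<close>. Vectors indexed by \<open>J\<close> are
  vectors indexed by \<open>'i\<close> that vanish outside \<open>J\<close>.\<close>

definition affine_type :: "'i set \<Rightarrow> bool"
  where "affine_type J \<longleftrightarrow>
     dim {u :: real ^ 'i. (\<forall>j\<in>- J. u $ j = 0) \<and> (\<forall>i\<in>J. (\<Sum>j\<in>J. cartan i j * u $ j) = 0)} = 1 \<and>
     (\<exists>u. (\<forall>j\<in>J. u j > 0) \<and> (\<forall>i\<in>J. (\<Sum>j\<in>J. cartan i j * u j) = 0)) \<and>
     (\<forall>u. (\<forall>i\<in>J. (\<Sum>j\<in>J. cartan i j * u j) \<ge> 0) \<longrightarrow> (\<forall>i\<in>J. (\<Sum>j\<in>J. cartan i j * u j) = 0))"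

definition has_affine_factor :: bool
  where "has_affine_factor \<longleftrightarrow> (\<exists>J. component J \<and> affine_type J)"


section \<open>Model apartment\<close>

definition hyperplane :: "('v \<Rightarrow> real) \<Rightarrow> real \<Rightarrow> 'v set"
  where "hyperplane \<beta> k = {v. \<beta> v + k = 0}"

definition walls :: "'v set set"
  where "walls = {hyperplane \<beta> k |\<beta> k. \<beta> \<in> real_roots \<and> k \<in> \<Lambda> \<beta>}"

text \<open>\<open>M(\<beta>, k)\<close> and \<open>M(-\<beta>, -k)\<close> are the same hyperplane. For real \<open>\<beta>\<close>, \<open>levels \<beta>\<close> is the set of all \<open>k\<close>
  such that \<open>M(\<beta>, k)\<close> is a wall; it equals \<open>\<Lambda> \<beta>\<close> under the usual convention \<open>\<Lambda> (-\<beta>) = - \<Lambda> \<beta>\<close>.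
  For imaginary \<open>\<beta>\<close> it is all of \<open>\<real>\<close>.\<close>

definition levels :: "('v \<Rightarrow> real) \<Rightarrow> real set"
  where "levels \<beta> = \<Lambda> \<beta> \<union> uminus ` \<Lambda> (- \<beta>)"

definition half_apartment :: "('v \<Rightarrow> real) \<Rightarrow> ereal \<Rightarrow> 'v set"
  where "half_apartment \<beta> k = {v. ereal (\<beta> v) + k \<ge> 0}"

definition affine_refl :: "('v \<Rightarrow> real) \<Rightarrow> real \<Rightarrow> 'v \<Rightarrow> 'v"
  where "affine_refl \<beta> k v = v - (\<beta> v + k) *\<^sub>R coroot \<beta>"

definition Wa :: "('v \<Rightarrow> 'v) set"
  where "Wa = generate (BijGroup UNIV) {affine_refl \<beta> k |\<beta> k. \<beta> \<in> real_roots \<and> k \<in> \<Lambda> \<beta>}"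

definition lin_part :: "('v \<Rightarrow> 'v) \<Rightarrow> 'v \<Rightarrow> 'v"
  where "lin_part g v = g v - g 0"

definition wall_pairs :: "('v set \<times> 'v) set"
  where "wall_pairs = {(hyperplane \<beta> k, coroot \<beta>) |\<beta> k. \<beta> \<in> real_roots \<and> k \<in> levels \<beta>}"

definition Aut_apt :: "('v \<Rightarrow> 'v) set"
  where "Aut_apt = {g. bij g \<and> linear (lin_part g) \<and>
     (\<lambda>(M, c). (g ` M, lin_part g c)) ` wall_pairs = wall_pairs}"

definition vectorially_Weyl_apt :: "('v \<Rightarrow> 'v) set"
  where "vectorially_Weyl_apt = {(\<lambda>v. w v + t) |w t. w \<in> Wv} \<inter> Aut_apt"


section \<open>Filters in the model apartment\<close>

definition enclosed :: "'v set set"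
  where "enclosed = {\<Inter>\<beta>\<in>real_roots \<union> imaginary_roots. half_apartment \<beta> (k \<beta>) |k.
     \<forall>\<beta>\<in>real_roots \<union> imaginary_roots. k \<beta> = \<infinity> \<or> k \<beta> \<in> ereal ` levels \<beta>}"

definition encl :: "'v filter \<Rightarrow> 'v filter"
  where "encl F = (INF E\<in>{E \<in> enclosed. F \<le> principal E}. principal E)"

definition support :: "'v filter \<Rightarrow> 'v set"
  where "support F = \<Inter>{U. affine U \<and> F \<le> principal U}"

definition direction :: "'v set \<Rightarrow> 'v set"
  where "direction U = {u - v |u v. u \<in> U \<and> v \<in> U}"

definition germ :: "'v \<Rightarrow> 'v set \<Rightarrow> 'v filter"
  where "germ x S = inf (nhds x) (principal S)"

definition local_face :: "'v \<Rightarrow> 'v set \<Rightarrow> 'v filter"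
  where "local_face x F = germ x ((+) x ` F)"

definition local_faces :: "'v filter set"
  where "local_faces = {local_face x F |x F. F \<in> vectorial_faces}"

definition closed_faces :: "'v filter set"
  where "closed_faces = encl ` local_faces"

definition filter_plus :: "'v filter \<Rightarrow> 'v set \<Rightarrow> 'v filter"
  where "filter_plus F S = filtermap (\<lambda>(x, y). x + y) (F \<times>\<^sub>F principal S)"

definition chimney :: "'v filter \<Rightarrow> 'v set \<Rightarrow> 'v filter"
  where "chimney F E = encl (filter_plus F E)"

definition solid :: "'v filter \<Rightarrow> bool"
  where "solid R \<longleftrightarrow> finite {w \<in> Wv. \<forall>u\<in>direction (support R). w u = u}"

definition chimney_germ :: "'v filter \<Rightarrow> 'v set \<Rightarrow> 'v filter"
  where "chimney_germ F E = (INF \<xi>\<in>E. chimney (filtermap ((+) \<xi>) F) E)"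

definition solid_chimneys :: "'v filter set"
  where "solid_chimneys = {chimney F E |F E.
     F \<in> local_faces \<and> E \<in> vectorial_faces \<and> solid (chimney F E)}"

definition solid_chimney_germs :: "'v filter set"
  where "solid_chimney_germs = {chimney_germ F E |F E.
     F \<in> local_faces \<and> E \<in> vectorial_faces \<and> solid (chimney F E)}"

definition splayed_chimney_germs :: "'v filter set"
  where "splayed_chimney_germs = {chimney_germ F E |F E.
     F \<in> local_faces \<and> E \<in> spherical_faces}"

definition points :: "'v filter set"
  where "points = {principal {x} |x. x \<in> UNIV}"

definition preordered_interval_germs :: "'v filter set"
  where "preordered_interval_germs = {germ x (closed_segment x y) |x y.
     x \<noteq> y \<and> (le_apt x y \<or> le_apt y x)}"

definition generic_rays :: "'v filter set"
  where "generic_rays = {principal {x + t *\<^sub>R (y - x) |t. t \<ge> 0} |x y.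
     x \<noteq> y \<and> (less_apt x y \<or> less_apt y x)}"

end


locale model_apartment = apartment_data \<alpha> \<alpha>v \<Lambda>
  for \<alpha> :: "'i::finite \<Rightarrow> 'v::euclidean_space \<Rightarrow> real"
    and \<alpha>v :: "'i \<Rightarrow> 'v"
    and \<Lambda> :: "('v \<Rightarrow> real) \<Rightarrow> real set" +
  assumes linear_root: "linear (\<alpha> i)"
    and roots_independent: "(\<And>v. (\<Sum>i\<in>UNIV. c i * \<alpha> i v) = 0) \<Longrightarrow> c i = 0"
    and cartan_diag: "cartan i i = 2"
    and cartan_int: "cartan i j \<in> \<int>"
    and cartan_nonpos: "i \<noteq> j \<Longrightarrow> cartan i j \<le> 0"
    and cartan_zero: "cartan i j = 0 \<Longrightarrow> cartan j i = 0"
    and Lambda_zero: "\<beta> \<in> real_roots \<Longrightarrow> 0 \<in> \<Lambda> \<beta>"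
    and Lambda_infinite: "\<beta> \<in> real_roots \<Longrightarrow> infinite (\<Lambda> \<beta>)"
    and Lambda_imaginary: "\<beta> \<in> imaginary_roots \<Longrightarrow> \<Lambda> \<beta> = UNIV"
    and Wa_walls: "w \<in> Wa \<Longrightarrow> (`) w ` walls = walls"


section \<open>Masures\<close>

text \<open>\<open>Isom A\<close> is the set of structure bijections of the apartment \<open>A\<close>.\<close>

locale masure_data = apartment_data \<alpha> \<alpha>v \<Lambda>
  for \<alpha> :: "'i::finite \<Rightarrow> 'v::euclidean_space \<Rightarrow> real"
    and \<alpha>v :: "'i \<Rightarrow> 'v"
    and \<Lambda> :: "('v \<Rightarrow> real) \<Rightarrow> real set" +
  fixes \<Delta> :: "'p set"
    and \<A> :: "'p set set"
    and Isom :: "'p set \<Rightarrow> ('v \<Rightarrow> 'p) set"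
begin

definition apartment_structure :: "'p set \<Rightarrow> bool"
  where "apartment_structure A \<longleftrightarrow>
     (\<exists>f\<^sub>0. bij_betw f\<^sub>0 UNIV A \<and> Isom A = {f\<^sub>0 \<circ> w |w. w \<in> Wa})"

definition iso_of_kind :: "('v \<Rightarrow> 'v) set \<Rightarrow> 'p set \<Rightarrow> 'p set \<Rightarrow> ('p \<Rightarrow> 'p) \<Rightarrow> bool"
  where "iso_of_kind X A A' \<phi> \<longleftrightarrow> bij_betw \<phi> A A' \<and>
     (\<forall>f\<in>Isom A. \<forall>f'\<in>Isom A'. inv_into UNIV f' \<circ> \<phi> \<circ> f \<in> X)"

definition transfer :: "'p set \<Rightarrow> 'v filter set \<Rightarrow> 'p filter set"
  where "transfer A X = {filtermap f F |f F. f \<in> Isom A \<and> F \<in> X}"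

definition encl_in :: "'p set \<Rightarrow> 'p filter \<Rightarrow> 'p filter"
  where "encl_in A F =
     (INF S\<in>{f ` E |f E. f \<in> Isom A \<and> E \<in> enclosed \<and> F \<le> principal (f ` E)}. principal S)"

definition le_in :: "'p set \<Rightarrow> 'p \<Rightarrow> 'p \<Rightarrow> bool"
  where "le_in A x y \<longleftrightarrow> (\<exists>f\<in>Isom A. \<exists>u v. f u = x \<and> f v = y \<and> le_apt u v)"

definition segment_in :: "'p set \<Rightarrow> 'p \<Rightarrow> 'p \<Rightarrow> 'p set"
  where "segment_in A x y =
     \<Union>{f ` closed_segment u v |f u v. f \<in> Isom A \<and> f u = x \<and> f v = y}"

definition Weyl_iso_fixing :: "'p set \<Rightarrow> 'p set \<Rightarrow> 'p filter \<Rightarrow> ('p \<Rightarrow> 'p) \<Rightarrow> bool"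
  where "Weyl_iso_fixing A A' F \<phi> \<longleftrightarrow>
     iso_of_kind Wa A A' \<phi> \<and> eventually (\<lambda>x. \<phi> x = x) F"

text \<open>The configurations to which axioms (MA2) and (MA4) apply.\<close>

definition MA2_config :: "'p set \<Rightarrow> 'p set \<Rightarrow> 'p filter \<Rightarrow> bool"
  where "MA2_config A A' F \<longleftrightarrow> A \<in> \<A> \<and> A' \<in> \<A> \<and>
     F \<in> transfer A (points \<union> preordered_interval_germs \<union> generic_rays \<union> solid_chimneys) \<and>
     F \<le> principal A'"

definition MA3_config :: "'p filter \<Rightarrow> 'p filter \<Rightarrow> bool"
  where "MA3_config R F \<longleftrightarrow> (\<exists>A\<in>\<A>. R \<in> transfer A splayed_chimney_germs) \<and>
     (\<exists>A\<in>\<A>. F \<in> transfer A (closed_faces \<union> solid_chimney_germs))"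

definition MA4_config :: "'p set \<Rightarrow> 'p set \<Rightarrow> 'p filter \<Rightarrow> 'p filter \<Rightarrow> bool"
  where "MA4_config A A' R F \<longleftrightarrow> A \<in> \<A> \<and> A' \<in> \<A> \<and> MA3_config R F \<and>
     R \<le> principal A \<and> F \<le> principal A \<and> R \<le> principal A' \<and> F \<le> principal A'"

definition local_panels_in :: "'p filter set"
  where "local_panels_in = (\<Union>A\<in>\<A>. transfer A {local_face x P |x P. P \<in> vectorial_panels})"

text \<open>The local chambers of \<open>\<Delta>\<close> whose closure contains the filter \<open>P\<close>; the closure of
  \<open>germ\<^sub>x(x + C)\<close> is the germ at \<open>x\<close> of the topological closure of \<open>x + C\<close>.\<close>

definition local_chambers_at :: "'p filter \<Rightarrow> 'p filter set"
  where "local_chambers_at P = {filtermap f (local_face x C) |A f x C.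
     A \<in> \<A> \<and> f \<in> Isom A \<and> C \<in> vectorial_chambers \<and> P \<le> filtermap f (local_face x (closure C))}"

definition thick :: bool
  where "thick \<longleftrightarrow> (\<forall>P\<in>local_panels_in. \<exists>S. S \<subseteq> local_chambers_at P \<and> card S = 3)"

definition Aut_of_kind :: "('v \<Rightarrow> 'v) set \<Rightarrow> ('p \<Rightarrow> 'p) set"
  where "Aut_of_kind X = {\<phi> \<in> Bij \<Delta>. (`) \<phi> ` \<A> = \<A> \<and> (\<forall>A\<in>\<A>. iso_of_kind X A (\<phi> ` A) \<phi>)}"

definition Aut_masure :: "('p \<Rightarrow> 'p) set"
  where "Aut_masure = Aut_of_kind Aut_apt"

definition vectorially_Weyl_Aut :: "('p \<Rightarrow> 'p) set"
  where "vectorially_Weyl_Aut = Aut_of_kind vectorially_Weyl_apt"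

definition strongly_transitive :: "('p \<Rightarrow> 'p) set \<Rightarrow> bool"
  where "strongly_transitive G \<longleftrightarrow>
     (\<forall>A A' F. MA2_config A A' F \<longrightarrow> (\<exists>g\<in>G. Weyl_iso_fixing A A' (encl_in A F) g)) \<and>
     (\<forall>A A' R F. MA4_config A A' R F \<longrightarrow>
        (\<exists>g\<in>G. Weyl_iso_fixing A A' (encl_in A (sup R F)) g))"

text \<open>In the coordinates \<open>f\<close> of an apartment, \<open>\<gamma>\<close> translates the line \<open>x + \<real> d\<close> by \<open>d \<noteq> 0\<close>.\<close>

definition translation_axis :: "('p \<Rightarrow> 'p) \<Rightarrow> ('v \<Rightarrow> 'p) \<Rightarrow> 'v \<Rightarrow> 'v \<Rightarrow> bool"
  where "translation_axis \<gamma> f x d \<longleftrightarrow>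
     d \<noteq> 0 \<and> (\<forall>s::real. \<gamma> (f (x + s *\<^sub>R d)) = f (x + s *\<^sub>R d + d))"

definition strongly_regular_direction :: "'v \<Rightarrow> bool"
  where "strongly_regular_direction d \<longleftrightarrow>
     d \<in> open_tits_cone \<union> uminus ` open_tits_cone \<and> (\<forall>\<beta>\<in>real_roots. \<beta> d \<noteq> 0)"

definition strongly_regular_hyperbolic :: "('p \<Rightarrow> 'p) \<Rightarrow> bool"
  where "strongly_regular_hyperbolic \<gamma> \<longleftrightarrow> \<gamma> \<in> Aut_masure \<and>
     (\<exists>A\<in>\<A>. \<exists>f\<in>Isom A. \<exists>x d. translation_axis \<gamma> f x d \<and> strongly_regular_direction d)"

end

locale masure = model_apartment \<alpha> \<alpha>v \<Lambda> + masure_data \<alpha> \<alpha>v \<Lambda> \<Delta> \<A> Isom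
  for \<alpha> :: "'i::finite \<Rightarrow> 'v::euclidean_space \<Rightarrow> real"
    and \<alpha>v :: "'i \<Rightarrow> 'v"
    and \<Lambda> :: "('v \<Rightarrow> real) \<Rightarrow> real set"
    and \<Delta> :: "'p set"
    and \<A> :: "'p set set"
    and Isom :: "'p set \<Rightarrow> ('v \<Rightarrow> 'p) set" +
  assumes nonempty: "\<Delta> \<noteq> {}"
    and cover: "\<Union>\<A> = \<Delta>"
    and MA1: "A \<in> \<A> \<Longrightarrow> apartment_structure A"
    and MA2: "MA2_config A A' F \<Longrightarrow>
      encl_in A F \<le> principal (A \<inter> A') \<and> (\<exists>\<phi>. Weyl_iso_fixing A A' (encl_in A F) \<phi>)"
    and MA3: "MA3_config R F \<Longrightarrow> \<exists>A\<in>\<A>. R \<le> principal A \<and> F \<le> principal A"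
    and MA4: "MA4_config A A' R F \<Longrightarrow>
      encl_in A (sup R F) \<le> principal (A \<inter> A') \<and>
      (\<exists>\<phi>. Weyl_iso_fixing A A' (encl_in A (sup R F)) \<phi>)"
    and MAO: "A \<in> \<A> \<Longrightarrow> A' \<in> \<A> \<Longrightarrow> {x, y} \<subseteq> A \<inter> A' \<Longrightarrow> le_in A x y \<Longrightarrow>
      segment_in A x y = segment_in A' x y"

end

theory Submission
  imports Defs
begin

text \<open>
  Write \<open>C\<close> for the fundamental chamber \<open>Fv {}\<close>, and call a structure bijection from the model apartment
  onto an apartment a frame of it.

  The product of two reflections with linear part \<open>r\<^sub>i\<close>, in parallel hyperplanes, is a translation along
  the coroot \<open>\<alpha>v i\<close>. If \<open>G\<close> induces on one apartment the reflection \<open>w \<mapsto> x + r\<^sub>i (w - x)\<close> for every \<open>i\<close>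
  and every \<open>x\<close>, then it induces the translation by every real combination \<open>d\<close> of the simple coroots.
  By Gordan's alternative, either some \<open>d\<close> is negative on all simple roots, or the Cartan matrix
  kills a nonzero vector with nonnegative entries; the support of such a vector contains an indecomposable
  component, which is then of affine type. In the absence of affine components there is thus a
  translation by some \<open>d\<close> in \<open>- C\<close>, and such a direction is strongly regular because every real root has a
  constant nonzero sign on \<open>C\<close> (\<open>antidominant_coroot_combination\<close>, \<open>antidominant_strongly_regular\<close>).

  The reflections come from thickness. In an apartment \<open>A\<close>, the local panel of type \<open>i\<close> at \<open>x\<close> lies in the
  closures of the local chambers \<open>x + C\<close> and \<open>x + r\<^sub>i C\<close>, and there is a third local chamber \<open>c\<close>. In a
  tree one would take the three half-lines at a vertex and go once around the three lines formed
  by them. Here the half-lines are replaced by sector germs. One apartment \<open>B\<close> contains the germ of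
  \<open>- C\<close> of \<open>A\<close> and \<open>c\<close>; in \<open>B\<close> the chamber \<open>c\<close> has the position that \<open>x + C\<close> has in \<open>A\<close>. Another one, \<open>Q\<close>,
  contains the germ of \<open>- r\<^sub>i C\<close> of \<open>A\<close> and the germ of the sector of \<open>B\<close> on \<open>c\<close>. Strong transitivity lifts
  to \<open>G\<close> the isomorphisms \<open>A \<rightarrow> B \<rightarrow> Q \<rightarrow> A\<close> which fix the three common germs, and the composite acts on
  \<open>A\<close> as the reflection through \<open>x\<close> (\<open>reflection_in_group\<close>).

  Two facts make this work. First, if two frames agree on the germ of a sector of direction \<open>D\<close> and the
  point \<open>x\<close> lies in both apartments, then the frames agree on all of \<open>x + D\<close>: axiom (MAO) puts the rays from \<open>x\<close> into
  both apartments, (MA2) for generic rays gives an isomorphism that fixes one of them, and an element of \<open>Wv\<close> that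
  fixes a point of a chamber is trivial (\<open>sector_cone_common\<close>). Second, a ray of \<open>B\<close> that
  starts at \<open>x\<close> in \<open>c\<close> is seen unfolded from the germ of \<open>- r\<^sub>i C\<close>: each of its initial segments lies in an apartment
  that contains this germ, on the ray opposite to it (\<open>ray_extension\<close>). This determines the composite above
  completely, and in particular shows that it fixes \<open>x\<close>.

  On the side of the Weyl group, everything rests on the theorem of Tits that a real root is a nonnegative or
  nonpositive combination of the simple roots according to a comparison of word lengths (\<open>root_pos_comb\<close>). It
  makes the action on chambers free, makes coroots well defined, and makes the linear parts of \<open>Wa\<close> lie in \<open>Wv\<close>.
\<close>

section \<open>Gordan's alternative and other preliminaries\<close>

text \<open>The image of \<open>v \<mapsto> (\<phi> i v)\<^sub>i\<close> is a linear subspace that misses the open positive orthant; a normal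
  vector of a hyperplane separating the two is orthogonal to the subspace and has nonnegative entries.\<close>

lemma gordan_alternative:
  fixes \<phi> :: "'i::finite \<Rightarrow> 'v::euclidean_space \<Rightarrow> real"
  assumes lin: "\<And>i. linear (\<phi> i)"
    and none: "\<nexists>v. \<forall>i. \<phi> i v > 0"
  shows "\<exists>c. (\<forall>i. c i \<ge> 0) \<and> (\<exists>i. c i \<noteq> 0) \<and> (\<forall>v. (\<Sum>i\<in>UNIV. c i * \<phi> i v) = 0)"
proof -
  define L where "L v = (\<chi> i. \<phi> i v)" for v
  have linL: "linear L"
    unfolding L_def by (rule linearI) (simp_all add: vec_eq_iff linear_add[OF lin] linear_scale[OF lin])
  define T where "T = {y :: real ^ 'i. \<forall>i. y $ i > 0}"
  have one: "(\<chi> i. 1) \<in> T" by (simp add: T_def)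
  have "convex T" unfolding T_def
    by (auto simp: convex_def intro: add_nonneg_pos)
      (metis add_nonneg_pos add_pos_nonneg less_eq_real_def mult_nonneg_nonneg mult_pos_pos not_one_le_zero add_0 less_numeral_extra(3) order.refl)
  moreover have "convex (range L)"
    by (rule convex_linear_image[OF linL convex_UNIV])
  moreover have "range L \<inter> T = {}" using none unfolding T_def L_def by force
  moreover have "T \<noteq> {}" using one by auto
  ultimately obtain a b where ab: "a \<noteq> 0" "\<forall>x\<in>range L. a \<bullet> x \<le> b" "\<forall>x\<in>T. a \<bullet> x \<ge> b"
    using separating_hyperplane_sets[of "range L" T] by auto
  have b0: "b \<ge> 0" using ab(2) linear_0[OF linL] by (metis inner_zero_right rangeI)
  have zero: "a \<bullet> L v = 0" for v
  proof (rule ccontr)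
    assume nz: "a \<bullet> L v \<noteq> 0"
    define r where "r = (b + 1) / (a \<bullet> L v)"
    have "a \<bullet> L (r *\<^sub>R v) = b + 1" using nz by (simp add: linear_scale[OF linL] r_def)
    then show False using ab(2) by (metis rangeI less_add_one not_less)
  qed
  have nonneg: "a $ i \<ge> 0" for i
  proof (rule ccontr)
    assume neg: "\<not> a $ i \<ge> 0"
    define s where "s = (\<Sum>j\<in>UNIV. a $ j)"
    \<comment> \<open>\<open>M\<close> is so large that \<open>(1, \<dots>, 1) + M e\<^sub>i\<close> lies on the wrong side of the hyperplane.\<close>
    define M where "M = (\<bar>s\<bar> + 1) / (- a $ i)"
    have M: "M > 0" unfolding M_def using neg by (intro divide_pos_pos) linarith+
    define y where "y = (\<chi> j. 1) + M *\<^sub>R axis i (1::real)"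
    have "y \<in> T" using M by (auto simp: T_def y_def axis_def)
    then have "a \<bullet> y \<ge> 0" using ab(3) b0 by force
    moreover have "a \<bullet> y = s + M * a $ i"
    proof -
      have "a \<bullet> (\<chi> j. 1) = s" by (simp add: inner_vec_def s_def)
      then show ?thesis by (simp add: y_def inner_add_right inner_axis)
    qed
    moreover have "M * a $ i = - (\<bar>s\<bar> + 1)" using neg by (simp add: M_def)
    ultimately show False by linarith
  qed
  show ?thesis
  proof (intro exI[of _ "\<lambda>i. a $ i"] conjI allI)
    show "\<exists>i. a $ i \<noteq> 0" using ab(1) by (simp add: vec_eq_iff)
    fix v show "(\<Sum>i\<in>UNIV. a $ i * \<phi> i v) = 0"
      using zero[of v] by (simp add: inner_vec_def L_def)
  qed (rule nonneg)
qed

text \<open>The two-sided form (negative \<open>s\<close> included) lets one lemma serve for steps along and against a direction.\<close>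

lemma open_small_step:
  fixes p d :: "'v::real_normed_vector"
  assumes "open U" "p \<in> U"
  obtains e where "e > 0" "\<And>s. \<bar>s\<bar> \<le> e \<Longrightarrow> p + s *\<^sub>R d \<in> U"
proof -
  obtain r where r: "r > 0" "ball p r \<subseteq> U" using assms openE by blast
  define e where "e = r / (norm d + 1)"
  have nd: "norm d + 1 > 0" by (simp add: add_nonneg_pos)
  have e: "e > 0" using r nd by (simp add: e_def)
  have "p + s *\<^sub>R d \<in> U" if "\<bar>s\<bar> \<le> e" for s
  proof -
    have "\<bar>s\<bar> * norm d \<le> e * norm d" using that by (simp add: mult_right_mono)
    also have "\<dots> < e * (norm d + 1)" using e by simp
    also have "\<dots> = r" using nd by (simp add: e_def)
    finally show ?thesis using r(2) by (auto simp: dist_norm)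
  qed
  then show thesis using that e by blast
qed

lemma filtermap_eventually_eq:
  assumes "eventually (\<lambda>x. f x = g x) F" shows "filtermap f F = filtermap g F"
  unfolding filter_eq_iff eventually_filtermap
  by (intro allI eventually_subst) (use assms in \<open>auto elim!: eventually_mono\<close>)

context model_apartment
begin

section \<open>Words and signs of real roots\<close>

lemma root_add: "\<alpha> i (u + v) = \<alpha> i u + \<alpha> i v"
  and root_diff: "\<alpha> i (u - v) = \<alpha> i u - \<alpha> i v"
  and root_scale: "\<alpha> i (c *\<^sub>R v) = c * \<alpha> i v"
  and root_minus: "\<alpha> i (- v) = - \<alpha> i v"
  and root_sum: "\<alpha> i (\<Sum>j\<in>J. g j) = (\<Sum>j\<in>J. \<alpha> i (g j))"
  using linear_root[of i]
  by (simp_all add: linear_add linear_diff linear_scale linear_neg linear_sum)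

lemma root_coroot: "\<alpha> j (\<alpha>v i) = cartan i j"
  by (simp add: cartan_def)

lemma root_refl: "\<alpha> j (simple_refl i v) = \<alpha> j v - \<alpha> i v * cartan i j"
  by (simp add: simple_refl_def root_diff root_scale root_coroot)

lemma refl_involutive [simp]: "simple_refl i (simple_refl i v) = v"
  by (simp add: simple_refl_def root_diff root_scale root_coroot cartan_diag)

lemma linear_refl: "linear (simple_refl i)"
  by (auto intro!: linearI simp: simple_refl_def root_add root_scale algebra_simps)

lemma refl_comp_refl [simp]: "simple_refl i \<circ> simple_refl i = id"
  by auto

lemma refl_comp_refl_left [simp]: "simple_refl i \<circ> (simple_refl i \<circ> z) = z"
  by (auto simp: comp_def)

lemma bij_refl: "bij (simple_refl i)"
  by (rule o_bij[of "simple_refl i"]) simp_all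

primrec word :: "'i list \<Rightarrow> 'v \<Rightarrow> 'v" where
  "word [] = id"
| "word (i # is) = simple_refl i \<circ> word is"

lemma word_append: "word (xs @ ys) = word xs \<circ> word ys"
  by (induction xs) (auto simp: comp_assoc)

lemma word_rev_comp: "word (rev xs) \<circ> word xs = id"
proof (induction xs)
  case (Cons x xs)
  then show ?case by (simp add: word_append fun_eq_iff)
qed simp

lemma word_comp_rev: "word xs \<circ> word (rev xs) = id"
  using word_rev_comp[of "rev xs"] by simp

lemma linear_word: "linear (word xs)"
proof (induction xs)
  case Nil
  show ?case by (simp only: word.simps(1) linear_id)
next
  case (Cons i xs)
  show ?case by (simp only: word.simps(2)) (rule linear_compose[OF Cons linear_refl])
qed

lemma bij_word: "bij (word xs)"
  by (rule o_bij[OF word_rev_comp word_comp_rev])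

lemma Wv_eq_words: "Wv = range word"
proof -
  interpret B: group "BijGroup (UNIV :: 'v set)" by (rule group_BijGroup)
  have carr: "f \<in> carrier (BijGroup UNIV) \<longleftrightarrow> bij f" for f :: "'v \<Rightarrow> 'v"
    by (simp add: BijGroup_def Bij_def)
  have mult: "f \<otimes>\<^bsub>BijGroup UNIV\<^esub> g = f \<circ> g" if "bij f" "bij g" for f g :: "'v \<Rightarrow> 'v"
    using that by (simp add: BijGroup_def Bij_def compose_def fun_eq_iff)
  have oneB: "\<one>\<^bsub>BijGroup UNIV\<^esub> = (id :: 'v \<Rightarrow> 'v)"
    by (simp add: BijGroup_def fun_eq_iff)
  show ?thesis
  proof (intro equalityI subsetI)
    fix w assume "w \<in> Wv"
    then show "w \<in> range word" unfolding Wv_def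
    proof (induction rule: generate.induct)
      case one
      show ?case unfolding oneB by (rule range_eqI[of _ _ "[]"]) (simp only: word.simps(1))
    next
      case (incl h)
      then obtain i where "h = simple_refl i" by blast
      then show ?case using range_eqI[of h word "[i]"] by simp
    next
      case (inv h)
      then obtain i where h: "h = simple_refl i" by blast
      have "inv\<^bsub>BijGroup UNIV\<^esub> h = h"
        by (rule B.inv_equality) (simp_all add: carr h bij_refl mult oneB)
      then show ?case using range_eqI[of h word "[i]"] h by simp
    next
      case (eng h1 h2)
      then obtain xs ys where "h1 = word xs" "h2 = word ys" by blast
      then show ?case by (simp only: mult bij_word word_append[symmetric] rangeI)
    qed
  next
    fix w assume "w \<in> range word"
    then obtain xs where "w = word xs" by blast
    moreover have "word xs \<in> Wv" for xs
    proof (induction xs)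
      case Nil
      then show ?case unfolding Wv_def word.simps(1) oneB[symmetric] by (rule generate.one)
    next
      case (Cons i xs)
      have "simple_refl i \<in> Wv" unfolding Wv_def by (blast intro: generate.incl)
      from generate.eng[OF this[unfolded Wv_def] Cons[unfolded Wv_def]]
      show ?case unfolding Wv_def by (simp only: mult bij_word bij_refl word.simps(2))
    qed
    ultimately show "w \<in> Wv" by simp
  qed
qed

lemma word_in_Wv: "word xs \<in> Wv"
  by (simp add: Wv_eq_words)

lemma linear_Wv: "w \<in> Wv \<Longrightarrow> linear w"
  by (auto simp: Wv_eq_words linear_word)

lemma bij_Wv: "w \<in> Wv \<Longrightarrow> bij w"
  by (auto simp: Wv_eq_words bij_word)

lemma Wv_comp: "w \<in> Wv \<Longrightarrow> w' \<in> Wv \<Longrightarrow> w \<circ> w' \<in> Wv"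
  unfolding Wv_eq_words by (auto simp: word_append[symmetric])

lemma id_in_Wv: "id \<in> Wv"
  using word_in_Wv[of "[]"] by simp

lemma refl_in_Wv: "simple_refl i \<in> Wv"
  using word_in_Wv[of "[i]"] by simp

lemma Wv_inv: assumes "w \<in> Wv" shows "inv_into UNIV w \<in> Wv"
proof -
  obtain xs where w: "w = word xs" using assms by (auto simp: Wv_eq_words)
  have "inv_into UNIV w = word (rev xs)"
    unfolding w by (rule inv_unique_comp[OF word_comp_rev word_rev_comp])
  then show ?thesis using word_in_Wv by simp
qed

lemma Wv_inv_apply [simp]: "w \<in> Wv \<Longrightarrow> inv_into UNIV w (w v) = v" "w \<in> Wv \<Longrightarrow> w (inv_into UNIV w v) = v"
  using bij_Wv by (simp_all add: bij_is_inj bij_is_surj surj_f_inv_f)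

definition wlen :: "('v \<Rightarrow> 'v) \<Rightarrow> nat"
  where "wlen z = (LEAST n. \<exists>xs. length xs = n \<and> word xs = z)"

lemma wlen_le: "wlen (word xs) \<le> length xs"
  unfolding wlen_def by (rule Least_le) auto

lemma reduced_word: assumes "z \<in> Wv" obtains xs where "word xs = z" "length xs = wlen z"
proof -
  obtain ys where "word ys = z" using assms by (auto simp: Wv_eq_words)
  then have "\<exists>n xs. length xs = n \<and> word xs = z" by auto
  from LeastI_ex[OF this] show ?thesis using that by (auto simp: wlen_def)
qed

lemma wlen_word_comp: assumes "z \<in> Wv" shows "wlen (word xs \<circ> z) \<le> length xs + wlen z"
proof -
  obtain ys where "word ys = z" "length ys = wlen z" using reduced_word[OF assms] .
  then show ?thesis using wlen_le[of "xs @ ys"] by (simp add: word_append)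
qed

primrec alt_word :: "'i \<Rightarrow> 'i \<Rightarrow> nat \<Rightarrow> 'i list" where
  "alt_word t s 0 = []"
| "alt_word t s (Suc k) = t # alt_word s t k"

lemma length_alt_word [simp]: "length (alt_word t s k) = k"
  by (induction k arbitrary: t s) auto

lemma alt_word_Suc: "alt_word t s (Suc k) = alt_word t s k @ [if even k then t else s]"
  by (induction k arbitrary: t s) auto

lemma alt_word_add: "\<exists>ys. alt_word t s (m + k) = alt_word t s m @ ys \<and> length ys = k"
proof (induction k)
  case (Suc k)
  then show ?case using alt_word_Suc[of t s "m + k"] by auto
qed simp

text \<open>Appending a letter changes the coordinates \<open>(p, q)\<close> of the root in the plane of \<open>\<alpha> s\<close> and \<open>\<alpha> t\<close> by a
  reflection of that plane. The two lemmas on rank two below follow the orbit of \<open>(1, 0)\<close>.\<close>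

lemma alt_word_root_Suc:
  assumes st: "s \<noteq> t" and ih: "\<And>v. \<alpha> s (word (alt_word t s k) v) = p * \<alpha> s v + q * \<alpha> t v"
  shows "\<alpha> s (word (alt_word t s (Suc k)) v) =
     (if even k then p * \<alpha> s v + (- cartan t s * p - q) * \<alpha> t v
      else (- cartan s t * q - p) * \<alpha> s v + q * \<alpha> t v)"
  by (simp only: alt_word_Suc word_append)
     (auto simp: ih root_refl cartan_diag algebra_simps)

text \<open>Positivity of the root \<open>\<alpha> s \<circ> w\<close> for \<open>w\<close> the alternating word with \<open>k\<close> letters that begins with \<open>t\<close>.\<close>

definition rank_two_pos :: "'i \<Rightarrow> 'i \<Rightarrow> nat \<Rightarrow> bool"
  where "rank_two_pos t s k \<longleftrightarrow> (\<exists>p q. p \<ge> 0 \<and> q \<ge> 0 \<and>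
     (\<forall>v. \<alpha> s (word (alt_word t s k) v) = p * \<alpha> s v + q * \<alpha> t v))"

text \<open>If the product of the two off-diagonal entries is at least 4, the coordinates stay nonnegative
  forever: with \<open>a = - cartan t s\<close>, the inequality \<open>2 q \<le> a p\<close> before an even step and the opposite one before an
  odd step reproduce each other.\<close>

lemma rank_two_infinite:
  assumes st: "s \<noteq> t" and ge: "cartan t s * cartan s t \<ge> 4"
  shows "rank_two_pos t s k"
proof -
  define a where "a = - cartan t s"
  define b where "b = - cartan s t"
  have ab: "a * b \<ge> 4" "a \<ge> 0" "b \<ge> 0"
    using ge cartan_nonpos[OF st] cartan_nonpos[OF st[symmetric]] by (simp_all add: a_def b_def)
  have "a \<noteq> 0" using ab(1) by auto
  then have a: "a > 0" using ab(2) by linarith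
  define good where "good k p q \<longleftrightarrow> p \<ge> 0 \<and> q \<ge> 0 \<and>
     (if even k then a * p \<ge> 2 * q else 2 * q \<ge> a * p) \<and>
     (\<forall>v. \<alpha> s (word (alt_word t s k) v) = p * \<alpha> s v + q * \<alpha> t v)" for k p q
  have "\<exists>p q. good k p q"
  proof (induction k)
    case 0
    have "good 0 1 0" using a by (simp add: good_def)
    then show ?case by blast
  next
    case (Suc k)
    then obtain p q where good: "good k p q" by blast
    then have pq: "p \<ge> 0" "q \<ge> 0"
      and root: "\<And>v. \<alpha> s (word (alt_word t s k) v) = p * \<alpha> s v + q * \<alpha> t v"
      by (simp_all only: good_def)
    note step = alt_word_root_Suc[OF st root]
    show ?case
    proof (cases "even k")
      case True
      have ap: "a * p \<ge> 2 * q" using good True by (simp only: good_def if_True)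
      have "a * p - q \<ge> 0" "a * p \<le> (a * p - q) + (a * p - q)" using ap pq(2) by linarith+
      then have "good (Suc k) p (a * p - q)"
        unfolding good_def step a_def[symmetric] mult_2 using pq(1) True by simp
      then show ?thesis by blast
    next
      case False
      have ap: "a * p \<le> 2 * q" using good False by (simp only: good_def if_False)
      have "a * b * q \<ge> 4 * q" using ab pq(2) by (intro mult_right_mono) auto
      moreover have "a * (b * q - p) = a * b * q - a * p" by (simp add: algebra_simps)
      ultimately have bq: "a * (b * q - p) \<ge> 2 * q" using ap by linarith
      then have "0 \<le> a * (b * q - p)" using pq(2) by linarith
      then have "b * q - p \<ge> 0" using a by (simp add: zero_le_mult_iff)
      then have "good (Suc k) (b * q - p) q"
        unfolding good_def step b_def[symmetric] using bq pq(2) False by simp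
      then show ?thesis by blast
    qed
  qed
  then obtain p q where "good k p q" by blast
  then have "p \<ge> 0 \<and> q \<ge> 0 \<and> (\<forall>v. \<alpha> s (word (alt_word t s k) v) = p * \<alpha> s v + q * \<alpha> t v)"
    unfolding good_def by (elim conjE) (intro conjI)
  then show ?thesis unfolding rank_two_pos_def by (intro exI)
qed

text \<open>The coroots need not be linearly independent, so the braid relation is checked
  on formal coordinates with respect to them.\<close>

lemma refl_plane:
  "simple_refl i (v + x *\<^sub>R \<alpha>v i + y *\<^sub>R \<alpha>v j) = v + (- x - \<alpha> i v - y * cartan j i) *\<^sub>R \<alpha>v i + y *\<^sub>R \<alpha>v j"
  "simple_refl j (v + x *\<^sub>R \<alpha>v i + y *\<^sub>R \<alpha>v j) = v + x *\<^sub>R \<alpha>v i + (- y - \<alpha> j v - x * cartan i j) *\<^sub>R \<alpha>v j"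
proof -
  have lin: "v + x *\<^sub>R a + y *\<^sub>R b - r *\<^sub>R a = v + (x - r) *\<^sub>R a + y *\<^sub>R b"
    "v + x *\<^sub>R b + y *\<^sub>R a - r *\<^sub>R a = v + x *\<^sub>R b + (y - r) *\<^sub>R a" for v a b :: 'v and x y r
    by (simp_all add: scaleR_diff_left)
  show "simple_refl i (v + x *\<^sub>R \<alpha>v i + y *\<^sub>R \<alpha>v j)
      = v + (- x - \<alpha> i v - y * cartan j i) *\<^sub>R \<alpha>v i + y *\<^sub>R \<alpha>v j"
    unfolding simple_refl_def lin root_add root_scale root_coroot cartan_diag
    by (rule arg_cong[where f = "\<lambda>c. v + c *\<^sub>R \<alpha>v i + y *\<^sub>R \<alpha>v j"]) simp
  show "simple_refl j (v + x *\<^sub>R \<alpha>v i + y *\<^sub>R \<alpha>v j)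
      = v + x *\<^sub>R \<alpha>v i + (- y - \<alpha> j v - x * cartan i j) *\<^sub>R \<alpha>v j"
    unfolding simple_refl_def lin root_add root_scale root_coroot cartan_diag
    by (rule arg_cong[where f = "\<lambda>c. v + x *\<^sub>R \<alpha>v i + c *\<^sub>R \<alpha>v j"]) simp
qed

text \<open>The remaining integral cases are the types \<open>A\<^sub>1 \<times> A\<^sub>1\<close>, \<open>A\<^sub>2\<close>, \<open>B\<^sub>2\<close> and \<open>G\<^sub>2\<close>. There \<open>m\<close> is the order of the
  product of the two reflections, and the alternating words with \<open>m\<close> letters satisfy the braid relation, so
  that a word of length \<open>m\<close> that begins with \<open>t\<close> can be shortened from the left by \<open>s\<close>.\<close>

lemma rank_two_finite:
  assumes st: "s \<noteq> t" and lt: "cartan t s * cartan s t < 4"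
  shows "\<exists>m\<ge>1. (\<forall>k<m. rank_two_pos t s k) \<and> word (alt_word t s m) = word (alt_word s t m)"
proof -
  define a where "a = - cartan t s"
  define b where "b = - cartan s t"
  have "a \<in> \<int>" "b \<in> \<int>" "a \<ge> 0" "b \<ge> 0"
    using cartan_int cartan_nonpos st by (auto simp: a_def b_def)
  have nat_of: "\<exists>n::nat. r = real n" if r: "r \<in> \<int>" "r \<ge> 0" for r :: real
  proof -
    obtain z where "r = of_int z" using r(1) by (rule Ints_cases)
    then show ?thesis using r(2) by (intro exI[of _ "nat z"]) simp
  qed
  obtain x where x: "a = real x" using nat_of[OF \<open>a \<in> \<int>\<close> \<open>a \<ge> 0\<close>] ..
  obtain y where y: "b = real y" using nat_of[OF \<open>b \<in> \<int>\<close> \<open>b \<ge> 0\<close>] ..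
  note xy = x y
  have "a * b < 4" using lt by (simp add: a_def b_def)
  then have "real (x * y) < real 4" using xy by simp
  then have "x * y < 4" by (simp only: of_nat_less_iff)
  have zz: "x = 0 \<longleftrightarrow> y = 0"
  proof -
    have "x = 0 \<longleftrightarrow> cartan t s = 0" "y = 0 \<longleftrightarrow> cartan s t = 0"
      using x y unfolding a_def b_def by (metis neg_equal_0_iff_equal of_nat_eq_0_iff)+
    then show ?thesis using cartan_zero[of t s] cartan_zero[of s t] by blast
  qed
  \<comment> \<open>The order of the product of the reflections, as a function of the product of the two entries.\<close>
  define m where "m = (if x = 0 then 2 else if x * y = 1 then 3 else if x * y = 2 then 4 else 6 :: nat)"
  have cases: "(a = 0 \<and> b = 0 \<and> m = 2) \<or> (a = 1 \<and> b = 1 \<and> m = 3) \<or> (a = 1 \<and> b = 2 \<and> m = 4)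
      \<or> (a = 2 \<and> b = 1 \<and> m = 4) \<or> (a = 1 \<and> b = 3 \<and> m = 6) \<or> (a = 3 \<and> b = 1 \<and> m = 6)"
  proof (cases "x = 0")
    case True then show ?thesis using zz xy by (simp add: m_def)
  next
    case False
    then have "y > 0" using zz by auto
    have "x \<le> x * y" "y \<le> x * y" using False \<open>y > 0\<close> by simp_all
    then have "x < 4" "y < 4" using \<open>x * y < 4\<close> by (blast intro: le_less_trans)+
    then have "x = 1 \<or> x = 2 \<or> x = 3" "y = 1 \<or> y = 2 \<or> y = 3"
      using False \<open>y > 0\<close> by auto
    then show ?thesis using \<open>x * y < 4\<close> unfolding x y m_def by (elim disjE) simp_all
  qed
  have car: "cartan t s = - a" "cartan s t = - b" by (simp_all add: a_def b_def)
  have pos: "rank_two_pos t s k" if "k < m" for k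
  proof -
    define coef where "coef k p q \<longleftrightarrow>
      (\<forall>v. \<alpha> s (word (alt_word t s k) v) = p * \<alpha> s v + q * \<alpha> t v)" for k p q
    have posI: "0 \<le> p \<Longrightarrow> 0 \<le> q \<Longrightarrow> rank_two_pos t s k" if "coef k p q" for k p q
      using that unfolding coef_def rank_two_pos_def by blast
    have even_step: "coef k p (a * p - q)" if "coef k' p q" "k = Suc k'" "even k'" for k k' p q
      using that alt_word_root_Suc[OF st, of k' p q] by (simp only: coef_def car) simp
    have odd_step: "coef k (b * q - p) q" if "coef k' p q" "k = Suc k'" "odd k'" for k k' p q
      using that alt_word_root_Suc[OF st, of k' p q] by (simp only: coef_def car) simp
    have c0: "coef 0 1 0" by (simp add: coef_def)
    have c1: "coef 1 1 (a * 1 - 0)" by (rule even_step[OF c0]) simp_all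
    have c2: "coef 2 (b * (a * 1 - 0) - 1) (a * 1 - 0)" by (rule odd_step[OF c1]) simp_all
    note c3 = even_step[OF c2, of 3, OF numeral_3_eq_3[unfolded numeral_2_eq_2[symmetric]] even_numeral]
    have n4: "4 = Suc 3" and n5: "5 = Suc 4" and o3: "odd (3::nat)" and e4: "even (4::nat)" by simp_all
    note c4 = odd_step[OF c3 n4 o3]
    note c5 = even_step[OF c4 n5 e4]
    have k6: "k = 0 \<or> k = 1 \<or> k = 2 \<or> k = 3 \<or> k = 4 \<or> k = 5"
    proof -
      have "m \<le> 6" by (simp add: m_def)
      then have "k < 6" using \<open>k < m\<close> by (rule less_le_trans[rotated])
      then show ?thesis by presburger
    qed
    have p0: "rank_two_pos t s 0" by (rule posI[OF c0]) simp_all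
    have p1: "rank_two_pos t s 1" by (rule posI[OF c1]) (use \<open>a \<ge> 0\<close> in simp_all)
    have p2: "rank_two_pos t s 2" if "a * b \<ge> 1"
      by (rule posI[OF c2]) (use \<open>a \<ge> 0\<close> that in \<open>simp_all add: mult.commute\<close>)
    have p3: "rank_two_pos t s 3" if "a * b = 2 \<or> a * b = 3"
    proof (rule posI[OF c3])
      show "0 \<le> b * (a * 1 - 0) - 1" using that by (auto simp: mult.commute)
      have "a * (b * (a * 1 - 0) - 1) - (a * 1 - 0) = a * (a * b - 2)" by (simp add: algebra_simps)
      then show "0 \<le> a * (b * (a * 1 - 0) - 1) - (a * 1 - 0)" using that \<open>a \<ge> 0\<close> by auto
    qed
    have p45: "rank_two_pos t s 4 \<and> rank_two_pos t s 5" if ab3: "a * b = 3"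
    proof -
      let ?p = "b * (a * (b * (a * 1 - 0) - 1) - (a * 1 - 0)) - (b * (a * 1 - 0) - 1)"
      let ?q = "a * (b * (a * 1 - 0) - 1) - (a * 1 - 0)"
      have "?p = (a * b) * (a * b) - 3 * (a * b) + 1" "?q = a * (a * b - 2)"
        by (simp_all add: algebra_simps)
      then have pq: "?p = 1" "?q = a" unfolding ab3 by simp_all
      have c4': "coef 4 1 a" and c5': "coef 5 1 (a * 1 - a)"
        using c4 c5 unfolding pq(1) unfolding pq(2) .
      have "rank_two_pos t s 4" by (rule posI[OF c4']) (use \<open>a \<ge> 0\<close> in simp_all)
      moreover have "rank_two_pos t s 5" by (rule posI[OF c5']) simp_all
      ultimately show ?thesis ..
    qed
    have mm: "m = 2 \<and> a * b = 0 \<or> m = 3 \<and> a * b = 1 \<or> m = 4 \<and> a * b = 2 \<or> m = 6 \<and> a * b = 3"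
      using cases by (elim disjE conjE) simp_all
    consider "k = 0" | "k = 1" | "k = 2" | "k = 3" | "k = 4 \<or> k = 5" using k6 by blast
    then show ?thesis
    proof cases
      case 3 then show ?thesis using mm \<open>k < m\<close> p2 by auto
    next
      case 4 then show ?thesis using mm \<open>k < m\<close> p3 by auto
    next
      case 5 then show ?thesis using mm \<open>k < m\<close> p45 by auto
    qed (simp_all add: p0 p1[unfolded One_nat_def])
  qed
  have braid: "word (alt_word t s m) = word (alt_word s t m)"
  proof
    fix v
    have rs0: "simple_refl s v = v + (- \<alpha> s v) *\<^sub>R \<alpha>v s + 0 *\<^sub>R \<alpha>v t"
      and rt0: "simple_refl t v = v + 0 *\<^sub>R \<alpha>v s + (- \<alpha> t v) *\<^sub>R \<alpha>v t"
      by (simp_all add: simple_refl_def)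
    have plane: "x = x' \<Longrightarrow> y = y' \<Longrightarrow>
        v + x *\<^sub>R \<alpha>v s + y *\<^sub>R \<alpha>v t = v + x' *\<^sub>R \<alpha>v s + y' *\<^sub>R \<alpha>v t" for x x' y y'
      by simp
    have rs: "simple_refl s (v + x *\<^sub>R \<alpha>v s + y *\<^sub>R \<alpha>v t)
        = v + (a * y - x - \<alpha> s v) *\<^sub>R \<alpha>v s + y *\<^sub>R \<alpha>v t"
      and rt: "simple_refl t (v + x *\<^sub>R \<alpha>v s + y *\<^sub>R \<alpha>v t)
        = v + x *\<^sub>R \<alpha>v s + (b * x - y - \<alpha> t v) *\<^sub>R \<alpha>v t" for x y
      unfolding refl_plane(1)[of s v x y t] refl_plane(2)[of t v x s y] car
      by (intro plane) simp_all
    have w2: "word (alt_word i j 2) = simple_refl i \<circ> simple_refl j"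
      and w3: "word (alt_word i j 3) = simple_refl i \<circ> simple_refl j \<circ> simple_refl i"
      and w4: "word (alt_word i j 4) = simple_refl i \<circ> simple_refl j \<circ> simple_refl i \<circ> simple_refl j"
      and w6: "word (alt_word i j 6) = simple_refl i \<circ> simple_refl j \<circ> simple_refl i \<circ> simple_refl j
        \<circ> simple_refl i \<circ> simple_refl j" for i j
      by (simp_all add: eval_nat_numeral fun_eq_iff)
    show "word (alt_word t s m) v = word (alt_word s t m) v"
      using cases
    proof (elim disjE conjE)
      assume *: "a = 0" "b = 0" "m = 2"
      show ?thesis unfolding *(3) w2 comp_apply rs0 rt0 rs rt
        by (rule plane) (simp_all add: *(1,2))
    next
      assume *: "a = 1" "b = 1" "m = 3"
      show ?thesis unfolding *(3) w3 comp_apply rs0 rt0 rs rt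
        by (rule plane) (simp_all add: *(1,2))
    next
      assume *: "a = 1" "b = 2" "m = 4"
      show ?thesis unfolding *(3) w4 comp_apply rs0 rt0 rs rt
        by (rule plane) (simp_all add: *(1,2))
    next
      assume *: "a = 2" "b = 1" "m = 4"
      show ?thesis unfolding *(3) w4 comp_apply rs0 rt0 rs rt
        by (rule plane) (simp_all add: *(1,2))
    next
      assume *: "a = 1" "b = 3" "m = 6"
      show ?thesis unfolding *(3) w6 comp_apply rs0 rt0 rs rt
        by (rule plane) (simp_all add: *(1,2))
    next
      assume *: "a = 3" "b = 1" "m = 6"
      show ?thesis unfolding *(3) w6 comp_apply rs0 rt0 rs rt
        by (rule plane) (simp_all add: *(1,2))
    qed
  qed
  show ?thesis
  proof (intro exI[of _ m] conjI allI impI)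
    show "m \<ge> 1" by (auto simp: m_def)
  qed (fact pos, fact braid)
qed

definition pos_comb :: "('v \<Rightarrow> real) \<Rightarrow> bool"
  where "pos_comb \<phi> \<longleftrightarrow> (\<exists>c. (\<forall>j. 0 \<le> c j) \<and> (\<forall>v. \<phi> v = (\<Sum>j\<in>UNIV. c j * \<alpha> j v)))"

lemma pos_comb_root: "pos_comb (\<alpha> i)"
  unfolding pos_comb_def
  by (rule exI[of _ "\<lambda>j. if j = i then 1 else 0"]) (auto simp: if_distrib[of "\<lambda>x. x * _"] cong: if_cong)

lemma pos_comb_lin:
  assumes "pos_comb \<phi>" "pos_comb \<psi>" "p \<ge> 0" "q \<ge> 0"
  shows "pos_comb (\<lambda>v. p * \<phi> v + q * \<psi> v)"
proof -
  from assms obtain c d where "\<forall>j. 0 \<le> c j" "\<forall>v. \<phi> v = (\<Sum>j\<in>UNIV. c j * \<alpha> j v)"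
    "\<forall>j. 0 \<le> d j" "\<forall>v. \<psi> v = (\<Sum>j\<in>UNIV. d j * \<alpha> j v)" unfolding pos_comb_def by blast
  then show ?thesis unfolding pos_comb_def using assms(3,4)
    by (intro exI[of _ "\<lambda>j. p * c j + q * d j"])
      (auto simp: sum_distrib_left sum.distrib algebra_simps)
qed

text \<open>Tits' theorem, by induction on the length of \<open>z\<close>. Strip from \<open>z\<close> a longest alternating word in \<open>s\<close> and
  the first letter \<open>t\<close> of a reduced word of \<open>z\<close>. The rest \<open>v\<close> is not shortened by \<open>s\<close> or \<open>t\<close>, so both \<open>\<alpha> s \<circ> v\<close>
  and \<open>\<alpha> t \<circ> v\<close> are nonnegative by induction, and the alternating word maps \<open>\<alpha> s\<close> to a nonnegative
  combination of the two by the analysis of rank two. The braid relation excludes that the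
  alternating word has \<open>m\<close> or more letters, since then \<open>simple_refl s\<close> would shorten \<open>z\<close>.\<close>

theorem root_pos_comb:
  assumes "z \<in> Wv" "wlen z \<le> wlen (simple_refl s \<circ> z)"
  shows "pos_comb (\<alpha> s \<circ> z)"
  using assms
proof (induction "wlen z" arbitrary: z s rule: less_induct)
  case less
  let ?n = "wlen z"
  obtain xs where xs: "word xs = z" "length xs = ?n" using reduced_word[OF less.prems(1)] .
  show ?case
  proof (cases xs)
    case Nil
    then show ?thesis using xs pos_comb_root by auto
  next
    case (Cons t ys)
    have st: "s \<noteq> t"
    proof
      assume "s = t"
      then have "simple_refl s \<circ> z = word ys" using xs(1) Cons by auto
      then have "wlen (simple_refl s \<circ> z) \<le> length ys" using wlen_le by metis
      then show False using less.prems xs Cons by simp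
    qed
    \<comment> \<open>\<open>D k\<close>: the alternating word with \<open>k\<close> letters can be stripped from \<open>z\<close> without loss of length.\<close>
    define D where "D k \<longleftrightarrow> (\<exists>v\<in>Wv. z = word (alt_word t s k) \<circ> v \<and> wlen v + k = ?n)" for k
    have D1: "D 1"
    proof -
      have "?n \<le> 1 + wlen (word ys)"
        using wlen_word_comp[OF word_in_Wv[of ys], of "[t]"] xs Cons by simp
      moreover have "wlen (word ys) \<le> length ys" by (rule wlen_le)
      ultimately show ?thesis unfolding D_def using xs Cons
        by (intro bexI[of _ "word ys"]) (auto simp: word_in_Wv)
    qed
    have Dn: "k \<le> ?n" if "D k" for k using that by (auto simp: D_def)
    define k where "k = Greatest D"
    have Dk: "D k" unfolding k_def by (rule GreatestI_nat[of D, OF D1 Dn])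
    have nD: "\<not> D (Suc k)" using Greatest_le_nat[of D "Suc k" ?n] Dn by (force simp: k_def)
    have k1: "k \<ge> 1" unfolding k_def by (rule Greatest_le_nat[of D, OF D1 Dn])
    then obtain k' where k': "k = Suc k'" by (cases k) auto
    obtain v where v: "v \<in> Wv" "z = word (alt_word t s k) \<circ> v" "wlen v + k = ?n"
      using Dk by (auto simp: D_def)
    define x where "x = (if even k then t else s)"
    define y where "y = (if even k' then t else s)"
    \<comment> \<open>\<open>x\<close> would be the next letter to strip, so this is maximality of \<open>k\<close>; \<open>y\<close> is the last stripped letter.\<close>
    have xl: "wlen v \<le> wlen (simple_refl x \<circ> v)"
    proof (rule ccontr)
      assume less: "\<not> ?thesis"
      have mem: "simple_refl x \<circ> v \<in> Wv" by (intro Wv_comp refl_in_Wv v)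
      have "z = word (alt_word t s (Suc k)) \<circ> (simple_refl x \<circ> v)"
        by (simp only: alt_word_Suc word_append) (simp add: v(2) x_def comp_assoc del: alt_word.simps)
      moreover have "wlen (simple_refl x \<circ> v) + Suc k = ?n"
      proof -
        have "?n \<le> Suc k + wlen (simple_refl x \<circ> v)"
          using wlen_word_comp[OF mem, of "alt_word t s (Suc k)"] calculation
          by (simp del: alt_word.simps)
        then show ?thesis using less v(3) by simp
      qed
      ultimately show False using nD mem by (auto simp: D_def)
    qed
    have yl: "wlen v \<le> wlen (simple_refl y \<circ> v)"
    proof -
      have mem: "simple_refl y \<circ> v \<in> Wv" by (intro Wv_comp refl_in_Wv v)
      have "z = word (alt_word t s k') \<circ> (simple_refl y \<circ> v)"
        using v(2) unfolding k' by (simp only: alt_word_Suc word_append) (simp add: y_def comp_assoc)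
      then have "?n \<le> k' + wlen (simple_refl y \<circ> v)"
        using wlen_word_comp[OF mem, of "alt_word t s k'"] by simp
      then show ?thesis using v(3) k' by simp
    qed
    have vlt: "wlen v < ?n" using v(3) k1 by simp
    have px: "pos_comb (\<alpha> x \<circ> v)" and py: "pos_comb (\<alpha> y \<circ> v)"
      using less.hyps[OF vlt v(1)] xl yl by auto
    have "{x, y} = {s, t}" by (auto simp: x_def y_def k')
    then have ps: "pos_comb (\<alpha> s \<circ> v)" and pt: "pos_comb (\<alpha> t \<circ> v)"
      using px py by (auto simp: doubleton_eq_iff)
    have "rank_two_pos t s k"
    proof (cases "cartan t s * cartan s t < 4")
      case False
      then show ?thesis using rank_two_infinite[OF st] by simp
    next
      case True
      then obtain m where m: "m \<ge> 1" "\<forall>k<m. rank_two_pos t s k"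
        "word (alt_word t s m) = word (alt_word s t m)" using rank_two_finite[OF st] by blast
      have "k < m"
      proof (rule ccontr)
        assume "\<not> k < m"
        then obtain ys where ys: "alt_word t s k = alt_word t s m @ ys" "length ys = k - m"
          using alt_word_add[of t s m "k - m"] by auto
        obtain m' where m': "m = Suc m'" using m(1) by (cases m) auto
        have "simple_refl s \<circ> z = word (alt_word t s m' @ ys) \<circ> v"
        proof -
          have "z = word (alt_word s t m) \<circ> (word ys \<circ> v)"
            using v(2) m(3) ys(1) by (simp only: word_append comp_assoc)
          then show ?thesis by (simp add: word_append m' comp_assoc del: word.simps(1))
        qed
        then have "wlen (simple_refl s \<circ> z) \<le> m' + (k - m) + wlen v"
          using wlen_word_comp[OF v(1), of "alt_word t s m' @ ys"] ys(2) by simp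
        then show False using less.prems(2) v(3) m' \<open>\<not> k < m\<close> by simp
      qed
      then show ?thesis using m by blast
    qed
    then obtain p q where pq: "p \<ge> 0" "q \<ge> 0"
      "\<And>v. \<alpha> s (word (alt_word t s k) v) = p * \<alpha> s v + q * \<alpha> t v"
      unfolding rank_two_pos_def by blast
    then have "\<alpha> s \<circ> z = (\<lambda>u. p * (\<alpha> s \<circ> v) u + q * (\<alpha> t \<circ> v) u)"
      using v(2) by auto
    then show ?thesis using pos_comb_lin[OF ps pt pq(1,2)] by simp
  qed
qed

section \<open>Chambers and panels\<close>

lemma fundamental_chamber_mem: "v \<in> Fv {} \<longleftrightarrow> (\<forall>i. \<alpha> i v > 0)"
  by (simp add: Fv_def)

lemma fundamental_chamber_nonempty: "Fv {} \<noteq> {}"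
proof (rule ccontr)
  assume "\<not> ?thesis"
  then have "\<nexists>v. \<forall>i. \<alpha> i v > 0" by (auto simp: Fv_def)
  from gordan_alternative[OF linear_root this] roots_independent show False by metis
qed

lemma root_comp_Wv_nonzero: assumes "z \<in> Wv" shows "\<exists>v. \<alpha> s (z v) \<noteq> 0"
  using assms by (intro exI[of _ "inv_into UNIV z (\<alpha>v s)"]) (simp add: root_coroot cartan_diag)

lemma pos_comb_positive:
  assumes "pos_comb \<phi>" "\<phi> u \<noteq> 0" "v \<in> Fv {}"
  shows "\<phi> v > 0"
proof -
  obtain c where c: "\<forall>j. 0 \<le> c j" "\<forall>v. \<phi> v = (\<Sum>j\<in>UNIV. c j * \<alpha> j v)"
    using assms(1) unfolding pos_comb_def by blast
  obtain j where j: "c j \<noteq> 0"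
    using assms(2) c(2) by (metis (mono_tags, lifting) mult_zero_left sum.neutral)
  have "0 < c j * \<alpha> j v" using j c(1) assms(3)
    by (simp add: fundamental_chamber_mem order_less_le)
  also have "c j * \<alpha> j v \<le> (\<Sum>j\<in>UNIV. c j * \<alpha> j v)"
    using c(1) assms(3) by (intro member_le_sum) (auto simp: fundamental_chamber_mem less_imp_le)
  finally show ?thesis using c(2) by simp
qed

text \<open>One of \<open>z\<close> and \<open>simple_refl s \<circ> z\<close> is not shortened by \<open>s\<close>, and \<open>\<alpha> s\<close> takes opposite values on them.\<close>

lemma root_sign_on_chamber:
  assumes z: "z \<in> Wv"
  shows "(\<forall>v\<in>Fv {}. \<alpha> s (z v) > 0) \<or> (\<forall>v\<in>Fv {}. \<alpha> s (z v) < 0)"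
proof (cases "wlen z \<le> wlen (simple_refl s \<circ> z)")
  case True
  then have "pos_comb (\<alpha> s \<circ> z)" by (rule root_pos_comb[OF z])
  then show ?thesis using pos_comb_positive root_comp_Wv_nonzero[OF z, of s] by fastforce
next
  case False
  define z' where "z' = simple_refl s \<circ> z"
  have z': "z' \<in> Wv" unfolding z'_def by (intro Wv_comp refl_in_Wv z)
  have "simple_refl s \<circ> z' = z" unfolding z'_def by simp
  then have pc: "pos_comb (\<alpha> s \<circ> z')" using False root_pos_comb[OF z', of s] by (simp add: z'_def)
  obtain u where u: "\<alpha> s (z u) \<noteq> 0" using root_comp_Wv_nonzero[OF z] by blast
  have eq: "(\<alpha> s \<circ> z') v = - \<alpha> s (z v)" for v
    by (simp add: z'_def root_refl cartan_diag)
  have "\<alpha> s (z v) < 0" if "v \<in> Fv {}" for v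
    using pos_comb_positive[OF pc _ that, of u] u unfolding eq by simp
  then show ?thesis by blast
qed

text \<open>Otherwise the first letter \<open>s\<close> of a reduced word of \<open>w\<close> gives a simple root that is positive at \<open>v\<close> after the
  remaining letters are applied, hence negative at \<open>w v\<close>.\<close>

theorem chamber_stabilizer_trivial:
  assumes w: "w \<in> Wv" and v: "v \<in> Fv {}" "w v \<in> Fv {}"
  shows "w = id"
proof -
  obtain xs where xs: "word xs = w" "length xs = wlen w" using reduced_word[OF w] .
  show ?thesis
  proof (cases xs)
    case Nil
    then show ?thesis using xs(1) by (simp only: word.simps)
  next
    case (Cons s ys)
    define z where "z = word ys"
    have z: "z \<in> Wv" by (simp add: z_def word_in_Wv)
    have w_eq: "w = simple_refl s \<circ> z" using xs(1) Cons by (simp only: word.simps z_def)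
    have "wlen z \<le> wlen (simple_refl s \<circ> z)"
      using wlen_le[of ys] xs(2) Cons by (simp add: z_def[symmetric] w_eq[symmetric])
    then have pc: "pos_comb (\<alpha> s \<circ> z)" by (rule root_pos_comb[OF z])
    obtain u where "\<alpha> s (z u) \<noteq> 0" using root_comp_Wv_nonzero[OF z] by blast
    then have "\<alpha> s (z v) > 0" using pos_comb_positive[OF pc _ v(1), of u] by simp
    moreover have "\<alpha> s (w v) = - \<alpha> s (z v)" by (simp add: w_eq root_refl cartan_diag)
    moreover have "\<alpha> s (w v) > 0" using v(2) by (simp add: fundamental_chamber_mem)
    ultimately show ?thesis by simp
  qed
qed

text \<open>The chambers of both signs, by inequalities; \<open>e\<close> is the sign.\<close>

definition signed_chamber :: "real \<Rightarrow> ('v \<Rightarrow> 'v) \<Rightarrow> 'v set"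
  where "signed_chamber e w = {v. \<forall>i. 0 < e * \<alpha> i (inv_into UNIV w v)}"

lemma Wv_image_eq: "w \<in> Wv \<Longrightarrow> w ` A = {v. inv_into UNIV w v \<in> A}"
  using bij_image_Collect_eq[of w "\<lambda>v. v \<in> A"] bij_Wv by simp

lemma image_fundamental_chamber:
  assumes "w \<in> Wv"
  shows "w ` Fv {} = signed_chamber 1 w" "uminus ` w ` Fv {} = signed_chamber (- 1) w"
proof -
  show 1: "w ` Fv {} = signed_chamber 1 w"
    by (simp add: Wv_image_eq assms signed_chamber_def fundamental_chamber_mem)
  have "uminus ` A = {v. - v \<in> A}" for A :: "'v set"
    by (auto simp: image_iff) (metis minus_minus)
  then show "uminus ` w ` Fv {} = signed_chamber (- 1) w"
    by (simp add: 1 signed_chamber_def linear_neg[OF linear_Wv[OF Wv_inv[OF assms]]] root_minus)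
qed

lemma vectorial_chambers_eq:
  "vectorial_chambers = {signed_chamber e w |e w. (e = 1 \<or> e = -1) \<and> w \<in> Wv}"
proof -
  have "vectorial_chambers = (\<lambda>w. w ` Fv {}) ` Wv \<union> (\<lambda>w. uminus ` w ` Fv {}) ` Wv"
    unfolding vectorial_chambers_def faces_of_type_def positive_faces_def by auto
  also have "\<dots> = signed_chamber 1 ` Wv \<union> signed_chamber (- 1) ` Wv"
    by (intro arg_cong2[where f = "(\<union>)"] image_cong refl image_fundamental_chamber)
  finally show ?thesis by auto
qed

lemma chamberE:
  assumes "D \<in> vectorial_chambers"
  obtains e w where "e = 1 \<or> e = (-1::real)" "w \<in> Wv" "D = signed_chamber e w"
  using assms unfolding vectorial_chambers_eq by blast

lemma signed_chamber_mem:
  assumes "e = 1 \<or> e = (-1::real)" "w \<in> Wv"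
  shows "v \<in> signed_chamber e w \<longleftrightarrow> e *\<^sub>R inv_into UNIV w v \<in> Fv {}"
  by (simp add: signed_chamber_def fundamental_chamber_mem root_scale)

lemma fundamental_chamber: "Fv {} \<in> vectorial_chambers"
  unfolding vectorial_chambers_def faces_of_type_def positive_faces_def
  using id_in_Wv by (auto intro!: exI[of _ id])

lemma chamber_image: assumes "D \<in> vectorial_chambers" "u \<in> Wv" shows "u ` D \<in> vectorial_chambers"
proof -
  obtain e w where D: "e = 1 \<or> e = (-1::real)" "w \<in> Wv" "D = signed_chamber e w"
    using chamberE[OF assms(1)] .
  have "inv_into UNIV (u \<circ> w) = inv_into UNIV w \<circ> inv_into UNIV u"
    using assms(2) D(2) bij_Wv by (simp add: o_inv_distrib)
  then have "u ` D = signed_chamber e (u \<circ> w)"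
    by (simp add: Wv_image_eq assms(2) D(3) signed_chamber_def)
  then show ?thesis unfolding vectorial_chambers_eq using D(1,2) Wv_comp[OF assms(2)] by blast
qed

lemma chamber_uminus: assumes "D \<in> vectorial_chambers" shows "uminus ` D \<in> vectorial_chambers"
proof -
  have "uminus ` uminus ` A = A" for A :: "'v set" by (simp add: image_image)
  then show ?thesis using assms unfolding vectorial_chambers_def faces_of_type_def by auto
qed

lemma continuous_on_Wv_root: "w \<in> Wv \<Longrightarrow> continuous_on A (\<lambda>v. \<alpha> i (w v))"
  using linear_compose[OF linear_Wv linear_root, of w i]
  by (intro linear_continuous_on linear_conv_bounded_linear[THEN iffD1]) (simp add: comp_def)

lemma chamber_open: assumes "D \<in> vectorial_chambers" shows "open D"
proof -
  obtain e w where D: "e = 1 \<or> e = (-1::real)" "w \<in> Wv" "D = signed_chamber e w"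
    using chamberE[OF assms] .
  have "D = (\<Inter>i. {v. 0 < e * \<alpha> i (inv_into UNIV w v)})" by (auto simp: D(3) signed_chamber_def)
  moreover have "open {v. 0 < e * \<alpha> i (inv_into UNIV w v)}" for i
    by (intro open_Collect_less continuous_intros continuous_on_Wv_root Wv_inv D(2))
  ultimately show ?thesis by auto
qed

lemma chamber_scale: assumes "D \<in> vectorial_chambers" "d \<in> D" "t > 0" shows "t *\<^sub>R d \<in> D"
proof -
  obtain e w where D: "e = 1 \<or> e = (-1::real)" "w \<in> Wv" "D = signed_chamber e w"
    using chamberE[OF assms(1)] .
  have "e * \<alpha> i (inv_into UNIV w (t *\<^sub>R d)) = t * (e * \<alpha> i (inv_into UNIV w d))" for i
    by (simp add: linear_scale[OF linear_Wv[OF Wv_inv[OF D(2)]]] root_scale)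
  then show ?thesis using assms(2,3) by (simp only: D(3) signed_chamber_def mem_Collect_eq) simp
qed

lemma chamber_add: assumes "D \<in> vectorial_chambers" "d \<in> D" "d' \<in> D" shows "d + d' \<in> D"
proof -
  obtain e w where D: "e = 1 \<or> e = (-1::real)" "w \<in> Wv" "D = signed_chamber e w"
    using chamberE[OF assms(1)] .
  have "e * \<alpha> i (inv_into UNIV w (d + d'))
      = e * \<alpha> i (inv_into UNIV w d) + e * \<alpha> i (inv_into UNIV w d')" for i
    by (simp add: linear_add[OF linear_Wv[OF Wv_inv[OF D(2)]]] root_add distrib_left)
  then show ?thesis using assms(2,3) by (simp add: D(3) signed_chamber_def add_pos_pos)
qed

lemma chamber_nonempty: assumes "D \<in> vectorial_chambers" shows "D \<noteq> {}"
proof -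
  have "A \<noteq> {}" if "A \<in> positive_faces {}" for A
    using that fundamental_chamber_nonempty by (auto simp: positive_faces_def)
  then show ?thesis using assms unfolding vectorial_chambers_def faces_of_type_def by auto
qed

lemma chamber_root_sign:
  assumes "D \<in> vectorial_chambers" "u \<in> Wv"
  shows "(\<forall>v\<in>D. \<alpha> s (u v) > 0) \<or> (\<forall>v\<in>D. \<alpha> s (u v) < 0)"
proof -
  obtain e w where D: "e = 1 \<or> e = (-1::real)" "w \<in> Wv" "D = signed_chamber e w"
    using chamberE[OF assms(1)] .
  have c: "e *\<^sub>R inv_into UNIV w v \<in> Fv {}" if "v \<in> D" for v
    using that signed_chamber_mem D by simp
  have eq: "\<alpha> s ((u \<circ> w) (e *\<^sub>R inv_into UNIV w v)) = e * \<alpha> s (u v)" for v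
    by (simp add: linear_scale[OF linear_Wv] D(2) assms(2) root_scale)
  have "(\<forall>v\<in>D. e * \<alpha> s (u v) > 0) \<or> (\<forall>v\<in>D. e * \<alpha> s (u v) < 0)"
    using root_sign_on_chamber[OF Wv_comp[OF assms(2) D(2)], of s] c eq by metis
  then show ?thesis using D(1) by auto
qed

text \<open>The walls of \<open>D\<close> are kernels of real roots, and these have a constant sign on \<open>D'\<close>. In particular a
  positive and a negative chamber that meet are the same set.\<close>

lemma chamber_subset_if_meet:
  assumes D: "D \<in> vectorial_chambers" and D': "D' \<in> vectorial_chambers" and v: "v \<in> D" "v \<in> D'"
  shows "D' \<subseteq> D"
proof
  fix v' assume v': "v' \<in> D'"
  obtain e w where ew: "e = 1 \<or> e = (-1::real)" "w \<in> Wv" "D = signed_chamber e w"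
    using chamberE[OF D] .
  have "0 < e * \<alpha> i (inv_into UNIV w v')" for i
  proof -
    have "0 < e * \<alpha> i (inv_into UNIV w v)" using v(1) ew(3) by (simp add: signed_chamber_def)
    then show ?thesis using chamber_root_sign[OF D' Wv_inv[OF ew(2)], of i] v(2) v' ew(1)
      by (metis mult_1 mult_minus1 neg_0_less_iff_less order_less_asym)
  qed
  then show "v' \<in> D" by (simp add: ew(3) signed_chamber_def)
qed

lemma chambers_equal_if_meet:
  assumes "D \<in> vectorial_chambers" "D' \<in> vectorial_chambers" "v \<in> D" "v \<in> D'"
  shows "D = D'"
  using chamber_subset_if_meet[OF assms] chamber_subset_if_meet[OF assms(2,1,4,3)] by simp

lemma chamber_stabilizer:
  assumes D: "D \<in> vectorial_chambers" and u: "u \<in> Wv" and d: "d \<in> D" "u d \<in> D"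
  shows "u = id"
proof -
  obtain e w where ew: "e = 1 \<or> e = (-1::real)" "w \<in> Wv" "D = signed_chamber e w"
    using chamberE[OF D] .
  let ?c = "e *\<^sub>R inv_into UNIV w d"
  let ?u = "inv_into UNIV w \<circ> (u \<circ> w)"
  have u': "?u \<in> Wv" by (intro Wv_comp Wv_inv ew u)
  have "?u ?c = e *\<^sub>R inv_into UNIV w (u d)"
    by (simp add: linear_scale[OF linear_Wv] Wv_inv ew(2) u)
  moreover have "?c \<in> Fv {}" "e *\<^sub>R inv_into UNIV w (u d) \<in> Fv {}"
    using d signed_chamber_mem ew by simp_all
  ultimately have *: "?u = id" using chamber_stabilizer_trivial[OF u', of ?c] by simp
  show "u = id"
  proof
    fix v
    have "?u (inv_into UNIV w v) = inv_into UNIV w v" unfolding * by simp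
    then have "inv_into UNIV w (u v) = inv_into UNIV w v" by (simp add: ew(2))
    then show "u v = id v" by (metis Wv_inv_apply(2) ew(2) id_apply)
  qed
qed

lemma panel_mem: "v \<in> Fv {i} \<longleftrightarrow> \<alpha> i v = 0 \<and> (\<forall>j. j \<noteq> i \<longrightarrow> \<alpha> j v > 0)"
  by (auto simp: Fv_def)

lemma panel_nonempty: "Fv {i} \<noteq> {}"
proof -
  obtain c where c: "c \<in> Fv {}" using fundamental_chamber_nonempty by blast
  define p where "p = c - (\<alpha> i c / 2) *\<^sub>R \<alpha>v i"
  have "\<alpha> j p > 0" if "j \<noteq> i" for j
  proof -
    have "\<alpha> i c * cartan i j \<le> 0"
      using c cartan_nonpos[of i j] that by (simp add: fundamental_chamber_mem mult_nonneg_nonpos less_imp_le)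
    moreover have "\<alpha> j c > 0" using c by (simp add: fundamental_chamber_mem)
    ultimately show ?thesis by (simp add: p_def root_diff root_scale root_coroot)
  qed
  moreover have "\<alpha> i p = 0" by (simp add: p_def root_diff root_scale root_coroot cartan_diag)
  ultimately have "p \<in> Fv {i}" by (simp add: panel_mem)
  then show ?thesis by blast
qed

text \<open>The open set on which, near the panel of type \<open>i\<close>, only the root \<open>\<alpha> i\<close> can change its sign.\<close>

definition away :: "'i \<Rightarrow> 'v set"
  where "away i = {v. \<forall>j. j \<noteq> i \<longrightarrow> \<alpha> j v > 0}"

lemma continuous_on_root: "continuous_on A (\<alpha> i)"
  using continuous_on_Wv_root[OF id_in_Wv] by simp

lemma open_away: "open (away i)"
proof -
  have "away i = (\<Inter>j\<in>- {i}. {v. 0 < \<alpha> j v})" by (auto simp: away_def)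
  moreover have "open {v. 0 < \<alpha> j v}" for j
    by (intro open_Collect_less continuous_intros continuous_on_root)
  ultimately show ?thesis by auto
qed

text \<open>Near \<open>p\<close> a chamber lies on one side of the wall of \<open>\<alpha> i\<close>, and there it meets \<open>Fv {}\<close> or its reflection.\<close>

lemma chambers_at_panel:
  assumes D: "D \<in> vectorial_chambers" and p: "p \<in> Fv {i}" "p \<in> closure D"
  shows "D = Fv {} \<or> D = simple_refl i ` Fv {}"
proof -
  let ?U = "away i \<inter> simple_refl i -` away i"
  have "open ?U"
    by (intro open_Int open_away open_vimage linear_continuous_on
        linear_conv_bounded_linear[THEN iffD1] linear_refl)
  moreover have "simple_refl i p = p" using p(1) by (simp add: panel_mem simple_refl_def)
  then have "p \<in> ?U" using p(1) by (simp add: panel_mem away_def)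
  ultimately have "?U \<inter> D \<noteq> {}"
    using p(2) open_Int_closure_eq_empty[of ?U D] by blast
  then obtain q where q: "q \<in> away i" "simple_refl i q \<in> away i" "q \<in> D" by blast
  have "\<alpha> i q \<noteq> 0" using chamber_root_sign[OF D id_in_Wv, of i] q(3) by force
  then consider "\<alpha> i q > 0" | "\<alpha> i (simple_refl i q) > 0"
    by (simp add: root_refl cartan_diag) linarith
  then show ?thesis
  proof cases
    case 1
    then have "q \<in> Fv {}" using q(1) by (auto simp: fundamental_chamber_mem away_def)
    then show ?thesis using chambers_equal_if_meet[OF D fundamental_chamber q(3)] by blast
  next
    case 2
    then have "simple_refl i q \<in> Fv {}" using q(2) by (auto simp: fundamental_chamber_mem away_def)
    then have "simple_refl i (simple_refl i q) \<in> simple_refl i ` Fv {}" by blast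
    then have "q \<in> simple_refl i ` Fv {}" by simp
    then show ?thesis
      using chambers_equal_if_meet[OF D chamber_image[OF fundamental_chamber refl_in_Wv] q(3)] by blast
  qed
qed

section \<open>Coroots and the affine Weyl group\<close>

text \<open>If \<open>u\<close> maps the root \<open>\<alpha> i\<close> to \<open>\<alpha> j\<close>, then \<open>r\<^sub>j u r\<^sub>i u\<^sup>-\<^sup>1\<close> is the transvection \<open>v \<mapsto> v + \<alpha> j v c\<close>, where \<open>c\<close>
  is the difference of the two candidates for the coroot. Close to the panel of type \<open>j\<close> it maps a point of
  the fundamental chamber into that chamber, so it is the identity and \<open>c = 0\<close>.\<close>

lemma coroot_unique:
  assumes w: "w \<in> Wv" "w' \<in> Wv" and eq: "\<alpha> i \<circ> inv_into UNIV w = \<alpha> j \<circ> inv_into UNIV w'"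
  shows "w (\<alpha>v i) = w' (\<alpha>v j)"
proof -
  define u where "u = inv_into UNIV w' \<circ> w"
  define u' where "u' = inv_into UNIV w \<circ> w'"
  have u: "u \<in> Wv" "u' \<in> Wv" unfolding u_def u'_def by (intro Wv_comp Wv_inv w)+
  have uu': "u (u' v) = v" "u' (u v) = v" for v by (simp_all add: u_def u'_def w)
  have root: "\<alpha> i (u' v) = \<alpha> j v" for v
    using fun_cong[OF eq, of "w' v"] by (simp add: u'_def w)
  define c where "c = \<alpha>v j - u (\<alpha>v i)"
  have "\<alpha> j (u (\<alpha>v i)) = 2" using root[of "u (\<alpha>v i)"] by (simp add: uu' root_coroot cartan_diag)
  then have jc: "\<alpha> j c = 0" by (simp add: c_def root_diff root_coroot cartan_diag)
  define g where "g = simple_refl j \<circ> (u \<circ> (simple_refl i \<circ> u'))"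
  have g: "g \<in> Wv" unfolding g_def by (intro Wv_comp refl_in_Wv u)
  have g_apply: "g v = v + \<alpha> j v *\<^sub>R c" for v
  proof -
    have "u (simple_refl i (u' v)) = v - \<alpha> j v *\<^sub>R u (\<alpha>v i)"
      by (simp add: simple_refl_def linear_diff[OF linear_Wv] linear_scale[OF linear_Wv] u uu' root)
    also have "simple_refl j \<dots> = v + \<alpha> j v *\<^sub>R c"
      using \<open>\<alpha> j (u (\<alpha>v i)) = 2\<close>
      by (simp add: simple_refl_def root_diff root_scale c_def algebra_simps)
    finally show ?thesis by (simp add: g_def)
  qed
  obtain p where p: "p \<in> Fv {j}" using panel_nonempty by blast
  then have pa: "p \<in> away j" by (simp add: panel_mem away_def)
  obtain e1 where e1: "e1 > 0" "\<And>s. \<bar>s\<bar> \<le> e1 \<Longrightarrow> p + s *\<^sub>R \<alpha>v j \<in> away j"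
    using open_small_step[OF open_away pa] by blast
  obtain e2 where e2: "e2 > 0" "\<And>s. \<bar>s\<bar> \<le> e2 \<Longrightarrow> p + s *\<^sub>R (\<alpha>v j + 2 *\<^sub>R c) \<in> away j"
    using open_small_step[OF open_away pa] by blast
  define e where "e = min e1 e2"
  have e: "e > 0" "\<bar>e\<bar> \<le> e1" "\<bar>e\<bar> \<le> e2" using e1(1) e2(1) by (auto simp: e_def)
  define x where "x = p + e *\<^sub>R \<alpha>v j"
  have jp: "\<alpha> j p = 0" using p by (simp add: panel_mem)
  have jx: "\<alpha> j x = 2 * e" by (simp add: x_def root_add root_scale root_coroot cartan_diag jp)
  have gx: "g x = p + e *\<^sub>R (\<alpha>v j + 2 *\<^sub>R c)"
    by (simp add: g_apply jx) (simp add: x_def algebra_simps)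
  have jgx: "\<alpha> j (g x) = 2 * e" by (simp add: g_apply root_add root_scale jc jx)
  have C: "v \<in> Fv {}" if "v \<in> away j" "\<alpha> j v = 2 * e" for v
    using that e(1) unfolding fundamental_chamber_mem away_def by (metis (mono_tags, lifting) mem_Collect_eq zero_less_mult_iff zero_less_numeral)
  \<comment> \<open>Both points have the small value \<open>2 e\<close> under \<open>\<alpha> j\<close> and are so close to \<open>p\<close> that the other simple roots stay
    positive on them.\<close>
  have "x \<in> Fv {}" using C[OF _ jx] e1(2)[OF e(2)] by (simp add: x_def)
  moreover have "g x \<in> Fv {}" using C[OF _ jgx] e2(2)[OF e(3)] by (simp add: gx)
  ultimately have "g = id" by (rule chamber_stabilizer_trivial[OF g])
  then have "x + \<alpha> j x *\<^sub>R c = x" using g_apply[of x] by simp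
  then have "c = 0" using e(1) by (simp add: jx)
  then have "u (\<alpha>v i) = \<alpha>v j" by (simp add: c_def)
  then have "w' (u (\<alpha>v i)) = w' (\<alpha>v j)" by simp
  then show ?thesis by (simp add: u_def w)
qed

lemma coroot_apply:
  assumes "w \<in> Wv" shows "coroot (\<alpha> i \<circ> inv_into UNIV w) = w (\<alpha>v i)"
  unfolding coroot_def
proof (rule the_equality)
  show "\<exists>w'\<in>Wv. \<exists>j. \<alpha> i \<circ> inv_into UNIV w = \<alpha> j \<circ> inv_into UNIV w' \<and> w (\<alpha>v i) = w' (\<alpha>v j)"
    using assms by blast
next
  fix c assume "\<exists>w'\<in>Wv. \<exists>j. \<alpha> i \<circ> inv_into UNIV w = \<alpha> j \<circ> inv_into UNIV w' \<and> c = w' (\<alpha>v j)"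
  then show "c = w (\<alpha>v i)" using coroot_unique[OF assms] by auto
qed

lemma affine_refl_form:
  assumes "\<beta> \<in> real_roots"
  obtains u t where "u \<in> Wv" "\<And>v. affine_refl \<beta> k v = u v + t"
proof -
  obtain w i where w: "w \<in> Wv" "\<beta> = \<alpha> i \<circ> inv_into UNIV w"
    using assms by (auto simp: real_roots_def)
  have "affine_refl \<beta> k v = (w \<circ> (simple_refl i \<circ> inv_into UNIV w)) v + (- k) *\<^sub>R w (\<alpha>v i)" for v
    by (simp add: affine_refl_def w(2) coroot_apply[OF w(1)] simple_refl_def
        linear_diff[OF linear_Wv[OF w(1)]] linear_scale[OF linear_Wv[OF w(1)]] w(1) algebra_simps)
  moreover have "w \<circ> (simple_refl i \<circ> inv_into UNIV w) \<in> Wv"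
    by (intro Wv_comp refl_in_Wv Wv_inv w)
  ultimately show thesis using that by blast
qed

lemma bij_Wv_affine:
  assumes "u \<in> Wv" "\<And>v. f v = u v + t" shows "bij f" "inv_into UNIV f v = inv_into UNIV u (v - t)"
proof -
  have "f = (\<lambda>v. v + t) \<circ> u" using assms(2) by auto
  then show "bij f" using bij_comp[OF bij_Wv[OF assms(1)] bij_plus_right[of t]] by simp
  then show "inv_into UNIV f v = inv_into UNIV u (v - t)"
    by (intro inv_f_eq bij_is_inj) (simp_all add: assms)
qed

lemma Wv_affine_inv:
  assumes "u \<in> Wv" "\<And>v. f v = u v + t"
  shows "\<exists>u'\<in>Wv. \<exists>t'. \<forall>v. inv_into UNIV f v = u' v + t'"
  by (intro bexI[of _ "inv_into UNIV u"] exI[of _ "- inv_into UNIV u t"])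
    (simp_all add: bij_Wv_affine(2)[OF assms] linear_diff[OF linear_Wv] Wv_inv assms(1))

lemma BijGroup_UNIV:
  "f \<in> carrier (BijGroup UNIV) \<longleftrightarrow> bij (f :: 'v \<Rightarrow> 'v)"
  "bij f \<Longrightarrow> bij g \<Longrightarrow> f \<otimes>\<^bsub>BijGroup UNIV\<^esub> g = f \<circ> (g :: 'v \<Rightarrow> 'v)"
  "\<one>\<^bsub>BijGroup UNIV\<^esub> = (id :: 'v \<Rightarrow> 'v)"
  by (simp_all add: BijGroup_def Bij_def compose_def fun_eq_iff)

lemma inv_BijGroup_UNIV:
  assumes "bij (f :: 'v \<Rightarrow> 'v)"
  shows "m_inv (BijGroup UNIV) f = inv_into UNIV f"
proof -
  interpret B: group "BijGroup (UNIV :: 'v set)" by (rule group_BijGroup)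
  have "inv_into UNIV f \<circ> f = id" using assms by (simp add: bij_is_inj)
  then show ?thesis
    using assms by (intro B.inv_equality) (simp_all only: BijGroup_UNIV bij_imp_bij_inv)
qed

text \<open>This is where well-definedness of coroots is needed: the definition of \<open>Wa\<close> refers to them.\<close>

lemma Wa_affine:
  assumes "\<tau> \<in> Wa" shows "\<exists>u\<in>Wv. \<exists>t. \<forall>v. \<tau> v = u v + t"
  using assms unfolding Wa_def
proof (induction rule: generate.induct)
  case one
  show ?case using id_in_Wv by (intro bexI[of _ id] exI[of _ 0]) (simp_all add: BijGroup_UNIV)
next
  case (incl h)
  then obtain \<beta> k where "h = affine_refl \<beta> k" "\<beta> \<in> real_roots" by blast
  then show ?case by (metis affine_refl_form)
next
  case (inv h)
  then obtain \<beta> k where "h = affine_refl \<beta> k" "\<beta> \<in> real_roots" by blast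
  then obtain u t where u: "u \<in> Wv" "\<And>v. h v = u v + t" by (metis affine_refl_form)
  show ?case unfolding inv_BijGroup_UNIV[OF bij_Wv_affine(1)[OF u]] by (rule Wv_affine_inv[OF u])
next
  case (eng h1 h2)
  then obtain u1 t1 u2 t2 where u: "u1 \<in> Wv" "\<And>v. h1 v = u1 v + t1" "u2 \<in> Wv" "\<And>v. h2 v = u2 v + t2"
    by blast
  have "(h1 \<otimes>\<^bsub>BijGroup UNIV\<^esub> h2) v = (u1 \<circ> u2) v + (u1 t2 + t1)" for v
    by (simp add: BijGroup_UNIV(2)[OF bij_Wv_affine(1)[OF u(1,2)] bij_Wv_affine(1)[OF u(3,4)]]
        u linear_add[OF linear_Wv[OF u(1)]])
  then show ?case using Wv_comp[OF u(1,3)] by blast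
qed

lemma Wa_bij: assumes "\<tau> \<in> Wa" shows "bij \<tau>"
proof -
  obtain u t where "u \<in> Wv" "\<And>v. \<tau> v = u v + t" using Wa_affine[OF assms] by blast
  then show ?thesis by (rule bij_Wv_affine(1))
qed

lemma Wa_comp: assumes "\<sigma> \<in> Wa" "\<tau> \<in> Wa" shows "\<sigma> \<circ> \<tau> \<in> Wa"
  using generate.eng[OF assms[unfolded Wa_def]]
  unfolding BijGroup_UNIV(2)[OF Wa_bij[OF assms(1)] Wa_bij[OF assms(2)]] Wa_def .

lemma id_in_Wa: "id \<in> Wa"
  unfolding Wa_def BijGroup_UNIV(3)[symmetric] by (rule generate.one)

lemma Wa_inv: assumes "\<tau> \<in> Wa" shows "inv_into UNIV \<tau> \<in> Wa"
proof -
  interpret B: group "BijGroup (UNIV :: 'v set)" by (rule group_BijGroup)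
  have gen: "{affine_refl \<beta> k |\<beta> k. \<beta> \<in> real_roots \<and> k \<in> \<Lambda> \<beta>} \<subseteq> carrier (BijGroup UNIV)"
  proof
    fix h assume "h \<in> {affine_refl \<beta> k |\<beta> k. \<beta> \<in> real_roots \<and> k \<in> \<Lambda> \<beta>}"
    then have "h \<in> Wa" unfolding Wa_def by (rule generate.incl)
    then show "h \<in> carrier (BijGroup UNIV)" using Wa_bij by (simp only: BijGroup_UNIV)
  qed
  from B.generate_m_inv_closed[OF gen] assms
  show ?thesis unfolding Wa_def inv_BijGroup_UNIV[OF Wa_bij[OF assms], symmetric] by blast
qed

section \<open>Coroot combinations in the absence of affine components\<close>

text \<open>Given \<open>u\<close> with \<open>A\<^sub>J u \<ge> 0\<close>, subtract the largest multiple of \<open>y\<close> that leaves a nonnegative vector \<open>v\<close>. Its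
  zero set is nonempty and closed under adjacency, because the off-diagonal entries of \<open>A\<^sub>J\<close> are nonpositive. As
  \<open>J\<close> is indecomposable, \<open>v = 0\<close>. So every such \<open>u\<close> is a multiple of \<open>y\<close>, which yields all three clauses of affine type.\<close>

lemma component_kernel_affine:
  assumes J: "component J" and pos: "\<And>j. j \<in> J \<Longrightarrow> y j > 0"
    and ker: "\<And>i. i \<in> J \<Longrightarrow> (\<Sum>j\<in>J. cartan i j * y j) = 0"
  shows "affine_type J"
proof -
  have Jne: "J \<noteq> {}" using J by (simp add: component_def)
  have multiple: "\<exists>c. \<forall>j\<in>J. u j = c * y j" if u: "\<And>i. i \<in> J \<Longrightarrow> (\<Sum>j\<in>J. cartan i j * u j) \<ge> 0" for u
  proof -
    define c where "c = Min ((\<lambda>j. u j / y j) ` J)"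
    have c: "c \<le> u j / y j" if "j \<in> J" for j using that by (simp add: c_def)
    have "c \<in> (\<lambda>j. u j / y j) ` J" unfolding c_def using Jne by (intro Min_in) auto
    then obtain m where m: "m \<in> J" "c = u m / y m" by auto
    define v where "v j = u j - c * y j" for j
    have v0: "v j \<ge> 0" if "j \<in> J" for j
      using c[OF that] pos[OF that] by (simp add: v_def pos_le_divide_eq)
    have vm: "v m = 0" using m pos[OF m(1)] by (simp add: v_def)
    have vker: "(\<Sum>j\<in>J. cartan i j * v j) \<ge> 0" if "i \<in> J" for i
    proof -
      have "(\<Sum>j\<in>J. cartan i j * v j) = (\<Sum>j\<in>J. cartan i j * u j) - c * (\<Sum>j\<in>J. cartan i j * y j)"
        by (simp add: v_def algebra_simps sum_subtractf sum_distrib_left)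
      then show ?thesis using u[OF that] ker[OF that] by simp
    qed
    define K where "K = {j\<in>J. v j = 0}"
    have closed: "v j = 0" if "i \<in> K" "j \<in> J" "cartan i j \<noteq> 0" for i j
    proof -
      have i: "i \<in> J" "v i = 0" using that by (auto simp: K_def)
      have le: "cartan i k * v k \<le> 0" if "k \<in> J" for k
        using cartan_nonpos[of i k] v0[OF that] i by (cases "i = k") (auto simp: mult_nonpos_nonneg)
      then have "(\<Sum>k\<in>J. - (cartan i k * v k)) = 0"
        using vker[OF i(1)] sum_nonneg[of J "\<lambda>k. - (cartan i k * v k)"] by (simp add: sum_negf)
      then have "- (cartan i j * v j) = 0"
        using le that(2) by (subst (asm) sum_nonneg_eq_0_iff) auto
      then show ?thesis using that by simp
    qed
    have "K = J"
    proof (rule ccontr)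
      assume "K \<noteq> J"
      then have "K \<noteq> {} \<and> K \<subset> J" using m vm by (auto simp: K_def)
      moreover have "\<forall>K. K \<noteq> {} \<and> K \<subset> J \<longrightarrow> (\<exists>i\<in>K. \<exists>j\<in>J - K. cartan i j \<noteq> 0 \<or> cartan j i \<noteq> 0)"
        using J unfolding component_def by (elim conjE)
      ultimately obtain i j where "i \<in> K" "j \<in> J - K" "cartan i j \<noteq> 0 \<or> cartan j i \<noteq> 0"
        by blast
      then have "i \<in> K" "j \<in> J" "cartan i j \<noteq> 0" "v j \<noteq> 0"
        using cartan_zero[of i j] by (auto simp: K_def)
      then show False using closed by blast
    qed
    then show ?thesis by (intro exI[of _ c]) (auto simp: K_def v_def)
  qed
  define z :: "real ^ 'i" where "z = (\<chi> j. if j \<in> J then y j else 0)"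
  have zker: "(\<Sum>j\<in>J. cartan i j * z $ j) = 0" if "i \<in> J" for i
    using ker[OF that] by (simp add: z_def)
  obtain j0 where "j0 \<in> J" using Jne by blast
  then have "z $ j0 \<noteq> 0" using pos[of j0] by (simp add: z_def)
  then have "z \<noteq> 0" by auto
  have null: "{u :: real ^ 'i. (\<forall>j\<in>- J. u $ j = 0) \<and> (\<forall>i\<in>J. (\<Sum>j\<in>J. cartan i j * u $ j) = 0)} = span {z}"
    (is "?N = _")
  proof (intro equalityI subsetI)
    fix u assume u: "u \<in> ?N"
    then obtain c where "\<forall>j\<in>J. u $ j = c * y j" using multiple[of "\<lambda>j. u $ j"] by auto
    then have "u = c *\<^sub>R z" using u by (auto simp: vec_eq_iff z_def)
    then show "u \<in> span {z}" by (auto simp: span_singleton)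
  next
    fix u assume "u \<in> span {z}"
    then obtain c where u: "u = c *\<^sub>R z" by (auto simp: span_singleton)
    have "(\<Sum>j\<in>J. cartan i j * u $ j) = c * (\<Sum>j\<in>J. cartan i j * z $ j)" for i
      by (simp add: u sum_distrib_left algebra_simps)
    then show "u \<in> ?N" using zker by (auto simp: u z_def)
  qed
  have dim1: "dim (span {z}) = 1" using \<open>z \<noteq> 0\<close> by (simp add: dim_span)
  have semi: "\<forall>i\<in>J. (\<Sum>j\<in>J. cartan i j * u j) = 0"
    if u: "\<forall>i\<in>J. (\<Sum>j\<in>J. cartan i j * u j) \<ge> 0" for u
  proof
    fix i assume i: "i \<in> J"
    obtain c where c: "\<forall>j\<in>J. u j = c * y j" using multiple u by blast
    have "(\<Sum>j\<in>J. cartan i j * u j) = (\<Sum>j\<in>J. c * (cartan i j * y j))"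
      using c by (intro sum.cong) auto
    also have "\<dots> = 0" using ker[OF i] by (simp flip: sum_distrib_left)
    finally show "(\<Sum>j\<in>J. cartan i j * u j) = 0" .
  qed
  have "\<exists>u. (\<forall>j\<in>J. u j > 0) \<and> (\<forall>i\<in>J. (\<Sum>j\<in>J. cartan i j * u j) = 0)"
    by (rule exI[of _ y], intro conjI ballI) (fact pos, fact ker)
  then show ?thesis unfolding affine_type_def null dim1 using semi by (intro conjI allI impI refl)
qed

text \<open>Gordan's alternative for the columns of the Cartan matrix. In the second case the support of the
  kernel vector is closed under adjacency, so it contains the connected component of any of its
  points.\<close>

lemma antidominant_coroot_combination:
  assumes "\<not> has_affine_factor"
  obtains u where "\<And>j. \<alpha> j (\<Sum>i\<in>UNIV. u i *\<^sub>R \<alpha>v i) < 0"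
proof -
  define \<phi> where "\<phi> j x = - (\<Sum>i\<in>UNIV. x $ i * cartan i j)" for j and x :: "real ^ 'i"
  have lin: "linear (\<phi> j)" for j
    unfolding \<phi>_def by (rule linearI) (simp_all add: algebra_simps sum.distrib sum_distrib_left)
  show thesis
  proof (cases "\<exists>x. \<forall>j. \<phi> j x > 0")
    case True
    then obtain x where x: "\<And>j. \<phi> j x > 0" by blast
    have "\<alpha> j (\<Sum>i\<in>UNIV. (x $ i) *\<^sub>R \<alpha>v i) < 0" for j
      using x[of j] by (simp add: \<phi>_def root_sum root_scale root_coroot)
    then show thesis by (rule that[of "\<lambda>i. x $ i"])
  next
    case False
    from gordan_alternative[of \<phi>, OF lin False]
    obtain y where "(\<forall>i. y i \<ge> 0) \<and> (\<exists>i. y i \<noteq> 0) \<and> (\<forall>x. (\<Sum>j\<in>UNIV. y j * \<phi> j x) = 0)" ..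
    then have y: "\<forall>i. y i \<ge> 0" "\<exists>i. y i \<noteq> 0"
      "\<forall>x. (\<Sum>j\<in>UNIV. y j * \<phi> j x) = 0" by simp_all
    have ker: "(\<Sum>j\<in>UNIV. cartan i j * y j) = 0" for i
    proof -
      have "\<phi> j (axis i 1) = - cartan i j" for j
        by (simp add: \<phi>_def axis_def if_distrib[of "\<lambda>x. x * _"] cong: if_cong)
      then show ?thesis using y(3)[rule_format, of "axis i 1"] by (simp add: sum_negf mult.commute)
    qed
    define R where "R = {(i, j). cartan i j \<noteq> 0}"
    have symR: "sym R" using cartan_zero by (auto simp: R_def sym_def)
    obtain i0 where i0: "y i0 \<noteq> 0" using y by blast
    define J where "J = {j. (i0, j) \<in> R\<^sup>*}"
    have supp: "y j = 0" if "y i = 0" "cartan i j \<noteq> 0" for i j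
    proof -
      have le: "cartan i k * y k \<le> 0" for k
        using cartan_nonpos[of i k] y(1) that(1) by (cases "i = k") (auto simp: mult_nonpos_nonneg)
      then have "- (cartan i j * y j) = 0"
        using ker[of i] sum_nonneg_eq_0_iff[of UNIV "\<lambda>k. - (cartan i k * y k)"]
        by (simp add: sum_negf)
      then show ?thesis using that by simp
    qed
    have closed: "j \<in> J" if "i \<in> J" "cartan i j \<noteq> 0 \<or> cartan j i \<noteq> 0" for i j
      using that cartan_zero by (auto simp: J_def R_def intro: rtrancl_into_rtrancl)
    have posJ: "y j > 0" if "j \<in> J" for j
    proof -
      from that have "(i0, j) \<in> R\<^sup>*" by (simp add: J_def)
      then have "y j \<noteq> 0"
      proof (induction rule: rtrancl_induct)
        case (step i j)
        then show ?case using supp[of j i] cartan_zero by (auto simp: R_def)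
      qed (rule i0)
      then show ?thesis using y(1) by (metis less_eq_real_def)
    qed
    have "component J" unfolding component_def
    proof (intro conjI ballI allI impI)
      show "J \<noteq> {}" by (auto simp: J_def)
    next
      fix i j assume "i \<in> J" "j \<in> - J"
      then show "cartan i j = 0" "cartan j i = 0" using closed by auto
    next
      fix K assume K: "K \<noteq> {} \<and> K \<subset> J"
      show "\<exists>i\<in>K. \<exists>j\<in>J - K. cartan i j \<noteq> 0 \<or> cartan j i \<noteq> 0"
      proof (rule ccontr)
        assume no: "\<not> ?thesis"
        have stab: "j \<in> K" if "i \<in> K" "cartan i j \<noteq> 0 \<or> cartan j i \<noteq> 0" for i j
          using no that closed K by blast
        obtain k where "k \<in> K" using K by blast
        then have "(i0, k) \<in> R\<^sup>*" using K by (auto simp: J_def)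
        then have "(k, i0) \<in> R\<^sup>*" using sym_rtrancl[OF symR] by (auto dest: symD)
        then have "i0 \<in> K" by (induction rule: rtrancl_induct) (auto simp: R_def \<open>k \<in> K\<close> intro: stab)
        have "j \<in> K" if "(i0, j) \<in> R\<^sup>*" for j
          using that by (induction rule: rtrancl_induct) (auto simp: R_def \<open>i0 \<in> K\<close> intro: stab)
        then show False using K by (auto simp: J_def)
      qed
    qed
    moreover have "(\<Sum>j\<in>J. cartan i j * y j) = 0" if "i \<in> J" for i
    proof -
      have "(\<Sum>j\<in>J. cartan i j * y j) = (\<Sum>j\<in>UNIV. cartan i j * y j)"
        using closed[OF that] by (intro sum.mono_neutral_left) auto
      then show ?thesis using ker by simp
    qed
    ultimately have "affine_type J" using posJ component_kernel_affine by blast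
    then have has_affine_factor using \<open>component J\<close> by (auto simp: has_affine_factor_def)
    then show thesis using assms by simp
  qed
qed

section \<open>Roots vanish on the minimal face\<close>

lemma minimal_face_mem: "h \<in> Fv UNIV \<longleftrightarrow> (\<forall>i. \<alpha> i h = 0)"
  by (simp add: Fv_def)

lemma Wv_fixes_minimal_face:
  assumes h: "h \<in> Fv UNIV" and w: "w \<in> Wv" shows "w h = h"
proof -
  have "word xs h = h" for xs
    using h by (induction xs) (simp_all add: simple_refl_def minimal_face_mem)
  then show ?thesis using w by (auto simp: Wv_eq_words)
qed

declare lie_trans [trans]

lemma lie_add_zero_right: "LAdd x LZero \<doteq> x"
  by (rule lie_trans[OF add_comm add_zero])

lemma lie_scale_zero: "LScale 0 x \<doteq> LZero"
proof -
  have "LScale (1 + - 1) x \<doteq> LAdd (LScale 1 x) (LScale (- 1) x)" by (rule add_scale)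
  also have "\<dots> \<doteq> LAdd x (LScale (- 1) x)" by (rule cong_add[OF scale_one lie_refl])
  also have "\<dots> \<doteq> LZero" by (rule add_neg)
  finally show ?thesis by simp
qed

lemma lie_scale_of_zero: "LScale c LZero \<doteq> LZero"
proof -
  have "LScale c LZero \<doteq> LScale c (LScale 0 LZero)" by (rule cong_scale[OF lie_sym[OF lie_scale_zero]])
  also have "\<dots> \<doteq> LScale (c * 0) LZero" by (rule scale_scale)
  also have "\<dots> \<doteq> LZero" by (simp add: lie_scale_zero)
  finally show ?thesis .
qed

lemma lie_br_zero_right: "y \<doteq> LZero \<Longrightarrow> LBr x y \<doteq> LZero"
proof -
  assume "y \<doteq> LZero"
  then have "y \<doteq> LScale 0 LZero" by (rule lie_trans[OF _ lie_sym[OF lie_scale_zero]])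
  then have "LBr x y \<doteq> LBr x (LScale 0 LZero)" by (rule cong_br[OF lie_refl])
  also have "\<dots> \<doteq> LScale 0 (LBr x LZero)" by (rule br_scale_right)
  also have "\<dots> \<doteq> LZero" by (rule lie_scale_zero)
  finally show ?thesis .
qed

lemma lie_br_zero_flip:
  assumes "LBr h y \<doteq> LZero" shows "LBr y h \<doteq> LZero"
proof -
  have "LBr y (LAdd y h) \<doteq> LAdd (LBr y y) (LBr y h)" by (rule br_add_right)
  also have "\<dots> \<doteq> LAdd LZero (LBr y h)" by (rule cong_add[OF br_alt lie_refl])
  also have "\<dots> \<doteq> LBr y h" by (rule add_zero)
  finally have 1: "LBr y (LAdd y h) \<doteq> LBr y h" .
  have "LBr h (LAdd y h) \<doteq> LAdd (LBr h y) (LBr h h)" by (rule br_add_right)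
  also have "\<dots> \<doteq> LAdd LZero LZero" by (rule cong_add[OF assms br_alt])
  also have "\<dots> \<doteq> LZero" by (rule add_zero)
  finally have 2: "LBr h (LAdd y h) \<doteq> LZero" .
  have "LBr y h \<doteq> LAdd (LBr y h) LZero" by (rule lie_sym[OF lie_add_zero_right])
  also have "\<dots> \<doteq> LAdd (LBr y (LAdd y h)) (LBr h (LAdd y h))"
    by (rule lie_sym[OF cong_add[OF 1 2]])
  also have "\<dots> \<doteq> LBr (LAdd y h) (LAdd y h)" by (rule lie_sym[OF br_add])
  also have "\<dots> \<doteq> LZero" by (rule br_alt)
  finally show ?thesis .
qed

text \<open>All generators of the Lie algebra commute with \<open>h\<close>, and by the Jacobi identity so do their brackets. Hence a
  linear form that does not vanish at \<open>h\<close> has no nonzero weight vectors.\<close>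

lemma minimal_face_central:
  assumes "h \<in> Fv UNIV" shows "LBr (LH h) x \<doteq> LZero"
proof (induction x)
  case (LH v)
  show ?case by (rule h_h)
next
  case (LE i)
  have "LBr (LH h) (LE i) \<doteq> LScale (\<alpha> i h) (LE i)" by (rule h_e)
  then show ?case using assms lie_trans lie_scale_zero by (metis minimal_face_mem)
next
  case (LF i)
  have "LBr (LH h) (LF i) \<doteq> LScale (- \<alpha> i h) (LF i)" by (rule h_f)
  then show ?case using assms lie_trans lie_scale_zero by (metis minimal_face_mem minus_zero)
next
  case LZero
  show ?case by (rule lie_br_zero_right[OF lie_refl])
next
  case (LAdd x y)
  have "LBr (LH h) (LAdd x y) \<doteq> LAdd (LBr (LH h) x) (LBr (LH h) y)" by (rule br_add_right)
  also have "\<dots> \<doteq> LAdd LZero LZero" by (rule cong_add[OF LAdd])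
  also have "\<dots> \<doteq> LZero" by (rule add_zero)
  finally show ?case .
next
  case (LScale c x)
  have "LBr (LH h) (LScale c x) \<doteq> LScale c (LBr (LH h) x)" by (rule br_scale_right)
  also have "\<dots> \<doteq> LScale c LZero" by (rule cong_scale[OF LScale])
  also have "\<dots> \<doteq> LZero" by (rule lie_scale_of_zero)
  finally show ?case .
next
  case (LBr x y)
  let ?h = "LH h" and ?b = "LBr (LH h) (LBr x y)"
  have z1: "LBr x (LBr y ?h) \<doteq> LZero" by (rule lie_br_zero_right[OF lie_br_zero_flip[OF LBr(2)]])
  have z2: "LBr y (LBr ?h x) \<doteq> LZero" by (rule lie_br_zero_right[OF LBr(1)])
  have "?b \<doteq> LAdd ?b LZero" by (rule lie_sym[OF lie_add_zero_right])
  also have "\<dots> \<doteq> LAdd ?b (LAdd LZero LZero)" by (rule cong_add[OF lie_refl lie_sym[OF add_zero]])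
  also have "\<dots> \<doteq> LAdd ?b (LAdd (LBr x (LBr y ?h)) (LBr y (LBr ?h x)))"
    by (rule cong_add[OF lie_refl lie_sym[OF cong_add[OF z1 z2]]])
  also have "\<dots> \<doteq> LZero" by (rule jacobi)
  finally show ?case .
qed

lemma kac_moody_root_minimal_face:
  assumes "\<beta> \<in> kac_moody_roots" and h: "h \<in> Fv UNIV" shows "\<beta> h = 0"
proof (rule ccontr)
  assume nz: "\<beta> h \<noteq> 0"
  obtain x where x: "x \<notin> kac_radical"
    "LAdd (LBr (LH h) x) (LScale (- \<beta> h) x) \<in> kac_radical"
    using assms(1) unfolding kac_moody_roots_def by blast
  then obtain N where N: "lie_ideal N" "\<forall>h. LH h \<in> N \<longrightarrow> LH h \<doteq> LZero"
    "LAdd (LBr (LH h) x) (LScale (- \<beta> h) x) \<in> N" unfolding kac_radical_def by blast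
  have cong: "\<And>a b. a \<doteq> b \<Longrightarrow> a \<in> N \<Longrightarrow> b \<in> N" and scale: "\<And>c a. a \<in> N \<Longrightarrow> LScale c a \<in> N"
    using N(1) unfolding lie_ideal_def by blast+
  have "LAdd (LBr (LH h) x) (LScale (- \<beta> h) x) \<doteq> LAdd LZero (LScale (- \<beta> h) x)"
    by (rule cong_add[OF minimal_face_central[OF h] lie_refl])
  also have "\<dots> \<doteq> LScale (- \<beta> h) x" by (rule add_zero)
  finally have "LScale (- \<beta> h) x \<in> N" using cong N(3) by blast
  then have 1: "LScale (- 1 / \<beta> h) (LScale (- \<beta> h) x) \<in> N" by (rule scale)
  have "LScale (- 1 / \<beta> h) (LScale (- \<beta> h) x) \<doteq> LScale (- 1 / \<beta> h * - \<beta> h) x" by (rule scale_scale)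
  also have "- 1 / \<beta> h * - \<beta> h = 1" using nz by simp
  also have "LScale 1 x \<doteq> x" by (rule scale_one)
  finally have "x \<in> N" using cong 1 by blast
  then show False using x(1) N(1,2) unfolding kac_radical_def by blast
qed

lemma root_linear:
  assumes "\<beta> \<in> real_roots \<union> imaginary_roots" shows "linear \<beta>"
proof (cases "\<beta> \<in> real_roots")
  case True
  then show ?thesis unfolding real_roots_def
    by (auto intro: linear_compose linear_Wv Wv_inv linear_root)
next
  case False
  then show ?thesis using assms by (auto simp: imaginary_roots_def kac_moody_roots_def)
qed

text \<open>Consequently enclosures do not change when a set is thickened by the minimal face.\<close>

lemma root_minimal_face:
  assumes "\<beta> \<in> real_roots \<union> imaginary_roots" and h: "h \<in> Fv UNIV" shows "\<beta> h = 0"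
proof (cases "\<beta> \<in> real_roots")
  case True
  then obtain w i where "w \<in> Wv" "\<beta> = \<alpha> i \<circ> inv_into UNIV w" by (auto simp: real_roots_def)
  then show ?thesis using Wv_fixes_minimal_face[OF h Wv_inv] h by (simp add: minimal_face_mem)
next
  case False
  then show ?thesis using assms kac_moody_root_minimal_face by (auto simp: imaginary_roots_def)
qed

lemma half_apartment_cases:
  assumes "k = \<infinity> \<or> k \<in> ereal ` levels \<beta>"
  shows "half_apartment \<beta> k = UNIV \<or> (\<exists>r. half_apartment \<beta> k = {v. \<beta> v + r \<ge> 0})"
  using assms by (auto simp: half_apartment_def zero_ereal_def)

lemma enclosed_closed:
  assumes "E \<in> enclosed" shows "closed E"
proof -
  obtain k where k: "E = (\<Inter>\<beta>\<in>real_roots \<union> imaginary_roots. half_apartment \<beta> (k \<beta>))"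
    "\<forall>\<beta>\<in>real_roots \<union> imaginary_roots. k \<beta> = \<infinity> \<or> k \<beta> \<in> ereal ` levels \<beta>"
    using assms unfolding enclosed_def by blast
  have "closed (half_apartment \<beta> (k \<beta>))" if "\<beta> \<in> real_roots \<union> imaginary_roots" for \<beta>
  proof -
    have "continuous_on UNIV \<beta>"
      using root_linear[OF that] by (intro linear_continuous_on linear_conv_bounded_linear[THEN iffD1])
    then have "closed {v. \<beta> v + r \<ge> 0}" for r
      by (intro closed_Collect_le continuous_intros)
    then show ?thesis using half_apartment_cases[of "k \<beta>" \<beta>] k(2) that by auto
  qed
  then show ?thesis unfolding k(1) by blast
qed

lemma enclosed_add_minimal_face:
  assumes "E \<in> enclosed" "v \<in> E" "h \<in> Fv UNIV" shows "v + h \<in> E"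
proof -
  obtain k where k: "E = (\<Inter>\<beta>\<in>real_roots \<union> imaginary_roots. half_apartment \<beta> (k \<beta>))"
    using assms(1) unfolding enclosed_def by blast
  have eq: "\<beta> (v + h) = \<beta> v" if "\<beta> \<in> real_roots \<union> imaginary_roots" for \<beta>
    using linear_add[OF root_linear[OF that]] root_minimal_face[OF that assms(3)] by simp
  have "v + h \<in> half_apartment \<beta> (k \<beta>)"
    if "\<beta> \<in> real_roots \<union> imaginary_roots" "v \<in> half_apartment \<beta> (k \<beta>)" for \<beta>
    using that(2) by (simp only: half_apartment_def mem_Collect_eq eq[OF that(1)])
  then show ?thesis using assms(2) unfolding k by blast
qed

section \<open>Enclosures of local chambers and sectors\<close>

lemma le_encl: "F \<le> encl F"
  unfolding encl_def by (rule INF_greatest) simp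

lemma encl_le_enclosed: "E \<in> enclosed \<Longrightarrow> F \<le> principal E \<Longrightarrow> encl F \<le> principal E"
  unfolding encl_def by (rule INF_lower) simp

lemma encl_le_encl: "F' \<le> encl F \<Longrightarrow> encl F' \<le> encl F"
proof -
  assume *: "F' \<le> encl F"
  have "encl F' \<le> principal E" if "E \<in> enclosed" "F \<le> principal E" for E
    using encl_le_enclosed[OF that(1)] encl_le_enclosed[OF that] * by (meson order_trans)
  then show "encl F' \<le> encl F" unfolding encl_def[of F] by (intro INF_greatest) blast
qed

lemma eventually_local_face:
  "eventually P (local_face x D) \<longleftrightarrow> (\<exists>U. open U \<and> x \<in> U \<and> (\<forall>d\<in>D. x + d \<in> U \<longrightarrow> P (x + d)))"
  unfolding local_face_def germ_def eventually_inf_principal eventually_nhds by blast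

lemma closed_local_face_le:
  assumes "closed K" "local_face x D \<le> principal K"
  shows "local_face x (closure D) \<le> principal K"
proof -
  obtain U where U: "open U" "x \<in> U" "\<forall>d\<in>D. x + d \<in> U \<longrightarrow> x + d \<in> K"
    using assms(2) unfolding le_principal eventually_local_face by blast
  have "U \<inter> (+) x ` closure D \<subseteq> closure (U \<inter> (+) x ` D)"
    using open_Int_closure_subset[OF U(1), of "(+) x ` D"] by (simp add: closure_translation)
  also have "\<dots> \<subseteq> K" using U(3) assms(1) by (intro closure_minimal) auto
  finally show ?thesis unfolding le_principal eventually_local_face using U(1,2) by blast
qed

text \<open>Enclosed sets are closed, so the enclosure of a local chamber sees its topological closure, in
  particular its panels and its vertex.\<close>

lemma local_face_closure_le_encl: "local_face x (closure D) \<le> encl (local_face x D)"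
  unfolding encl_def
  by (rule INF_greatest) (use closed_local_face_le enclosed_closed in blast)

lemma local_face_mono: "D \<subseteq> D' \<Longrightarrow> local_face x D \<le> local_face x D'"
  unfolding local_face_def germ_def by (intro inf_mono) auto

lemma eventually_filter_plus:
  "eventually P (filter_plus F S) \<longleftrightarrow> (\<exists>Q. eventually Q F \<and> (\<forall>x y. Q x \<longrightarrow> y \<in> S \<longrightarrow> P (x + y)))"
  unfolding filter_plus_def eventually_filtermap eventually_prod_filter eventually_principal
  by (auto; metis)

lemma minimal_face_vectorial: "Fv UNIV \<in> vectorial_faces"
proof -
  have "Fv UNIV = id ` Fv UNIV" by simp
  then have "Fv UNIV \<in> positive_faces UNIV" unfolding positive_faces_def using id_in_Wv by blast
  then show ?thesis unfolding vectorial_faces_def faces_of_type_def by blast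
qed

lemma chamber_vectorial: "D \<in> vectorial_chambers \<Longrightarrow> D \<in> vectorial_faces"
  unfolding vectorial_chambers_def vectorial_faces_def by blast

lemma empty_spherical: "spherical {}"
proof -
  have "w = \<one>\<^bsub>BijGroup UNIV\<^esub>" if "w \<in> Wv_par {}" for w
    using that unfolding Wv_par_def
  proof (induction rule: generate.induct)
    case (eng h1 h2)
    then show ?case using group.is_monoid[OF group_BijGroup, of "UNIV :: 'v set"] by (simp add: monoid.l_one monoid.one_closed)
  qed simp_all
  then have "Wv_par {} \<subseteq> {\<one>\<^bsub>BijGroup UNIV\<^esub>}" by blast
  then show ?thesis unfolding spherical_def using finite_subset by blast
qed

lemma chamber_spherical: "D \<in> vectorial_chambers \<Longrightarrow> D \<in> spherical_faces"
  unfolding vectorial_chambers_def spherical_faces_def using empty_spherical by blast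

lemma local_chamber_point:
  assumes "D \<in> vectorial_chambers" "open U" "x \<in> U"
  obtains d where "d \<in> D" "x + d \<in> U"
proof -
  obtain d where d: "d \<in> D" using chamber_nonempty[OF assms(1)] by blast
  obtain e where e: "e > 0" "\<And>s. \<bar>s\<bar> \<le> e \<Longrightarrow> x + s *\<^sub>R d \<in> U" using open_small_step[OF assms(2,3)] by blast
  show thesis using that[OF chamber_scale[OF assms(1) d e(1)]] e by simp
qed

text \<open>A filter all of whose members have interior points has full support, and only the identity fixes all of \<open>V\<close>.\<close>

lemma solid_if_open:
  assumes "\<And>S. R \<le> principal S \<Longrightarrow> \<exists>V. open V \<and> V \<noteq> {} \<and> V \<subseteq> S"
  shows "solid R"
proof -
  have "U = UNIV" if aff: "affine U" and R: "R \<le> principal U" for U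
  proof -
    obtain V where V: "open V" "V \<noteq> {}" "V \<subseteq> U" using assms[OF R] by blast
    have "affine hull V = UNIV" by (rule affine_hull_open[OF V(1,2)])
    moreover have "affine hull V \<subseteq> U" by (rule hull_minimal[of V U affine, OF V(3) aff])
    ultimately show ?thesis by blast
  qed
  then have "support R = UNIV" unfolding support_def by blast
  moreover have "x \<in> direction UNIV" for x :: 'v
    unfolding direction_def using diff_zero[of x] by (metis (mono_tags, lifting) UNIV_I mem_Collect_eq)
  ultimately have "direction (support R) = UNIV" by auto
  then have "{w \<in> Wv. \<forall>u\<in>direction (support R). w u = u} \<subseteq> {id}" by auto
  then show ?thesis unfolding solid_def using finite_subset by blast
qed

lemma solid_of_local_chamber:
  assumes "D \<in> vectorial_chambers" "local_face x D \<le> R" shows "solid R"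
proof (rule solid_if_open)
  fix S assume "R \<le> principal S"
  then have "local_face x D \<le> principal S" using assms(2) by (rule order_trans[rotated])
  then obtain U where U: "open U" "x \<in> U" "\<forall>d\<in>D. x + d \<in> U \<longrightarrow> x + d \<in> S"
    unfolding le_principal eventually_local_face by blast
  have "open (U \<inter> (+) x ` D)" using U(1) chamber_open[OF assms(1)] by (intro open_Int open_translation)
  moreover obtain d where "d \<in> D" "x + d \<in> U" using local_chamber_point[OF assms(1) U(1,2)] by blast
  then have "U \<inter> (+) x ` D \<noteq> {}" by blast
  moreover have "U \<inter> (+) x ` D \<subseteq> S" using U(3) by auto
  ultimately show "\<exists>V. open V \<and> V \<noteq> {} \<and> V \<subseteq> S" by blast
qed

text \<open>Take the minimal face as the direction of the chimney. This makes (MA2) available for closed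
  local chambers.\<close>

lemma closed_chamber_solid_chimney:
  assumes D: "D \<in> vectorial_chambers"
  shows "encl (local_face x D) \<in> solid_chimneys"
proof -
  have "filter_plus (local_face x D) (Fv UNIV) \<le> principal E \<longleftrightarrow> local_face x D \<le> principal E"
    if E: "E \<in> enclosed" for E
  proof -
    have "0 \<in> Fv UNIV" by (simp add: minimal_face_mem linear_0[OF linear_root])
    then show ?thesis unfolding le_principal eventually_filter_plus
      using enclosed_add_minimal_face[OF E] by (metis (mono_tags, lifting) add.right_neutral eventually_mono)
  qed
  then have eq: "encl (local_face x D) = chimney (local_face x D) (Fv UNIV)"
    unfolding chimney_def encl_def by (intro arg_cong[where f = "\<lambda>X. Inf (principal ` X)"]) blast
  have "local_face x D \<in> local_faces" unfolding local_faces_def using chamber_vectorial[OF D] by blast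
  moreover have "solid (chimney (local_face x D) (Fv UNIV))"
    using solid_of_local_chamber[OF D le_encl] by (simp add: eq[symmetric])
  ultimately show ?thesis unfolding solid_chimneys_def eq using minimal_face_vectorial by blast
qed

lemma closed_chamber_closed_face:
  assumes D: "D \<in> vectorial_chambers"
  shows "encl (local_face x D) \<in> closed_faces"
  unfolding closed_faces_def local_faces_def using chamber_vectorial[OF D] by blast

text \<open>The germ at infinity of the sectors of direction \<open>D\<close>. It is both splayed and solid, so it may be
  used in either argument of (MA3) and (MA4).\<close>

definition sector_germ :: "'v set \<Rightarrow> 'v filter"
  where "sector_germ D = chimney_germ (local_face 0 D) D"

lemma sector_le_filter_plus:
  assumes D: "D \<in> vectorial_chambers"
  shows "principal ((+) \<xi> ` D) \<le> filter_plus (filtermap ((+) \<xi>) (local_face 0 D)) D"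
proof (rule filter_leI)
  fix P assume "eventually P (filter_plus (filtermap ((+) \<xi>) (local_face 0 D)) D)"
  then obtain Q where Q: "eventually Q (filtermap ((+) \<xi>) (local_face 0 D))"
    "\<forall>x y. Q x \<longrightarrow> y \<in> D \<longrightarrow> P (x + y)" unfolding eventually_filter_plus by blast
  obtain U where U: "open U" "0 \<in> U" "\<forall>d\<in>D. d \<in> U \<longrightarrow> Q (\<xi> + d)"
    using Q(1) unfolding eventually_filtermap eventually_local_face by auto
  have "P (\<xi> + d)" if d: "d \<in> D" for d
  proof -
    obtain e where e: "e > 0" "\<And>s. \<bar>s\<bar> \<le> e \<Longrightarrow> 0 + s *\<^sub>R d \<in> U" using open_small_step[OF U(1,2)] by blast
    \<comment> \<open>Split \<open>d\<close> into a part that is small enough for \<open>U\<close> and a remainder in \<open>D\<close>.\<close>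
    define s where "s = min e (1/2)"
    have s: "0 < s" "s < 1" "\<bar>s\<bar> \<le> e" using e(1) by (auto simp: s_def)
    have "Q (\<xi> + s *\<^sub>R d)" using U(3) e(2)[OF s(3)] chamber_scale[OF D d s(1)] by simp
    moreover have "(1 - s) *\<^sub>R d \<in> D" using chamber_scale[OF D d] s by simp
    ultimately have "P (\<xi> + s *\<^sub>R d + (1 - s) *\<^sub>R d)" using Q(2) by blast
    then show ?thesis by (simp add: algebra_simps)
  qed
  then show "eventually P (principal ((+) \<xi> ` D))" by (simp add: eventually_principal)
qed

text \<open>Finitely many translates of \<open>D\<close> by elements of \<open>D\<close> contain a common one, so the family that
  defines the germ is directed.\<close>

lemma eventually_sector_germ:
  assumes D: "D \<in> vectorial_chambers" and P: "eventually P (sector_germ D)"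
  obtains \<eta> where "\<eta> \<in> D" "eventually P (encl (principal ((+) \<eta> ` D)))"
proof -
  let ?c = "\<lambda>\<xi>. chimney (filtermap ((+) \<xi>) (local_face 0 D)) D"
  obtain X where X: "X \<subseteq> D" "finite X" "eventually P (INF \<xi>\<in>X. ?c \<xi>)"
    using eventually_INF[THEN iffD1, OF P[unfolded sector_germ_def chimney_germ_def]]
    by (elim exE conjE) (rule that)
  have "\<exists>\<eta>\<in>D. \<forall>\<xi>\<in>X. \<eta> - \<xi> \<in> D" using X(2,1)
  proof (induction rule: finite_induct)
    case empty
    show ?case using chamber_nonempty[OF D] by blast
  next
    case (insert x X)
    then obtain \<eta> where \<eta>: "\<eta> \<in> D" "\<forall>\<xi>\<in>X. \<eta> - \<xi> \<in> D" by auto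
    have "x \<in> D" using insert by auto
    then have "(\<eta> + x) - \<xi> \<in> D" if "\<xi> \<in> X" for \<xi>
      using chamber_add[OF D, of "\<eta> - \<xi>" x] \<eta>(2) that by (simp add: algebra_simps)
    moreover have "\<eta> + x \<in> D" using chamber_add[OF D \<eta>(1) \<open>x \<in> D\<close>] .
    ultimately show ?case using \<eta>(1) by (intro bexI[of _ "\<eta> + x"]) auto
  qed
  then obtain \<eta> where \<eta>: "\<eta> \<in> D" "\<forall>\<xi>\<in>X. \<eta> - \<xi> \<in> D" by blast
  have "encl (principal ((+) \<eta> ` D)) \<le> ?c \<xi>" if "\<xi> \<in> X" for \<xi>
  proof -
    have "(+) \<eta> ` D \<subseteq> (+) \<xi> ` D"
    proof
      fix v assume "v \<in> (+) \<eta> ` D"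
      then obtain d where "d \<in> D" "v = \<eta> + d" by blast
      then show "v \<in> (+) \<xi> ` D"
        using chamber_add[OF D, of "\<eta> - \<xi>" d] \<eta>(2) that
        by (intro image_eqI[of _ _ "\<eta> - \<xi> + d"]) auto
    qed
    then have "principal ((+) \<eta> ` D) \<le> principal ((+) \<xi> ` D)" by simp
    also have "\<dots> \<le> filter_plus (filtermap ((+) \<xi>) (local_face 0 D)) D"
      by (rule sector_le_filter_plus[OF D])
    also have "\<dots> \<le> encl \<dots>" by (rule le_encl)
    finally show ?thesis unfolding chimney_def by (rule encl_le_encl)
  qed
  then have "encl (principal ((+) \<eta> ` D)) \<le> (INF \<xi>\<in>X. ?c \<xi>)" by (intro INF_greatest)
  then have "eventually P (encl (principal ((+) \<eta> ` D)))" using X(3) by (rule filter_leD)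
  then show thesis using that \<eta>(1) by blast
qed

lemma eventually_sector_germD:
  assumes D: "D \<in> vectorial_chambers" and P: "eventually P (sector_germ D)"
  obtains \<eta> where "\<And>d. d \<in> D \<Longrightarrow> P (\<eta> + d)"
proof -
  obtain \<eta> where "eventually P (encl (principal ((+) \<eta> ` D)))" using eventually_sector_germ[OF D P] .
  then have "eventually P (principal ((+) \<eta> ` D))" using le_encl by (rule filter_leD[rotated])
  then show thesis using that by (auto simp: eventually_principal)
qed

lemma sector_germ_splayed: "D \<in> vectorial_chambers \<Longrightarrow> sector_germ D \<in> splayed_chimney_germs"
  unfolding sector_germ_def splayed_chimney_germs_def local_faces_def
  using chamber_spherical chamber_vectorial by blast

lemma sector_germ_solid:
  assumes D: "D \<in> vectorial_chambers" shows "sector_germ D \<in> solid_chimney_germs"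
proof -
  have "(+) 0 = (\<lambda>v :: 'v. v)" by auto
  then have "filtermap ((+) 0) F = F" for F :: "'v filter" by (simp only: filtermap_ident)
  then have "principal ((+) 0 ` D) \<le> chimney (local_face 0 D) D"
    using sector_le_filter_plus[OF D, of 0] le_encl unfolding chimney_def by (metis order_trans)
  then have *: "principal D \<le> chimney (local_face 0 D) D" by simp
  have "solid (chimney (local_face 0 D) D)"
  proof (rule solid_if_open)
    fix S assume "chimney (local_face 0 D) D \<le> principal S"
    then have "D \<subseteq> S" using * by (meson order_trans principal_le_iff)
    then show "\<exists>V. open V \<and> V \<noteq> {} \<and> V \<subseteq> S" using chamber_open[OF D] chamber_nonempty[OF D] by blast
  qed
  then show ?thesis unfolding sector_germ_def solid_chimney_germs_def local_faces_def
    using chamber_vectorial[OF D] by blast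
qed

text \<open>A ray whose direction is interior to \<open>D\<close> enters every sector of direction \<open>D\<close>.\<close>

lemma chamber_sector_eventually:
  assumes D: "D \<in> vectorial_chambers" and d: "d \<in> D"
  obtains T where "T > 0" "\<And>t. t \<ge> T \<Longrightarrow> x + t *\<^sub>R d - \<eta> \<in> D"
proof -
  obtain e where e: "e > 0" "\<And>s. \<bar>s\<bar> \<le> e \<Longrightarrow> d + s *\<^sub>R (x - \<eta>) \<in> D"
    using open_small_step[OF chamber_open[OF D] d] by blast
  have "x + t *\<^sub>R d - \<eta> \<in> D" if t: "t \<ge> 1 / e" for t
  proof -
    have t0: "t > 0" using t e(1) by (meson divide_pos_pos less_le_trans zero_less_one)
    have "1 / t \<le> e" using t e(1) t0 by (simp add: field_simps)
    then have "d + (1 / t) *\<^sub>R (x - \<eta>) \<in> D" using t0 by (intro e(2)) simp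
    from chamber_scale[OF D this t0]
    have "t *\<^sub>R d + (x - \<eta>) \<in> D" using t0 by (simp add: scaleR_add_right)
    then show ?thesis by (simp add: algebra_simps)
  qed
  then show thesis using that[of "1 / e"] e(1) by simp
qed

lemma chamber_open_tits_cone:
  assumes D: "D \<in> vectorial_chambers" and d: "d \<in> D"
  shows "d \<in> open_tits_cone \<or> - d \<in> open_tits_cone"
proof -
  have sub: "\<Union>(positive_faces {}) \<subseteq> open_tits_cone"
    unfolding open_tits_cone_def using empty_spherical by blast
  from D consider "D \<in> positive_faces {}" | F where "F \<in> positive_faces {}" "D = uminus ` F"
    unfolding vectorial_chambers_def faces_of_type_def by blast
  then show ?thesis
  proof cases
    case 1 then show ?thesis using sub d by blast
  next
    case 2
    then have "- d \<in> F" using d by auto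
    then show ?thesis using sub 2(1) by blast
  qed
qed

lemma open_tits_cone_subset: "open_tits_cone \<subseteq> tits_cone"
  unfolding open_tits_cone_def tits_cone_def by blast

lemma chamber_zero_notin: assumes "D \<in> vectorial_chambers" shows "0 \<notin> D"
proof
  assume "0 \<in> D"
  then show False using chamber_root_sign[OF assms id_in_Wv, of undefined]
    by (force simp: linear_0[OF linear_root])
qed

lemma zero_in_closure_chamber: assumes "D \<in> vectorial_chambers" shows "0 \<in> closure D"
proof -
  have "U \<inter> D \<noteq> {}" if "open U" "0 \<in> U" for U
    using local_chamber_point[OF assms that] by auto
  then show ?thesis unfolding closure_iff_nhds_not_empty by (metis inf_commute inf_mono order_refl subset_empty)
qed

lemma filtermap_affine_local_face_le:
  assumes u: "u \<in> Wv"
  shows "filtermap (\<lambda>v. u v + t) (local_face x D) \<le> local_face (u x + t) (u ` D)"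
proof (rule filter_leI)
  fix P assume "eventually P (local_face (u x + t) (u ` D))"
  then obtain U where U: "open U" "u x + t \<in> U" "\<forall>d\<in>u ` D. u x + t + d \<in> U \<longrightarrow> P (u x + t + d)"
    unfolding eventually_local_face by blast
  have "continuous_on UNIV (\<lambda>v. u v + t)"
    by (intro continuous_intros linear_continuous_on linear_conv_bounded_linear[THEN iffD1] linear_Wv u)
  then have "open ((\<lambda>v. u v + t) -` U)" using U(1) by (simp add: open_vimage)
  moreover have "x \<in> (\<lambda>v. u v + t) -` U" using U(2) by simp
  moreover have "P (u (x + d) + t)" if "d \<in> D" "x + d \<in> (\<lambda>v. u v + t) -` U" for d
  proof -
    have eq: "u (x + d) + t = u x + t + u d" by (simp add: linear_add[OF linear_Wv[OF u]])
    have "u x + t + u d \<in> U" using that(2) unfolding eq[symmetric] by simp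
    then show ?thesis unfolding eq using U(3) that(1) by blast
  qed
  ultimately show "eventually P (filtermap (\<lambda>v. u v + t) (local_face x D))"
    unfolding eventually_filtermap eventually_local_face by blast
qed

lemma filtermap_affine_local_face:
  assumes u: "u \<in> Wv"
  shows "filtermap (\<lambda>v. u v + t) (local_face x D) = local_face (u x + t) (u ` D)"
proof (rule antisym[OF filtermap_affine_local_face_le[OF u]])
  let ?u' = "inv_into UNIV u" and ?t' = "- inv_into UNIV u t"
  have add: "?u' (a + b) = ?u' a + ?u' b" for a b by (rule linear_add[OF linear_Wv[OF Wv_inv[OF u]]])
  have "filtermap (\<lambda>v. ?u' v + ?t') (local_face (u x + t) (u ` D))
      \<le> local_face (?u' (u x + t) + ?t') (?u' ` u ` D)"
    by (rule filtermap_affine_local_face_le[OF Wv_inv[OF u]])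
  also have "?u' (u x + t) + ?t' = x" by (simp add: add u)
  also have "?u' ` u ` D = D" by (simp add: image_image u)
  finally have "filtermap (\<lambda>v. u v + t) (filtermap (\<lambda>v. ?u' v + ?t') (local_face (u x + t) (u ` D)))
      \<le> filtermap (\<lambda>v. u v + t) (local_face x D)" by (rule filtermap_mono)
  moreover have "u (?u' v + ?t') + t = v" for v
    by (simp add: linear_diff[OF linear_Wv[OF u]] u)
  ultimately show "local_face (u x + t) (u ` D) \<le> filtermap (\<lambda>v. u v + t) (local_face x D)"
    by (simp add: filtermap_filtermap filtermap_ident)
qed

lemma panel_vectorial: "Fv {i} \<in> vectorial_panels"
proof -
  have "Fv {i} = id ` Fv {i}" by simp
  then have "Fv {i} \<in> positive_faces {i}" unfolding positive_faces_def using id_in_Wv by blast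
  then show ?thesis unfolding vectorial_panels_def faces_of_type_def by blast
qed

lemma panel_subset_closure: "Fv {i} \<subseteq> closure (Fv {})"
proof
  fix p assume p: "p \<in> Fv {i}"
  show "p \<in> closure (Fv {})" unfolding closure_iff_nhds_not_empty
  proof (intro allI impI)
    fix A U assume U: "U \<subseteq> A" "p \<in> U" "open U"
    obtain c where c: "c \<in> Fv {}" using fundamental_chamber_nonempty by blast
    obtain e where e: "e > 0" "\<And>s. \<bar>s\<bar> \<le> e \<Longrightarrow> p + s *\<^sub>R c \<in> U"
      using open_small_step[OF U(3,2)] by blast
    have "\<alpha> j (p + e *\<^sub>R c) > 0" for j
    proof -
      have "\<alpha> j p \<ge> 0" using p by (cases "j = i") (auto simp: panel_mem less_imp_le)
      moreover have "e * \<alpha> j c > 0" using e(1) c by (simp add: fundamental_chamber_mem)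
      ultimately show ?thesis by (simp add: root_add root_scale)
    qed
    then have "p + e *\<^sub>R c \<in> Fv {}" by (simp add: fundamental_chamber_mem)
    then show "Fv {} \<inter> A \<noteq> {}" using e(2)[of e] e(1) U(1) by auto
  qed
qed

text \<open>Up to a factor 2, this vector is the midpoint of \<open>v\<close> and its mirror image.\<close>

lemma add_refl_panel:
  assumes "v \<in> Fv {} \<or> v \<in> simple_refl i ` Fv {}" shows "v + simple_refl i v \<in> Fv {i}"
proof -
  have *: "c + simple_refl i c \<in> Fv {i}" if c: "c \<in> Fv {}" for c
    unfolding panel_mem
  proof (intro conjI allI impI)
    show "\<alpha> i (c + simple_refl i c) = 0" by (simp add: root_add root_refl cartan_diag)
    fix j assume "j \<noteq> i"
    then have "\<alpha> i c * cartan i j \<le> 0"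
      using c cartan_nonpos[of i j] by (simp add: fundamental_chamber_mem mult_nonneg_nonpos less_imp_le)
    moreover have "\<alpha> j c > 0" using c by (simp add: fundamental_chamber_mem)
    ultimately show "\<alpha> j (c + simple_refl i c) > 0" by (simp add: root_add root_refl)
  qed
  from assms show ?thesis
  proof
    assume "v \<in> simple_refl i ` Fv {}"
    then obtain c where "c \<in> Fv {}" "v = simple_refl i c" by blast
    then show ?thesis using *[of c] by (simp add: add.commute)
  qed (rule *)
qed

text \<open>Any \<open>d\<close> in \<open>D\<close> is \<open>(d + r\<^sub>i d) - r\<^sub>i d\<close>, a small panel point minus a point of the adjacent chamber. So
  the cones \<open>q - r\<^sub>i D\<close> over panel points \<open>q\<close> near the vertex cover the local chamber \<open>D\<close>.\<close>

lemma local_chamber_from_panel: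
  assumes D: "D = Fv {} \<or> D = simple_refl i ` Fv {}" and U: "open U" "x \<in> U"
    and P: "\<And>q c. q \<in> Fv {i} \<Longrightarrow> x + q \<in> U \<Longrightarrow> c \<in> simple_refl i ` D \<Longrightarrow> P (x + q - c)"
  shows "eventually P (local_face x D)"
proof -
  let ?g = "\<lambda>y. x + ((y - x) + simple_refl i (y - x))"
  have "continuous_on UNIV (simple_refl i)"
    by (intro linear_continuous_on linear_conv_bounded_linear[THEN iffD1] linear_refl)
  then have "continuous_on UNIV (\<lambda>y. simple_refl i (y - x))"
    by (rule continuous_on_compose2) (auto intro: continuous_intros)
  then have "continuous_on UNIV ?g" by (intro continuous_intros)
  then have "open (?g -` U)" using U(1) by (simp add: open_vimage)
  moreover have "x \<in> ?g -` U" using U(2) by (simp add: linear_0[OF linear_refl])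
  moreover have "P (x + d)" if d: "d \<in> D" "x + d \<in> ?g -` U" for d
  proof -
    have "d + simple_refl i d \<in> Fv {i}" using add_refl_panel D d(1) by blast
    moreover have "x + (d + simple_refl i d) \<in> U" using d(2) by (simp add: add.assoc)
    ultimately have "P (x + (d + simple_refl i d) - simple_refl i d)" using P d(1) by blast
    then show ?thesis by simp
  qed
  ultimately show ?thesis unfolding eventually_local_face by blast
qed

lemma refl_refl_image [simp]: "simple_refl i ` simple_refl i ` X = X"
  by (simp add: image_image)

end

context masure
begin

section \<open>Frames of apartments\<close>

lemma frame_structure:
  assumes "A \<in> \<A>"
  obtains f0 where "bij_betw f0 UNIV A" "Isom A = {f0 \<circ> w |w. w \<in> Wa}"
  using MA1[OF assms] unfolding apartment_structure_def by blast

lemma frame_bij: assumes "A \<in> \<A>" "f \<in> Isom A" shows "bij_betw f UNIV A"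
proof -
  obtain f0 where f0: "bij_betw f0 UNIV A" "Isom A = {f0 \<circ> w |w. w \<in> Wa}"
    using frame_structure[OF assms(1)] .
  then obtain w where "w \<in> Wa" "f = f0 \<circ> w" using assms(2) by blast
  then show ?thesis using bij_betw_trans[OF Wa_bij f0(1)] by simp
qed

lemma frame_inj: "A \<in> \<A> \<Longrightarrow> f \<in> Isom A \<Longrightarrow> f u = f v \<longleftrightarrow> u = v"
  using frame_bij by (meson bij_betw_imp_inj_on inj_eq)

lemma frame_range: "A \<in> \<A> \<Longrightarrow> f \<in> Isom A \<Longrightarrow> range f = A"
  using frame_bij by (simp add: bij_betw_def)

lemma frame_in: "A \<in> \<A> \<Longrightarrow> f \<in> Isom A \<Longrightarrow> f v \<in> A"
  using frame_range by blast

lemma frame_exists: assumes "A \<in> \<A>" obtains f where "f \<in> Isom A"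
  using frame_structure[OF assms] id_in_Wa by blast

lemma frame_comp: assumes "A \<in> \<A>" "f \<in> Isom A" "\<tau> \<in> Wa" shows "f \<circ> \<tau> \<in> Isom A"
proof -
  obtain f0 where f0: "Isom A = {f0 \<circ> w |w. w \<in> Wa}" using frame_structure[OF assms(1)] .
  then obtain w where "w \<in> Wa" "f = f0 \<circ> w" using assms(2) by blast
  then show ?thesis unfolding f0 using Wa_comp[of w \<tau>] assms(3) by (auto simp: comp_assoc)
qed

lemma frame_change_Wa:
  assumes "A \<in> \<A>" "f \<in> Isom A" "f' \<in> Isom A" obtains \<tau> where "\<tau> \<in> Wa" "f' = f \<circ> \<tau>"
proof -
  obtain f0 where f0: "Isom A = {f0 \<circ> w |w. w \<in> Wa}" using frame_structure[OF assms(1)] .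
  then obtain w w' where w: "w \<in> Wa" "f = f0 \<circ> w" "w' \<in> Wa" "f' = f0 \<circ> w'" using assms(2,3) by blast
  have "f \<circ> (inv_into UNIV w \<circ> w') = f'"
    using Wa_bij[OF w(1)] by (simp add: w fun_eq_iff bij_is_surj surj_f_inv_f)
  then show thesis using that[OF Wa_comp[OF Wa_inv[OF w(1)] w(3)]] by simp
qed

lemma frame_change:
  assumes "A \<in> \<A>" "f \<in> Isom A" "f' \<in> Isom A"
  obtains u t where "u \<in> Wv" "\<And>v. f' v = f (u v + t)"
proof -
  obtain \<tau> where \<tau>: "\<tau> \<in> Wa" "f' = f \<circ> \<tau>" using frame_change_Wa[OF assms] .
  obtain u t where "u \<in> Wv" "\<And>v. \<tau> v = u v + t" using Wa_affine[OF \<tau>(1)] by blast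
  then show thesis using that \<tau>(2) by simp
qed

lemma frame_iso:
  assumes A: "A \<in> \<A>" "f \<in> Isom A" and A': "A' \<in> \<A>" and iso: "iso_of_kind Wa A A' \<phi>"
  shows "\<phi> \<circ> f \<in> Isom A'"
proof -
  obtain f' where f': "f' \<in> Isom A'" using frame_exists[OF A'] .
  have "inv_into UNIV f' \<circ> \<phi> \<circ> f \<in> Wa" using iso A(2) f' unfolding iso_of_kind_def by blast
  then have "f' \<circ> (inv_into UNIV f' \<circ> \<phi> \<circ> f) \<in> Isom A'" by (rule frame_comp[OF A' f'])
  moreover have "f' (inv_into UNIV f' (\<phi> (f v))) = \<phi> (f v)" for v
  proof -
    have "\<phi> (f v) \<in> A'" using iso frame_in[OF A] unfolding iso_of_kind_def bij_betw_def by blast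
    then show ?thesis using frame_range[OF A' f'] by (simp add: f_inv_into_f)
  qed
  then have "f' \<circ> (inv_into UNIV f' \<circ> \<phi> \<circ> f) = \<phi> \<circ> f" by auto
  ultimately show ?thesis by simp
qed

lemma le_encl_in: "F \<le> encl_in A F"
  unfolding encl_in_def by (rule INF_greatest) auto

text \<open>An isomorphism of apartments that fixes part of \<open>A\<close> is the same as a frame of \<open>A'\<close> that agrees there
  with a given frame of \<open>A\<close>. All axioms are used in this form.\<close>

lemma Weyl_iso_fixing_frame:
  assumes A: "A \<in> \<A>" "f \<in> Isom A" and A': "A' \<in> \<A>" and F: "filtermap f F \<le> F'"
    and iso: "Weyl_iso_fixing A A' (encl_in A F') \<phi>"
  shows "\<phi> \<circ> f \<in> Isom A'" "eventually (\<lambda>v. \<phi> (f v) = f v) F"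
proof -
  show "\<phi> \<circ> f \<in> Isom A'" using frame_iso[OF A A'] iso by (simp add: Weyl_iso_fixing_def)
  have "eventually (\<lambda>x. \<phi> x = x) (encl_in A F')" using iso by (simp add: Weyl_iso_fixing_def)
  then have "eventually (\<lambda>x. \<phi> x = x) (filtermap f F)"
    by (rule filter_leD[OF order_trans[OF F le_encl_in]])
  then show "eventually (\<lambda>v. \<phi> (f v) = f v) F" by (simp add: eventually_filtermap)
qed

lemma filtermap_le_principal: "filtermap f F \<le> principal B \<longleftrightarrow> eventually (\<lambda>v. f v \<in> B) F"
  by (simp add: le_principal eventually_filtermap)

lemma MA2_frame:
  assumes A: "A \<in> \<A>" "f \<in> Isom A" and A': "A' \<in> \<A>"
    and F: "F \<in> generic_rays \<union> solid_chimneys" and ev: "eventually (\<lambda>v. f v \<in> A') F"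
  obtains f' where "f' \<in> Isom A'" "eventually (\<lambda>v. f' v = f v) F"
proof -
  have "filtermap f F \<in> transfer A (points \<union> preordered_interval_germs \<union> generic_rays \<union> solid_chimneys)"
    unfolding transfer_def using A(2) F by blast
  then have "MA2_config A A' (filtermap f F)"
    unfolding MA2_config_def filtermap_le_principal using A(1) A' ev by blast
  then obtain \<phi> where \<phi>: "Weyl_iso_fixing A A' (encl_in A (filtermap f F)) \<phi>" using MA2 by blast
  show thesis
    using that[of "\<phi> \<circ> f"] Weyl_iso_fixing_frame[OF A A' order_refl \<phi>] by simp
qed

lemma sector_germ_MA4_config:
  assumes A: "A \<in> \<A>" "f \<in> Isom A" and A': "A' \<in> \<A>" and D: "D \<in> vectorial_chambers"
    and ev: "eventually (\<lambda>v. f v \<in> A') (sector_germ D)"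
  shows "MA4_config A A' (filtermap f (sector_germ D)) (filtermap f (sector_germ D))"
proof -
  have "filtermap f (sector_germ D) \<in> transfer A splayed_chimney_germs"
    "filtermap f (sector_germ D) \<in> transfer A (closed_faces \<union> solid_chimney_germs)"
    unfolding transfer_def using A(2) sector_germ_splayed[OF D] sector_germ_solid[OF D] by blast+
  then have "MA3_config (filtermap f (sector_germ D)) (filtermap f (sector_germ D))"
    unfolding MA3_config_def using A(1) by blast
  then show ?thesis unfolding MA4_config_def filtermap_le_principal
    using A(1) A' ev frame_in[OF A] by simp
qed

lemma sector_germ_frame:
  assumes A: "A \<in> \<A>" "f \<in> Isom A" and A': "A' \<in> \<A>" and D: "D \<in> vectorial_chambers"
    and ev: "eventually (\<lambda>v. f v \<in> A') (sector_germ D)"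
  obtains f' where "f' \<in> Isom A'" "eventually (\<lambda>v. f' v = f v) (sector_germ D)"
proof -
  obtain \<phi> where "Weyl_iso_fixing A A' (encl_in A (sup (filtermap f (sector_germ D)) (filtermap f (sector_germ D)))) \<phi>"
    using MA4[OF sector_germ_MA4_config[OF assms]] by blast
  then show thesis using that[of "\<phi> \<circ> f"] Weyl_iso_fixing_frame[OF A A' order_refl] by simp
qed

lemma MA3_frame:
  assumes A: "A \<in> \<A>" "f \<in> Isom A" and D: "D \<in> vectorial_chambers"
    and B: "B \<in> \<A>" "h \<in> Isom B" and F: "F \<in> closed_faces \<union> solid_chimney_germs"
  obtains E where "E \<in> \<A>" "eventually (\<lambda>v. f v \<in> E) (sector_germ D)" "eventually (\<lambda>v. h v \<in> E) F"
proof -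
  have "filtermap f (sector_germ D) \<in> transfer A splayed_chimney_germs"
    "filtermap h F \<in> transfer B (closed_faces \<union> solid_chimney_germs)"
    unfolding transfer_def using A(2) B(2) F sector_germ_splayed[OF D] by blast+
  then have "MA3_config (filtermap f (sector_germ D)) (filtermap h F)"
    unfolding MA3_config_def using A(1) B(1) by blast
  from MA3[OF this] show thesis using that unfolding filtermap_le_principal by blast
qed

text \<open>The linear part of the coordinate change fixes the regular direction \<open>d\<close>, so it is trivial.\<close>

lemma frames_equal_on_line:
  assumes A: "A \<in> \<A>" "f \<in> Isom A" "f' \<in> Isom A" and D: "D \<in> vectorial_chambers" "d \<in> D"
    and eq: "f a = f' a" "f (a + s *\<^sub>R d) = f' (a + s *\<^sub>R d)" and s: "s \<noteq> 0"
  shows "f = f'"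
proof -
  obtain u t where u: "u \<in> Wv" "\<And>v. f' v = f (u v + t)" by (rule frame_change[OF A]) (rule that)
  have a: "u a + t = a" and b: "u (a + s *\<^sub>R d) + t = a + s *\<^sub>R d"
    using eq unfolding u(2) by (simp_all add: frame_inj[OF A(1,2)])
  have "u (a + s *\<^sub>R d) = u a + s *\<^sub>R u d"
    by (simp add: linear_add[OF linear_Wv] linear_scale[OF linear_Wv] u(1))
  then have "u a + t + s *\<^sub>R u d = a + s *\<^sub>R d" using b by (simp add: algebra_simps)
  then have "s *\<^sub>R u d = s *\<^sub>R d" unfolding a by simp
  then have ud: "u d = d" using s by simp
  have "u = id" using chamber_stabilizer[OF D(1) u(1) D(2)] D(2) by (simp add: ud)
  then show ?thesis using a u(2) by (intro ext) simp
qed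

lemma segment_in_frame:
  assumes A: "A \<in> \<A>" "f \<in> Isom A"
  shows "segment_in A (f a) (f b) = f ` closed_segment a b"
proof -
  have "g ` closed_segment p q = f ` closed_segment a b"
    if g: "g \<in> Isom A" "g p = f a" "g q = f b" for g p q
  proof -
    obtain u t where u: "u \<in> Wv" "\<And>v. g v = f (u v + t)" by (rule frame_change[OF A g(1)]) (rule that)
    have "u p + t = a" "u q + t = b" using g(2,3) u(2) frame_inj[OF A] by simp_all
    moreover have "closed_segment (t + u p) (t + u q) = (+) t ` u ` closed_segment p q"
      by (simp only: closed_segment_linear_image[OF linear_Wv[OF u(1)]] closed_segment_translation)
    ultimately have "closed_segment a b = (\<lambda>v. u v + t) ` closed_segment p q"
      by (simp add: image_image add.commute)
    then show ?thesis using u(2) by (simp add: image_image)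
  qed
  then show ?thesis unfolding segment_in_def using A(2) by blast
qed

lemma segment_frames:
  assumes A: "A \<in> \<A>" "f \<in> Isom A" and B: "B \<in> \<A>" "h \<in> Isom B"
    and eq: "f a = h a'" "f b = h b'" and le: "le_apt a b \<or> le_apt b a"
  shows "f ` closed_segment a b = h ` closed_segment a' b'"
proof -
  have in_both: "{f a, f b} \<subseteq> A \<inter> B" 
    using frame_in[OF A, of a] frame_in[OF A, of b] frame_in[OF B, of a'] frame_in[OF B, of b'] eq by auto
  have *: "segment_in A (f p) (f q) = segment_in B (f p) (f q)" if "le_apt p q" "{f p, f q} \<subseteq> A \<inter> B" for p q
    using MAO[OF A(1) B(1) that(2)] that(1) A(2) unfolding le_in_def by blast
  from le show ?thesis
  proof
    assume "le_apt a b"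
    from *[OF this in_both] show ?thesis
      by (simp only: segment_in_frame[OF A]) (simp only: eq segment_in_frame[OF B])
  next
    assume "le_apt b a"
    moreover have "{f b, f a} \<subseteq> A \<inter> B" using in_both by auto
    ultimately have "f ` closed_segment b a = h ` closed_segment b' a'"
      using * by (simp only: segment_in_frame[OF A]) (simp only: eq segment_in_frame[OF B])
    then show ?thesis by (simp only: closed_segment_commute)
  qed
qed

lemma le_apt_chamber:
  assumes "D \<in> vectorial_chambers" "d \<in> D" "s > 0"
  shows "le_apt x (x + s *\<^sub>R d) \<or> le_apt (x + s *\<^sub>R d) x"
  using chamber_open_tits_cone[OF assms(1) chamber_scale[OF assms]] open_tits_cone_subset
  unfolding le_apt_def by auto

section \<open>Cones over sector germs and rays\<close>

text \<open>Far out, the ray from \<open>x\<close> in direction \<open>d\<close> runs in the common sector. Hence its segments lie in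
  \<open>B\<close> by (MAO), and (MA2) for this generic ray gives a frame of \<open>B\<close> that agrees with \<open>f\<close> on the ray. It coincides
  with \<open>h\<close>, because the two agree on the far part of the ray.\<close>

theorem sector_cone_common:
  assumes A: "A \<in> \<A>" "f \<in> Isom A" and B: "B \<in> \<A>" "h \<in> Isom B" and D: "D \<in> vectorial_chambers"
    and ev: "eventually (\<lambda>v. f v = h v) (sector_germ D)" and x: "f x \<in> B" and d: "d \<in> D" and s: "s \<ge> 0"
  shows "f (x + s *\<^sub>R d) = h (x + s *\<^sub>R d)"
proof -
  obtain \<eta> where \<eta>: "\<And>e. e \<in> D \<Longrightarrow> f (\<eta> + e) = h (\<eta> + e)" using eventually_sector_germD[OF D ev] by blast
  obtain T where T: "T > 0" "\<And>t. t \<ge> T \<Longrightarrow> x + t *\<^sub>R d - \<eta> \<in> D"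
    using chamber_sector_eventually[OF D d] by blast
  have far: "f (x + t *\<^sub>R d) = h (x + t *\<^sub>R d)" if "t \<ge> T" for t
    using \<eta>[OF T(2)[OF that]] by simp
  have ray: "f (x + t *\<^sub>R d) \<in> B" if t: "t \<ge> 0" for t
  proof -
    define t' where "t' = max t T"
    have t': "t' > 0" "t' \<ge> t" "t' \<ge> T" using T(1) by (auto simp: t'_def)
    obtain y where y: "f x = h y" using x frame_range[OF B] by blast
    have "f ` closed_segment x (x + t' *\<^sub>R d) = h ` closed_segment y (x + t' *\<^sub>R d)"
      by (rule segment_frames[OF A B y far[OF t'(3)] le_apt_chamber[OF D d t'(1)]])
    moreover have "x + t *\<^sub>R d \<in> closed_segment x (x + t' *\<^sub>R d)"
    proof -
      have "x + t *\<^sub>R d = (1 - t / t') *\<^sub>R x + (t / t') *\<^sub>R (x + t' *\<^sub>R d)"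
        using t'(1) by (simp add: algebra_simps)
      moreover have "0 \<le> t / t'" "t / t' \<le> 1" using t t' by auto
      ultimately show ?thesis unfolding closed_segment_def by blast
    qed
    ultimately have "f (x + t *\<^sub>R d) \<in> h ` closed_segment y (x + t' *\<^sub>R d)" by (metis imageI)
    then show ?thesis using frame_in[OF B] by auto
  qed
  let ?R = "principal {x + t *\<^sub>R (x + d - x) |t. t \<ge> 0}"
  have "less_apt x (x + d) \<or> less_apt (x + d) x"
    using chamber_open_tits_cone[OF D d] unfolding less_apt_def by simp
  moreover have "x \<noteq> x + d" using d chamber_zero_notin[OF D] by auto
  ultimately have R: "?R \<in> generic_rays \<union> solid_chimneys" unfolding generic_rays_def by blast
  have "eventually (\<lambda>v. f v \<in> B) ?R" using ray by (auto simp: eventually_principal)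
  from MA2_frame[OF A B(1) R this] obtain f' where f': "f' \<in> Isom B" "eventually (\<lambda>v. f' v = f v) ?R"
    by blast
  have f'_ray: "f' (x + t *\<^sub>R d) = f (x + t *\<^sub>R d)" if "t \<ge> 0" for t
    using f'(2) that by (auto simp: eventually_principal)
  have "f' = h"
  proof (rule frames_equal_on_line[OF B(1) f'(1) B(2) D d])
    show "f' (x + T *\<^sub>R d) = h (x + T *\<^sub>R d)" using f'_ray[of T] far[of T] T(1) by simp
    have eq: "x + T *\<^sub>R d + 1 *\<^sub>R d = x + (T + 1) *\<^sub>R d" by (simp add: algebra_simps)
    show "f' (x + T *\<^sub>R d + 1 *\<^sub>R d) = h (x + T *\<^sub>R d + 1 *\<^sub>R d)"
      unfolding eq using f'_ray[of "T + 1"] far[of "T + 1"] T(1) by simp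
  qed simp
  then show ?thesis using f'_ray[OF s] by simp
qed

lemma closed_chamber_transfer:
  assumes A: "A \<in> \<A>" "f \<in> Isom A" and B: "B \<in> \<A>" "h \<in> Isom B" and D: "D \<in> vectorial_chambers"
    and ev: "eventually (\<lambda>v. f v \<in> B) (encl (local_face x D))"
  obtains u t where "u \<in> Wv" "eventually (\<lambda>v. f v = h (u v + t)) (local_face x (closure D))"
proof -
  have "encl (local_face x D) \<in> generic_rays \<union> solid_chimneys"
    using closed_chamber_solid_chimney[OF D] by blast
  from MA2_frame[OF A B(1) this ev] obtain f' where f': "f' \<in> Isom B"
    "eventually (\<lambda>v. f' v = f v) (encl (local_face x D))" by blast
  obtain u t where u: "u \<in> Wv" "\<And>v. f' v = h (u v + t)" by (rule frame_change[OF B f'(1)]) (rule that)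
  have "eventually (\<lambda>v. f v = h (u v + t)) (encl (local_face x D))"
    using f'(2) by (rule eventually_mono) (simp add: u(2))
  then have "eventually (\<lambda>v. f v = h (u v + t)) (local_face x (closure D))"
    by (rule filter_leD[OF local_face_closure_le_encl])
  then show thesis using that u(1) by blast
qed

lemma local_face_ray:
  assumes D: "D \<in> vectorial_chambers" "d \<in> D" and ev: "eventually P (local_face x (closure D))"
  obtains e where "e > 0" "\<And>s. 0 \<le> s \<Longrightarrow> s \<le> e \<Longrightarrow> P (x + s *\<^sub>R d)"
proof -
  obtain U where U: "open U" "x \<in> U" "\<forall>d\<in>closure D. x + d \<in> U \<longrightarrow> P (x + d)"
    using ev unfolding eventually_local_face by blast
  obtain e where e: "e > 0" "\<And>s. \<bar>s\<bar> \<le> e \<Longrightarrow> x + s *\<^sub>R d \<in> U" using open_small_step[OF U(1,2)] by blast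
  have "s *\<^sub>R d \<in> closure D" if "0 \<le> s" for s
    using chamber_scale[OF D] zero_in_closure_chamber[OF D(1)] closure_subset[of D] that
    by (cases "s = 0") (auto simp: order_less_le)
  then have "P (x + s *\<^sub>R d)" if "0 \<le> s" "s \<le> e" for s using U(3) e(2)[of s] that by simp
  then show thesis using that e(1) by blast
qed

text \<open>Axioms (MA3) and (MA4) see only germs. The set of \<open>t\<close> for which the conclusion holds is an interval, and it
  is shown to be closed and open. At a limit \<open>m\<close> one takes an apartment that contains the given sector germ and the
  local chamber behind the point \<open>x + m v\<close>; to go beyond \<open>m\<close>, one that contains the local
  chamber ahead of it. In the latter case the ray might bend at \<open>m\<close>, but by (MAO) segments that join
  comparable points are the same in both apartments, so the ray is straight.\<close>

theorem ray_extension: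
  assumes A: "A \<in> \<A>" "f \<in> Isom A" and B: "B \<in> \<A>" "k \<in> Isom B"
    and D: "D \<in> vectorial_chambers" "v \<in> D" and u: "u \<in> Wv"
    and start: "E0 \<in> \<A>" "h0 \<in> Isom E0" "eventually (\<lambda>w. f w = h0 w) (sector_germ (uminus ` u ` D))"
      "e0 > 0" "\<And>s. 0 \<le> s \<Longrightarrow> s \<le> e0 \<Longrightarrow> k (x + s *\<^sub>R v) = h0 (y + s *\<^sub>R u v)"
  shows "\<exists>E\<in>\<A>. \<exists>h\<in>Isom E. eventually (\<lambda>w. f w = h w) (sector_germ (uminus ` u ` D)) \<and>
    (\<forall>s. 0 \<le> s \<and> s \<le> t \<longrightarrow> k (x + s *\<^sub>R v) = h (y + s *\<^sub>R u v))"
proof -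
  let ?D' = "uminus ` u ` D"
  define S where "S m \<longleftrightarrow> (\<exists>E\<in>\<A>. \<exists>h\<in>Isom E. eventually (\<lambda>w. f w = h w) (sector_germ ?D') \<and>
    (\<forall>s. 0 \<le> s \<and> s \<le> m \<longrightarrow> k (x + s *\<^sub>R v) = h (y + s *\<^sub>R u v)))" for m
  have SI: "S m" if "E \<in> \<A>" "h \<in> Isom E" "eventually (\<lambda>w. f w = h w) (sector_germ ?D')"
      "\<And>s. 0 \<le> s \<Longrightarrow> s \<le> m \<Longrightarrow> k (x + s *\<^sub>R v) = h (y + s *\<^sub>R u v)" for m E h
    unfolding S_def
    by (rule bexI[OF _ that(1)], rule bexI[OF _ that(2)], intro conjI allI impI, rule that(3))
      (elim conjE, rule that(4))
  have D': "?D' \<in> vectorial_chambers" by (intro chamber_uminus chamber_image D u)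
  have uv: "- u v \<in> ?D'" using D(2) by blast
  have down: "S s" if S: "S s'" and le: "s \<le> s'" for s s'
  proof -
    obtain E1 h1 where 1: "E1 \<in> \<A>" "h1 \<in> Isom E1" "eventually (\<lambda>w. f w = h1 w) (sector_germ ?D')"
      "\<forall>r. 0 \<le> r \<and> r \<le> s' \<longrightarrow> k (x + r *\<^sub>R v) = h1 (y + r *\<^sub>R u v)" using S unfolding S_def by blast
    show ?thesis by (rule SI[OF 1(1-3)]) (use 1(4) le in auto)
  qed
  \<comment> \<open>It does not matter which apartment containing the germ and the end point is used.\<close>
  have switch: "\<forall>s. 0 \<le> s \<and> s \<le> m \<longrightarrow> k (x + s *\<^sub>R v) = h (y + s *\<^sub>R u v)"
    if S: "S m" and m: "0 \<le> m" and E: "E \<in> \<A>" "h \<in> Isom E"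
      and ev: "eventually (\<lambda>w. f w = h w) (sector_germ ?D')" and pt: "k (x + m *\<^sub>R v) \<in> E" for m E h
  proof -
    obtain E1 h1 where 1: "E1 \<in> \<A>" "h1 \<in> Isom E1" "eventually (\<lambda>w. f w = h1 w) (sector_germ ?D')"
      "\<forall>s. 0 \<le> s \<and> s \<le> m \<longrightarrow> k (x + s *\<^sub>R v) = h1 (y + s *\<^sub>R u v)" using S unfolding S_def by blast
    have ev': "eventually (\<lambda>w. h1 w = h w) (sector_germ ?D')"
      using eventually_conj[OF 1(3) ev] by (rule eventually_mono) metis
    have pt': "h1 (y + m *\<^sub>R u v) \<in> E" using 1(4) m pt by force
    show ?thesis
    proof (intro allI impI)
      fix s assume s: "0 \<le> s \<and> s \<le> m"
      have "h1 (y + m *\<^sub>R u v + (m - s) *\<^sub>R (- u v)) = h (y + m *\<^sub>R u v + (m - s) *\<^sub>R (- u v))"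
        by (rule sector_cone_common[OF 1(1,2) E D' ev' pt' uv]) (use s in simp)
      moreover have "y + m *\<^sub>R u v + (m - s) *\<^sub>R (- u v) = y + s *\<^sub>R u v" by (simp add: algebra_simps)
      ultimately have "h1 (y + s *\<^sub>R u v) = h (y + s *\<^sub>R u v)" by (simp only:)
      then show "k (x + s *\<^sub>R v) = h (y + s *\<^sub>R u v)" using 1(4) s by simp
    qed
  qed
  have "S t"
  proof (rule ccontr)
    assume "\<not> S t"
    define X where "X = {s. S s}"
    define m where "m = Sup X"
    have bound: "s \<le> t" if "s \<in> X" for s
      using \<open>\<not> S t\<close> down[of s t] that unfolding X_def mem_Collect_eq by linarith
    then have bdd: "bdd_above X" by (rule bdd_aboveI)
    have "S e0" by (rule SI[OF start(1-3,5)])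
    then have e0X: "e0 \<in> X" unfolding X_def by blast
    have m0: "e0 \<le> m" unfolding m_def by (rule cSup_upper[OF e0X bdd])
    then have mpos: "m > 0" using start(4) by simp
    have below: "S s" if sm: "s < m" for s
    proof -
      obtain s' where "s' \<in> X" "s < s'" using less_cSup_iff[OF _ bdd, of s] e0X sm unfolding m_def by blast
      then show ?thesis using down[of s' s] unfolding X_def mem_Collect_eq by simp
    qed
    have "S m"
    proof -
      have mD: "uminus ` D \<in> vectorial_chambers" "- v \<in> uminus ` D" using chamber_uminus D by auto
      have "encl (local_face (x + m *\<^sub>R v) (uminus ` D)) \<in> closed_faces \<union> solid_chimney_germs"
        using closed_chamber_closed_face[OF mD(1)] by blast
      from MA3_frame[OF A D' B this] obtain E where E: "E \<in> \<A>"
        "eventually (\<lambda>w. f w \<in> E) (sector_germ ?D')"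
        "eventually (\<lambda>w. k w \<in> E) (encl (local_face (x + m *\<^sub>R v) (uminus ` D)))" by blast
      obtain h where h: "h \<in> Isom E" "eventually (\<lambda>w. h w = f w) (sector_germ ?D')"
        using sector_germ_frame[OF A E(1) D' E(2)] by blast
      have fh: "eventually (\<lambda>w. f w = h w) (sector_germ ?D')"
        using h(2) by (rule eventually_mono) simp
      obtain u' t' where u': "u' \<in> Wv"
        "eventually (\<lambda>w. k w = h (u' w + t')) (local_face (x + m *\<^sub>R v) (closure (uminus ` D)))"
        using closed_chamber_transfer[OF B E(1) h(1) mD(1) E(3)] by blast
      obtain e where e: "e > 0"
        "\<And>s. 0 \<le> s \<Longrightarrow> s \<le> e \<Longrightarrow> k (x + m *\<^sub>R v + s *\<^sub>R (- v)) = h (u' (x + m *\<^sub>R v + s *\<^sub>R (- v)) + t')"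
        using local_face_ray[OF mD u'(2)] by blast
      \<comment> \<open>The frame \<open>h\<close> is compared with \<open>k\<close> at the parameters \<open>m - r\<close> and \<open>m - 2 r\<close>, and then extrapolated to \<open>m\<close>.\<close>
      define r where "r = min (e / 2) (m / 2)"
      have r: "r > 0" "2 * r \<le> e" "2 * r \<le> m" using e(1) mpos by (auto simp: r_def)
      have loc: "k (x + (m - s) *\<^sub>R v) = h (u' (x + (m - s) *\<^sub>R v) + t')" if "0 \<le> s" "s \<le> e" for s
      proof -
        have "x + m *\<^sub>R v + s *\<^sub>R (- v) = x + (m - s) *\<^sub>R v" by (simp add: algebra_simps)
        then show ?thesis using e(2)[OF that] by (simp only:)
      qed
      have known: "k (x + (m - s) *\<^sub>R v) = h (y + (m - s) *\<^sub>R u v)" if s: "0 < s" "s \<le> m" for s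
      proof (cases "s \<le> e")
        case True
        have "k (x + (m - s) *\<^sub>R v) \<in> E" using loc[of s] frame_in[OF E(1) h(1)] s True by simp
        then show ?thesis using switch[OF below[of "m - s"] _ E(1) h(1) fh] s by simp
      next
        case False
        have "k (x + (m - min e m) *\<^sub>R v) \<in> E"
          using loc[of "min e m"] frame_in[OF E(1) h(1)] e(1) mpos by simp
        then show ?thesis
          using switch[OF below[of "m - min e m"] _ E(1) h(1) fh] s False e(1) mpos by simp
      qed
      have aff: "u' (x + (m - s) *\<^sub>R v) + t' = y + (m - s) *\<^sub>R u v" if "0 < s" "s \<le> 2 * r" for s
        using known[of s] loc[of s] that r frame_inj[OF E(1) h(1)] by simp
      have lin: "u' (x + r *\<^sub>R v) = u' x + r *\<^sub>R u' v" for r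
        by (simp add: linear_add[OF linear_Wv[OF u'(1)]] linear_scale[OF linear_Wv[OF u'(1)]])
      have extrapolate: "2 *\<^sub>R (a + (m - r) *\<^sub>R b) - (a + (m - 2 * r) *\<^sub>R b) = a + m *\<^sub>R b" for a b :: 'v
      proof -
        have "(m - 2 * r) *\<^sub>R b = m *\<^sub>R b - r *\<^sub>R b - r *\<^sub>R b"
          unfolding scaleR_diff_left[symmetric] by simp
        moreover have "(m - r) *\<^sub>R b = m *\<^sub>R b - r *\<^sub>R b" by (rule scaleR_diff_left)
        ultimately show ?thesis by (simp add: scaleR_2)
      qed
      have aff': "(u' x + t') + (m - s) *\<^sub>R u' v = y + (m - s) *\<^sub>R u v" if "0 < s" "s \<le> 2 * r" for s
        using aff[OF that] unfolding lin by (simp add: add.assoc add.commute)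
      have "u' (x + m *\<^sub>R v) + t' = (u' x + t') + m *\<^sub>R u' v"
        unfolding lin by (simp add: add.assoc add.commute)
      also have "\<dots> = 2 *\<^sub>R ((u' x + t') + (m - r) *\<^sub>R u' v) - ((u' x + t') + (m - 2 * r) *\<^sub>R u' v)"
        by (rule extrapolate[symmetric])
      also have "\<dots> = 2 *\<^sub>R (y + (m - r) *\<^sub>R u v) - (y + (m - 2 * r) *\<^sub>R u v)"
        using aff'[of r] aff'[of "2 * r"] r(1) by simp
      also have "\<dots> = y + m *\<^sub>R u v" by (rule extrapolate)
      finally have "k (x + m *\<^sub>R v) = h (y + m *\<^sub>R u v)" using loc[of 0] e(1) by simp
      then have "k (x + s *\<^sub>R v) = h (y + s *\<^sub>R u v)" if "0 \<le> s" "s \<le> m" for s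
        using known[of "m - s"] that by (cases "s = m") auto
      then show ?thesis by (rule SI[OF E(1) h(1) fh])
    qed
    have "encl (local_face (x + m *\<^sub>R v) D) \<in> closed_faces \<union> solid_chimney_germs"
      using closed_chamber_closed_face[OF D(1)] by blast
    from MA3_frame[OF A D' B this] obtain E where E: "E \<in> \<A>"
      "eventually (\<lambda>w. f w \<in> E) (sector_germ ?D')"
      "eventually (\<lambda>w. k w \<in> E) (encl (local_face (x + m *\<^sub>R v) D))" by blast
    obtain h where h: "h \<in> Isom E" "eventually (\<lambda>w. h w = f w) (sector_germ ?D')"
      using sector_germ_frame[OF A E(1) D' E(2)] by blast
    have fh: "eventually (\<lambda>w. f w = h w) (sector_germ ?D')"
      using h(2) by (rule eventually_mono) simp
    obtain u' t' where u': "u' \<in> Wv"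
      "eventually (\<lambda>w. k w = h (u' w + t')) (local_face (x + m *\<^sub>R v) (closure D))"
      using closed_chamber_transfer[OF B E(1) h(1) D(1) E(3)] by blast
    obtain e where e: "e > 0"
      "\<And>s. 0 \<le> s \<Longrightarrow> s \<le> e \<Longrightarrow> k (x + m *\<^sub>R v + s *\<^sub>R v) = h (u' (x + m *\<^sub>R v + s *\<^sub>R v) + t')"
      using local_face_ray[OF D u'(2)] by blast
    have "k (x + m *\<^sub>R v) \<in> E" using e(2)[of 0] e(1) frame_in[OF E(1) h(1)] by simp
    note known = switch[OF \<open>S m\<close> less_imp_le[OF mpos] E(1) h(1) fh this]
    have apex: "u' (x + m *\<^sub>R v) + t' = y + m *\<^sub>R u v"
      using known[rule_format, of m] e(2)[of 0] e(1) mpos frame_inj[OF E(1) h(1)] by simp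
    have loc: "k (x + m *\<^sub>R v + s *\<^sub>R v) = h (y + m *\<^sub>R u v + s *\<^sub>R u' v)" if "0 \<le> s" "s \<le> e" for s
    proof -
      have "u' (x + m *\<^sub>R v + s *\<^sub>R v) + t' = u' (x + m *\<^sub>R v) + t' + s *\<^sub>R u' v"
        by (simp add: linear_add[OF linear_Wv[OF u'(1)]] linear_scale[OF linear_Wv[OF u'(1)]] algebra_simps)
      then show ?thesis using e(2)[OF that] by (simp only: apex)
    qed
    \<comment> \<open>The point with parameter \<open>m\<close> lies on a segment of \<open>E\<close>, so the two directions at it are proportional, and
      freeness of the action on chambers makes the linear parts equal.\<close>
    have "u' = u"
    proof -
      have ends: "k x = h y" "k (x + (m + e) *\<^sub>R v) = h (y + m *\<^sub>R u v + e *\<^sub>R u' v)"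
        using known[rule_format, of 0] mpos loc[of e] e(1) by (simp_all add: scaleR_add_left add.assoc)
      have me: "m + e > 0" using mpos e(1) by simp
      have "k ` closed_segment x (x + (m + e) *\<^sub>R v) = h ` closed_segment y (y + m *\<^sub>R u v + e *\<^sub>R u' v)"
        by (rule segment_frames[OF B E(1) h(1) ends le_apt_chamber[OF D me]])
      moreover have "x + m *\<^sub>R v \<in> closed_segment x (x + (m + e) *\<^sub>R v)"
      proof -
        have "x + m *\<^sub>R v = (1 - m / (m + e)) *\<^sub>R x + (m / (m + e)) *\<^sub>R (x + (m + e) *\<^sub>R v)"
          using me by (simp add: scaleR_add_right scaleR_diff_left)
        moreover have "0 \<le> m / (m + e)" "m / (m + e) \<le> 1" using mpos e(1) by auto
        ultimately show ?thesis unfolding closed_segment_def by blast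
      qed
      moreover have "k (x + m *\<^sub>R v) = h (y + m *\<^sub>R u v)" using known mpos by simp
      ultimately have "h (y + m *\<^sub>R u v) \<in> h ` closed_segment y (y + m *\<^sub>R u v + e *\<^sub>R u' v)"
        by (metis imageI)
      then have "y + m *\<^sub>R u v \<in> closed_segment y (y + m *\<^sub>R u v + e *\<^sub>R u' v)"
        using frame_inj[OF E(1) h(1)] by auto
      then obtain \<theta> where \<theta>: "0 \<le> \<theta>" "\<theta> \<le> 1"
        "y + m *\<^sub>R u v = (1 - \<theta>) *\<^sub>R y + \<theta> *\<^sub>R (y + m *\<^sub>R u v + e *\<^sub>R u' v)"
        unfolding closed_segment_def by blast
      have eq: "((1 - \<theta>) * m) *\<^sub>R u v = (\<theta> * e) *\<^sub>R u' v"
        using \<theta>(3) by (simp add: algebra_simps)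
      have nz: "u v \<noteq> 0" "u' v \<noteq> 0"
        using chamber_zero_notin[OF chamber_image[OF D(1) u]] D(2)
          chamber_zero_notin[OF chamber_image[OF D(1) u'(1)]] by force+
      have th0: "\<theta> \<noteq> 0" using eq nz(1) mpos by auto
      have th1: "\<theta> \<noteq> 1" using eq nz(2) e(1) by auto
      define c where "c = ((1 - \<theta>) * m) / (\<theta> * e)"
      have c: "c > 0" unfolding c_def using \<theta> th0 th1 mpos e(1) by (intro divide_pos_pos mult_pos_pos) auto
      have "u' v = (1 / (\<theta> * e)) *\<^sub>R ((\<theta> * e) *\<^sub>R u' v)" using th0 e(1) by simp
      also have "\<dots> = c *\<^sub>R u v" by (simp add: eq[symmetric] c_def)
      finally have u'v: "u' v = c *\<^sub>R u v" .
      have "(inv_into UNIV u \<circ> u') v = c *\<^sub>R v"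
        by (simp add: u'v linear_scale[OF linear_Wv[OF Wv_inv[OF u]]] u)
      then have "(inv_into UNIV u \<circ> u') v \<in> D" using chamber_scale[OF D c] by simp
      then have id: "inv_into UNIV u \<circ> u' = id"
        by (rule chamber_stabilizer[OF D(1) Wv_comp[OF Wv_inv[OF u] u'(1)] D(2)])
      show ?thesis
      proof
        fix w
        have "inv_into UNIV u (u' w) = w" using fun_cong[OF id, of w] by simp
        then show "u' w = u w" using Wv_inv_apply(2)[OF u, of "u' w"] by simp
      qed
    qed
    have "k (x + s *\<^sub>R v) = h (y + s *\<^sub>R u v)" if s: "0 \<le> s" "s \<le> m + e" for s
    proof (cases "s \<le> m")
      case False
      have eqs: "x + m *\<^sub>R v + (s - m) *\<^sub>R v = x + s *\<^sub>R v" "y + m *\<^sub>R u v + (s - m) *\<^sub>R u v = y + s *\<^sub>R u v"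
        by (simp_all add: algebra_simps)
      have "0 \<le> s - m" "s - m \<le> e" using s False by simp_all
      from loc[OF this] show ?thesis unfolding \<open>u' = u\<close> eqs .
    qed (use known s in blast)
    then have "S (m + e)" by (rule SI[OF E(1) h(1) fh])
    then have "m + e \<in> X" unfolding X_def by blast
    then have "m + e \<le> m" unfolding m_def by (rule cSup_upper[OF _ bdd])
    then show False using e(1) by simp
  qed
  then show ?thesis unfolding S_def .
qed

section \<open>A third local chamber at a panel\<close>

lemma third_chamber:
  assumes thick and A: "A \<in> \<A>" "f \<in> Isom A"
  obtains A' f' x' C where "A' \<in> \<A>" "f' \<in> Isom A'" "C \<in> vectorial_chambers"
    "filtermap f (local_face x (Fv {i})) \<le> filtermap f' (local_face x' (closure C))"
    "filtermap f' (local_face x' C) \<noteq> c1" "filtermap f' (local_face x' C) \<noteq> c2"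
proof -
  let ?p = "filtermap f (local_face x (Fv {i}))"
  have "?p \<in> local_panels_in"
    unfolding local_panels_in_def transfer_def using A panel_vectorial by blast
  then obtain S where S: "S \<subseteq> local_chambers_at ?p" "card S = 3"
    using assms(1) unfolding thick_def by blast
  have "\<not> S \<subseteq> {c1, c2}"
  proof
    assume "S \<subseteq> {c1, c2}"
    then have "card S \<le> card {c1, c2}" by (intro card_mono) auto
    also have "\<dots> \<le> 2" by (simp add: card_insert_if)
    finally show False using S(2) by simp
  qed
  then obtain c where c: "c \<in> S" "c \<noteq> c1" "c \<noteq> c2" by blast
  then have "c \<in> local_chambers_at ?p" using S(1) by blast
  then obtain A' f' x' C where "c = filtermap f' (local_face x' C)" "A' \<in> \<A>" "f' \<in> Isom A'"
    "C \<in> vectorial_chambers" "?p \<le> filtermap f' (local_face x' (closure C))"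
    unfolding local_chambers_at_def by blast
  then show thesis using that c(2,3) by blast
qed

text \<open>By \<open>sector_cone_common\<close> the frames agree on the cones \<open>q - D\<close> over all panel points \<open>q\<close>, and these
  cover the local chamber on the other side of the panel.\<close>

lemma panel_extension:
  assumes A: "A \<in> \<A>" "f \<in> Isom A" and B: "B \<in> \<A>" "h \<in> Isom B"
    and D: "D = Fv {} \<or> D = simple_refl i ` Fv {}"
    and ev: "eventually (\<lambda>v. f v = h v) (sector_germ (uminus ` D))"
    and panel: "eventually (\<lambda>v. f v \<in> B) (local_face x (Fv {i}))"
  shows "eventually (\<lambda>v. f v = h v) (local_face x (Fv {i}))"
    "eventually (\<lambda>v. f v = h v) (local_face x (simple_refl i ` D))"
proof -
  have Dc: "D \<in> vectorial_chambers"
    using D fundamental_chamber chamber_image[OF fundamental_chamber refl_in_Wv] by blast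
  note mD = chamber_uminus[OF Dc]
  obtain U where U: "open U" "x \<in> U" "\<forall>q\<in>Fv {i}. x + q \<in> U \<longrightarrow> f (x + q) \<in> B"
    using panel unfolding eventually_local_face by blast
  have eq: "f (x + q + s *\<^sub>R d) = h (x + q + s *\<^sub>R d)"
    if "q \<in> Fv {i}" "x + q \<in> U" "d \<in> uminus ` D" "s \<ge> 0" for q s d
    by (rule sector_cone_common[OF A B mD ev]) (use U(3) that in auto)
  obtain d where d: "d \<in> uminus ` D" using chamber_nonempty[OF mD] by blast
  have "f (x + q) = h (x + q)" if "q \<in> Fv {i}" "x + q \<in> U" for q
    using eq[OF that d, of 0] by simp
  then show "eventually (\<lambda>v. f v = h v) (local_face x (Fv {i}))"
    unfolding eventually_local_face using U(1,2) by blast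
  have D': "simple_refl i ` D = Fv {} \<or> simple_refl i ` D = simple_refl i ` Fv {}"
    using D by auto
  show "eventually (\<lambda>v. f v = h v) (local_face x (simple_refl i ` D))"
  proof (rule local_chamber_from_panel[OF D' U(1,2)])
    fix q c assume "q \<in> Fv {i}" "x + q \<in> U" "c \<in> simple_refl i ` simple_refl i ` D"
    then show "f (x + q - c) = h (x + q - c)" using eq[of q "- c" 1] by simp
  qed
qed

text \<open>A local chamber of another apartment becomes, by (MA2), a local chamber \<open>u C\<close> of \<open>B\<close> at some vertex.
  That its closure contains the panel is known only for subsets of the masure; comparing the points of
  both near the panel determines the vertex and shows that \<open>u C\<close> has the panel in its closure.\<close>

lemma chamber_position_at_panel:
  assumes A: "A \<in> \<A>" "f \<in> Isom A" and B: "B \<in> \<A>" "h \<in> Isom B"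
    and k: "k \<in> Isom A'" "A' \<in> \<A>" and C: "C \<in> vectorial_chambers"
    and panel: "filtermap f (local_face x (Fv {i})) \<le> filtermap k (local_face y (closure C))"
    and agree: "eventually (\<lambda>v. f v = h v) (local_face x (Fv {i}))"
    and inB: "eventually (\<lambda>v. k v \<in> B) (encl (local_face y C))"
  obtains u t where "u \<in> Wv" "u y + t = x" "u ` C = Fv {} \<or> u ` C = simple_refl i ` Fv {}"
    "eventually (\<lambda>v. k v = h (u v + t)) (local_face y (closure C))"
    "filtermap k (local_face y C) = filtermap h (local_face x (u ` C))"
proof -
  obtain u t where u: "u \<in> Wv" and ev: "eventually (\<lambda>v. k v = h (u v + t)) (local_face y (closure C))"
    using closed_chamber_transfer[OF k(2,1) B C inB] by blast
  obtain V where V: "open V" "y \<in> V" "\<forall>c\<in>closure C. y + c \<in> V \<longrightarrow> k (y + c) = h (u (y + c) + t)"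
    using ev unfolding eventually_local_face by blast
  have near: "\<exists>U. open U \<and> x \<in> U \<and> (\<forall>q\<in>Fv {i}. x + q \<in> U \<longrightarrow>
      (\<exists>c\<in>closure C. y + c \<in> W \<and> x + q = u (y + c) + t))"
    if W: "open W" "y \<in> W" for W
  proof -
    let ?Q = "\<lambda>p. \<exists>c\<in>closure C. y + c \<in> W \<inter> V \<and> p = k (y + c)"
    have "eventually (\<lambda>v. ?Q (k v)) (local_face y (closure C))"
      unfolding eventually_local_face
      by (rule exI[of _ "W \<inter> V"]) (use W V(1,2) in blast)
    then have "eventually ?Q (filtermap f (local_face x (Fv {i})))"
      using panel by (intro filter_leD[OF panel]) (simp add: eventually_filtermap)
    then have "eventually (\<lambda>v. ?Q (f v) \<and> f v = h v) (local_face x (Fv {i}))"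
      using agree by (simp add: eventually_filtermap eventually_conj)
    then obtain U where U: "open U" "x \<in> U"
      "\<forall>q\<in>Fv {i}. x + q \<in> U \<longrightarrow> ?Q (f (x + q)) \<and> f (x + q) = h (x + q)"
      unfolding eventually_local_face by blast
    have "\<exists>c\<in>closure C. y + c \<in> W \<and> x + q = u (y + c) + t" if q: "q \<in> Fv {i}" "x + q \<in> U" for q
    proof -
      obtain c where c: "c \<in> closure C" "y + c \<in> W" "y + c \<in> V" "f (x + q) = k (y + c)" "f (x + q) = h (x + q)"
        using U(3) q by blast
      then have "h (x + q) = h (u (y + c) + t)" using V(3) by simp
      then show ?thesis using c(1,2) frame_inj[OF B] by blast
    qed
    then show ?thesis using U(1,2) by blast
  qed
  obtain p where p: "p \<in> Fv {i}" using panel_nonempty by blast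
  have scaleP: "s *\<^sub>R p \<in> Fv {i}" if "s > 0" for s
    using p that by (simp add: panel_mem root_scale)
  have cont: "continuous_on UNIV (\<lambda>v. u v + t)"
    by (intro continuous_intros linear_continuous_on linear_conv_bounded_linear[THEN iffD1] linear_Wv u)
  have apex: "u y + t = x"
  proof (rule ccontr)
    assume "u y + t \<noteq> x"
    then obtain O1 O2 where O: "open O1" "open O2" "u y + t \<in> O1" "x \<in> O2" "O1 \<inter> O2 = {}"
      using hausdorff[of "u y + t" x] by blast
    have "open ((\<lambda>v. u v + t) -` O1)" using cont O(1) by (simp add: open_vimage)
    from near[OF this] obtain U where U: "open U" "x \<in> U"
      "\<forall>q\<in>Fv {i}. x + q \<in> U \<longrightarrow> (\<exists>c\<in>closure C. y + c \<in> (\<lambda>v. u v + t) -` O1 \<and> x + q = u (y + c) + t)"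
      using O(3) by auto
    obtain e where e: "e > 0" "\<And>s. \<bar>s\<bar> \<le> e \<Longrightarrow> x + s *\<^sub>R p \<in> U \<inter> O2"
      using open_small_step[of "U \<inter> O2" x p] U(1,2) O(2,4) by (metis IntI open_Int)
    have "x + e *\<^sub>R p \<in> U" "x + e *\<^sub>R p \<in> O2" using e(2)[of e] e(1) by auto
    then have "x + e *\<^sub>R p \<in> O1" using U(3) scaleP[OF e(1)] by fastforce
    then show False using \<open>x + e *\<^sub>R p \<in> O2\<close> O(5) by blast
  qed
  obtain U where U: "open U" "x \<in> U"
    "\<forall>q\<in>Fv {i}. x + q \<in> U \<longrightarrow> (\<exists>c\<in>closure C. y + c \<in> UNIV \<and> x + q = u (y + c) + t)"
    using near[OF open_UNIV UNIV_I] by blast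
  obtain e where e: "e > 0" "\<And>s. \<bar>s\<bar> \<le> e \<Longrightarrow> x + s *\<^sub>R p \<in> U" using open_small_step[OF U(1,2)] by blast
  obtain c where c: "c \<in> closure C" "x + e *\<^sub>R p = u (y + c) + t"
    using U(3) scaleP[OF e(1)] e(2)[of e] e(1) by auto
  have "u (y + c) + t = u y + t + u c" by (simp add: linear_add[OF linear_Wv[OF u]])
  then have "e *\<^sub>R p = u c" using c(2) unfolding apex by simp
  moreover have "u c \<in> closure (u ` C)"
    using c(1) linear_Wv[OF u] by (metis closure_linear_image_subset imageI subsetD)
  ultimately have uC: "u ` C = Fv {} \<or> u ` C = simple_refl i ` Fv {}"
    using chambers_at_panel[OF chamber_image[OF C u] scaleP[OF e(1)]] by simp
  have "eventually (\<lambda>v. k v = h (u v + t)) (local_face y C)"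
    by (rule filter_leD[OF local_face_mono[OF closure_subset] ev])
  then have "filtermap k (local_face y C) = filtermap (\<lambda>v. h (u v + t)) (local_face y C)"
    by (rule filtermap_eventually_eq)
  also have "\<dots> = filtermap h (filtermap (\<lambda>v. u v + t) (local_face y C))"
    by (simp add: filtermap_filtermap)
  also have "\<dots> = filtermap h (local_face x (u ` C))"
    by (simp add: filtermap_affine_local_face[OF u] apex)
  finally show thesis using that u apex uC ev by blast
qed

section \<open>Reflections and translations induced by the group\<close>

lemma BijGroup_subgroup_apply:
  assumes G: "subgroup G (BijGroup \<Delta>)"
  shows "g \<in> G \<Longrightarrow> p \<in> \<Delta> \<Longrightarrow> g p \<in> \<Delta>"
    and "g \<in> G \<Longrightarrow> g' \<in> G \<Longrightarrow> \<exists>k\<in>G. \<forall>p\<in>\<Delta>. k p = g (g' p)"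
    and "g \<in> G \<Longrightarrow> \<exists>k\<in>G. \<forall>p\<in>\<Delta>. k (g p) = p"
proof -
  interpret B: group "BijGroup \<Delta>" by (rule group_BijGroup)
  have Bij: "g \<in> Bij \<Delta>" if "g \<in> G" for g
    using subgroup.mem_carrier[OF G that] by (simp add: BijGroup_def)
  have mult: "(g \<otimes>\<^bsub>BijGroup \<Delta>\<^esub> g') p = g (g' p)" if "g \<in> G" "g' \<in> G" "p \<in> \<Delta>" for g g' p
    using that Bij by (simp add: BijGroup_def compose_def)
  show "g p \<in> \<Delta>" if "g \<in> G" "p \<in> \<Delta>"
    using Bij[OF that(1)] that(2) by (auto simp: Bij_def bij_betw_def)
  show "\<exists>k\<in>G. \<forall>p\<in>\<Delta>. k p = g (g' p)" if "g \<in> G" "g' \<in> G"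
    using subgroup.m_closed[OF G that] mult[OF that] by blast
  show "\<exists>k\<in>G. \<forall>p\<in>\<Delta>. k (g p) = p" if g: "g \<in> G"
  proof (intro bexI ballI)
    show k: "inv\<^bsub>BijGroup \<Delta>\<^esub> g \<in> G" by (rule subgroup.m_inv_closed[OF G g])
    fix p assume p: "p \<in> \<Delta>"
    have "inv\<^bsub>BijGroup \<Delta>\<^esub> g \<otimes>\<^bsub>BijGroup \<Delta>\<^esub> g = \<one>\<^bsub>BijGroup \<Delta>\<^esub>"
      by (rule B.l_inv[OF subgroup.mem_carrier[OF G g]])
    moreover have "\<one>\<^bsub>BijGroup \<Delta>\<^esub> p = p" using p by (simp add: BijGroup_def)
    ultimately show "(inv\<^bsub>BijGroup \<Delta>\<^esub> g) (g p) = p" using mult[OF k g p] by simp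
  qed
qed

lemma frame_in_masure: "A \<in> \<A> \<Longrightarrow> f \<in> Isom A \<Longrightarrow> f v \<in> \<Delta>"
  using frame_in cover by blast

text \<open>The form of strong transitivity that is used below: the isomorphism provided for (MA4) comes from \<open>G\<close>.\<close>

lemma sector_germ_group_frame:
  assumes G: "strongly_transitive G"
    and A: "A \<in> \<A>" "f \<in> Isom A" and A': "A' \<in> \<A>" and D: "D \<in> vectorial_chambers"
    and ev: "eventually (\<lambda>v. f v \<in> A') (sector_germ D)"
  obtains g where "g \<in> G" "g \<circ> f \<in> Isom A'" "eventually (\<lambda>v. f v = (g \<circ> f) v) (sector_germ D)"
proof -
  obtain g where g: "g \<in> G"
    "Weyl_iso_fixing A A' (encl_in A (sup (filtermap f (sector_germ D)) (filtermap f (sector_germ D)))) g"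
    using G sector_germ_MA4_config[OF A A' D ev] unfolding strongly_transitive_def by blast
  note fr = Weyl_iso_fixing_frame[OF A A' _ g(2)]
  have "filtermap f (sector_germ D) \<le> sup (filtermap f (sector_germ D)) (filtermap f (sector_germ D))"
    by simp
  note fr = fr[OF this]
  have "eventually (\<lambda>v. f v = (g \<circ> f) v) (sector_germ D)"
    using fr(2) by (rule eventually_mono) simp
  then show thesis using that g(1) fr(1) by blast
qed

text \<open>The triangle of apartments described at the beginning.\<close>

theorem reflection_in_group:
  assumes thick and G: "subgroup G (BijGroup \<Delta>)" "strongly_transitive G"
    and A: "A \<in> \<A>" "f \<in> Isom A"
  shows "\<exists>g\<in>G. \<forall>w. g (f w) = f (x + simple_refl i (w - x))"
proof -
  let ?C = "Fv {} :: 'v set" and ?C' = "simple_refl i ` Fv {} :: 'v set" and ?P = "Fv {i}"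
  have C: "?C \<in> vectorial_chambers" and C': "?C' \<in> vectorial_chambers"
    by (rule fundamental_chamber, rule chamber_image[OF fundamental_chamber refl_in_Wv])
  note mC = chamber_uminus[OF C] and mC' = chamber_uminus[OF C']
  obtain A3 f3 x3 C3 where 3: "A3 \<in> \<A>" "f3 \<in> Isom A3" "C3 \<in> vectorial_chambers"
    "filtermap f (local_face x ?P) \<le> filtermap f3 (local_face x3 (closure C3))"
    "filtermap f3 (local_face x3 C3) \<noteq> filtermap f (local_face x ?C)"
    "filtermap f3 (local_face x3 C3) \<noteq> filtermap f (local_face x ?C')"
    by (rule third_chamber[OF assms(1) A]) (rule that)
  \<comment> \<open>\<open>B\<close> contains the germ of \<open>- C\<close> of \<open>A\<close> and the third local chamber. It also contains the local chamber \<open>x + r\<^sub>i C\<close>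
    of \<open>A\<close>, so the third chamber takes the place of \<open>x + C\<close> in it.\<close>
  have "encl (local_face x3 C3) \<in> closed_faces \<union> solid_chimney_germs"
    using closed_chamber_closed_face[OF 3(3)] by blast
  from MA3_frame[OF A mC 3(1,2) this] obtain B where B: "B \<in> \<A>"
    "eventually (\<lambda>v. f v \<in> B) (sector_germ (uminus ` ?C))"
    "eventually (\<lambda>v. f3 v \<in> B) (encl (local_face x3 C3))" by blast
  obtain g0 where g0: "g0 \<in> G" "g0 \<circ> f \<in> Isom B"
    "eventually (\<lambda>v. f v = (g0 \<circ> f) v) (sector_germ (uminus ` ?C))"
    using sector_germ_group_frame[OF G(2) A B(1) mC B(2)] by blast
  define k where "k = g0 \<circ> f"
  have k: "k \<in> Isom B" "eventually (\<lambda>v. f v = k v) (sector_germ (uminus ` ?C))"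
    using g0 by (simp_all add: k_def)
  have "eventually (\<lambda>v. f3 v \<in> B) (local_face x3 (closure C3))"
    by (rule filter_leD[OF local_face_closure_le_encl B(3)])
  then have "eventually (\<lambda>p. p \<in> B) (filtermap f (local_face x ?P))"
    by (intro filter_leD[OF 3(4)]) (simp add: eventually_filtermap)
  then have PB: "eventually (\<lambda>v. f v \<in> B) (local_face x ?P)" by (simp add: eventually_filtermap)
  note kP = panel_extension[OF A B(1) k(1) disjI1[OF refl] k(2) PB]
  obtain u t where u: "u ` C3 = ?C \<or> u ` C3 = ?C'"
    "filtermap f3 (local_face x3 C3) = filtermap k (local_face x (u ` C3))"
    by (rule chamber_position_at_panel[OF A B(1) k(1) 3(2,1,3,4) kP(1) B(3)]) (rule that)
  have "u ` C3 = ?C"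
  proof (rule ccontr)
    assume "u ` C3 \<noteq> ?C"
    then have "filtermap f3 (local_face x3 C3) = filtermap k (local_face x ?C')" using u by simp
    also have "\<dots> = filtermap f (local_face x ?C')" by (rule filtermap_eventually_eq[OF kP(2), symmetric])
    finally show False using 3(6) by simp
  qed
  then have kC: "filtermap k (local_face x ?C) \<noteq> filtermap f (local_face x ?C)" using u(2) 3(5) by simp
  \<comment> \<open>\<open>E\<close> contains the germ of \<open>- r\<^sub>i C\<close> of \<open>A\<close> and the third local chamber. By the same argument with \<open>C\<close> and \<open>r\<^sub>i C\<close>
    exchanged, this chamber is on the side of \<open>r\<^sub>i C\<close> in \<open>E\<close>, that is, opposite to the germ.\<close>
  have "encl (local_face x ?C) \<in> closed_faces \<union> solid_chimney_germs"
    using closed_chamber_closed_face[OF C] by blast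
  from MA3_frame[OF A mC' B(1) k(1) this] obtain E where E: "E \<in> \<A>"
    "eventually (\<lambda>v. f v \<in> E) (sector_germ (uminus ` ?C'))"
    "eventually (\<lambda>v. k v \<in> E) (encl (local_face x ?C))" by blast
  obtain e where "e \<in> Isom E" "eventually (\<lambda>v. e v = f v) (sector_germ (uminus ` ?C'))"
    using sector_germ_frame[OF A E(1) mC' E(2)] by blast
  then have e: "e \<in> Isom E" "eventually (\<lambda>v. f v = e v) (sector_germ (uminus ` ?C'))"
    by (simp_all add: eq_commute)
  have Pk: "filtermap f (local_face x ?P) \<le> filtermap k (local_face x (closure ?C))"
    unfolding filtermap_eventually_eq[OF kP(1)]
    by (intro filtermap_mono local_face_mono panel_subset_closure)
  have "eventually (\<lambda>v. k v \<in> E) (local_face x (closure ?C))"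
    by (rule filter_leD[OF local_face_closure_le_encl E(3)])
  then have "eventually (\<lambda>p. p \<in> E) (filtermap f (local_face x ?P))"
    by (intro filter_leD[OF Pk]) (simp add: eventually_filtermap)
  then have PE: "eventually (\<lambda>v. f v \<in> E) (local_face x ?P)" by (simp add: eventually_filtermap)
  note eP = panel_extension[OF A E(1) e(1) disjI2[OF refl] e(2) PE, unfolded refl_refl_image]
  obtain u t where u: "u \<in> Wv" "u x + t = x" "u ` ?C = ?C \<or> u ` ?C = ?C'"
    "eventually (\<lambda>v. k v = e (u v + t)) (local_face x (closure ?C))"
    "filtermap k (local_face x ?C) = filtermap e (local_face x (u ` ?C))"
    by (rule chamber_position_at_panel[OF A E(1) e(1) k(1) B(1) C Pk eP(1) E(3)]) (rule that)
  have uC: "u ` ?C = ?C'"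
  proof (rule ccontr)
    assume "u ` ?C \<noteq> ?C'"
    then have "filtermap k (local_face x ?C) = filtermap e (local_face x ?C)" using u(3,5) by simp
    also have "\<dots> = filtermap f (local_face x ?C)" by (rule filtermap_eventually_eq[OF eP(2), symmetric])
    finally show False using kC by simp
  qed
  have "u = simple_refl i"
  proof -
    obtain c where c: "c \<in> ?C" using fundamental_chamber_nonempty by blast
    then have "u c \<in> ?C'" using uC by blast
    then have "(simple_refl i \<circ> u) c \<in> ?C" by auto
    then have id: "simple_refl i \<circ> u = id"
      by (rule chamber_stabilizer_trivial[OF Wv_comp[OF refl_in_Wv u(1)] c])
    show ?thesis
    proof
      fix w
      have "simple_refl i (u w) = w" using fun_cong[OF id, of w] by simp
      then show "u w = simple_refl i w" using refl_involutive[of i "u w"] by simp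
    qed
  qed
  \<comment> \<open>Hence the rays of \<open>B\<close> from \<open>x\<close> into the third chamber extend the sectors of direction \<open>- r\<^sub>i C\<close> straight.\<close>
  have ray: "\<exists>E\<in>\<A>. \<exists>h\<in>Isom E. eventually (\<lambda>w. f w = h w) (sector_germ (uminus ` ?C')) \<and>
      (\<forall>s. 0 \<le> s \<and> s \<le> r \<longrightarrow> k (x + s *\<^sub>R v) = h (x + s *\<^sub>R simple_refl i v))"
    if v: "v \<in> ?C" for v r
  proof -
    obtain e0 where e0: "e0 > 0" "\<And>s. 0 \<le> s \<Longrightarrow> s \<le> e0 \<Longrightarrow> k (x + s *\<^sub>R v) = e (u (x + s *\<^sub>R v) + t)"
      using local_face_ray[OF C v u(4)] by blast
    have "k (x + s *\<^sub>R v) = e (x + s *\<^sub>R simple_refl i v)" if s: "0 \<le> s" "s \<le> e0" for s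
    proof -
      have "u (x + s *\<^sub>R v) + t = u x + t + s *\<^sub>R u v"
        by (simp add: linear_add[OF linear_Wv[OF u(1)]] linear_scale[OF linear_Wv[OF u(1)]])
      also have "\<dots> = x + s *\<^sub>R simple_refl i v" unfolding u(2) by (simp add: \<open>u = simple_refl i\<close>)
      finally show ?thesis using e0(2)[OF s] by simp
    qed
    from ray_extension[OF A B(1) k(1) C v refl_in_Wv E(1) e e0(1) this] show ?thesis .
  qed
  \<comment> \<open>\<open>Q\<close> closes the triangle. Far out on such a ray the frames of \<open>B\<close> and \<open>Q\<close> agree, which forces \<open>u'\<close> and \<open>t'\<close>.\<close>
  have "sector_germ ?C \<in> closed_faces \<union> solid_chimney_germs" using sector_germ_solid[OF C] by blast
  from MA3_frame[OF A mC' B(1) k(1) this] obtain Q where Q: "Q \<in> \<A>"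
    "eventually (\<lambda>v. f v \<in> Q) (sector_germ (uminus ` ?C'))"
    "eventually (\<lambda>v. k v \<in> Q) (sector_germ ?C)" by blast
  obtain g1 where g1: "g1 \<in> G" "g1 \<circ> f \<in> Isom Q"
    "eventually (\<lambda>v. f v = (g1 \<circ> f) v) (sector_germ (uminus ` ?C'))"
    using sector_germ_group_frame[OF G(2) A Q(1) mC' Q(2)] by blast
  obtain g2 where g2: "g2 \<in> G" "g2 \<circ> k \<in> Isom Q"
    "eventually (\<lambda>v. k v = (g2 \<circ> k) v) (sector_germ ?C)"
    using sector_germ_group_frame[OF G(2) B(1) k(1) Q(1) C Q(3)] by blast
  obtain u' t' where u': "u' \<in> Wv" "\<And>v. (g2 \<circ> k) v = (g1 \<circ> f) (u' v + t')"
    by (rule frame_change[OF Q(1) g1(2) g2(2)]) (rule that)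
  obtain \<eta> where \<eta>: "\<And>d. d \<in> ?C \<Longrightarrow> k (\<eta> + d) = (g2 \<circ> k) (\<eta> + d)"
    using eventually_sector_germD[OF C g2(3)] by blast
  obtain v where v: "v \<in> ?C" using fundamental_chamber_nonempty by blast
  obtain T where T: "T > 0" "\<And>s. s \<ge> T \<Longrightarrow> x + s *\<^sub>R v - \<eta> \<in> ?C"
    using chamber_sector_eventually[OF C v] by blast
  have far: "u' (x + s *\<^sub>R v) + t' = x + s *\<^sub>R simple_refl i v" if s: "s \<ge> T" for s
  proof -
    have kQ: "k (x + s *\<^sub>R v) = (g2 \<circ> k) (x + s *\<^sub>R v)" using \<eta>[OF T(2)[OF s]] by simp
    obtain E1 h1 where 1: "E1 \<in> \<A>" "h1 \<in> Isom E1"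
      "eventually (\<lambda>w. f w = h1 w) (sector_germ (uminus ` ?C'))"
      "\<forall>r. 0 \<le> r \<and> r \<le> s \<longrightarrow> k (x + r *\<^sub>R v) = h1 (x + r *\<^sub>R simple_refl i v)"
      using ray[OF v] by blast
    have k1: "k (x + s *\<^sub>R v) = h1 (x + s *\<^sub>R simple_refl i v)" using 1(4) s T(1) by simp
    have ev: "eventually (\<lambda>w. h1 w = (g1 \<circ> f) w) (sector_germ (uminus ` ?C'))"
      using eventually_conj[OF 1(3) g1(3)] by (rule eventually_mono) metis
    have inQ: "h1 (x + s *\<^sub>R simple_refl i v) \<in> Q" using k1 kQ frame_in[OF Q(1) g2(2)] by metis
    obtain d where d: "d \<in> uminus ` ?C'" using chamber_nonempty[OF mC'] by blast
    have "h1 (x + s *\<^sub>R simple_refl i v) = (g1 \<circ> f) (x + s *\<^sub>R simple_refl i v)"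
      using sector_cone_common[OF 1(1,2) Q(1) g1(2) mC' ev inQ d, of 0] by simp
    then have "(g1 \<circ> f) (u' (x + s *\<^sub>R v) + t') = (g1 \<circ> f) (x + s *\<^sub>R simple_refl i v)"
      using k1 kQ u'(2) by metis
    then show ?thesis using frame_inj[OF Q(1) g1(2)] by blast
  qed
  have lin: "u' (x + s *\<^sub>R v) = u' x + s *\<^sub>R u' v" for s
    by (simp add: linear_add[OF linear_Wv[OF u'(1)]] linear_scale[OF linear_Wv[OF u'(1)]])
  have a1: "u' x + T *\<^sub>R u' v + t' = x + T *\<^sub>R simple_refl i v" using far[of T] lin by simp
  have a2: "u' x + (T + 1) *\<^sub>R u' v + t' = x + (T + 1) *\<^sub>R simple_refl i v" using far[of "T + 1"] lin by simp
  have "(u' x + T *\<^sub>R u' v + t') + u' v = (x + T *\<^sub>R simple_refl i v) + simple_refl i v"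
    using a2 by (simp add: algebra_simps)
  then have u'v: "u' v = simple_refl i v" unfolding a1 by simp
  have u'x: "u' x + t' = x" using a1 unfolding u'v by (simp add: algebra_simps)
  have id: "simple_refl i \<circ> u' = id"
    by (rule chamber_stabilizer_trivial[OF Wv_comp[OF refl_in_Wv u'(1)] v]) (use u'v v in simp)
  have u'_refl: "u' w = simple_refl i w" for w
  proof -
    have "simple_refl i (u' w) = w" using fun_cong[OF id, of w] by simp
    then show ?thesis using refl_involutive[of i "u' w"] by simp
  qed
  have final: "g2 (g0 (f w)) = g1 (f (x + simple_refl i (w - x)))" for w
  proof -
    have "u' w + t' = u' w + (x - u' x)" using u'x by (simp add: algebra_simps)
    also have "\<dots> = x + simple_refl i (w - x)"
      by (simp add: u'_refl linear_diff[OF linear_refl])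
    finally show ?thesis using u'(2)[of w] by (simp add: k_def)
  qed
  obtain g20 where g20: "g20 \<in> G" "\<forall>p\<in>\<Delta>. g20 p = g2 (g0 p)"
    using BijGroup_subgroup_apply(2)[OF G(1) g2(1) g0(1)] by blast
  obtain g1' where g1': "g1' \<in> G" "\<forall>p\<in>\<Delta>. g1' (g1 p) = p"
    using BijGroup_subgroup_apply(3)[OF G(1) g1(1)] by blast
  obtain g where g: "g \<in> G" "\<forall>p\<in>\<Delta>. g p = g1' (g20 p)"
    using BijGroup_subgroup_apply(2)[OF G(1) g1'(1) g20(1)] by blast
  have "g (f w) = f (x + simple_refl i (w - x))" for w
    using g(2) g20(2) g1'(2) final[of w] frame_in_masure[OF A] by simp
  then show ?thesis using g(1) by blast
qed

text \<open>The product of the reflections through \<open>(c / 2) \<alpha>v i\<close> and through the origin.\<close>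

corollary coroot_translation_in_group:
  assumes thick and G: "subgroup G (BijGroup \<Delta>)" "strongly_transitive G"
    and A: "A \<in> \<A>" "f \<in> Isom A"
  shows "\<exists>g\<in>G. \<forall>w. g (f w) = f (w + c *\<^sub>R \<alpha>v i)"
proof -
  define x where "x = (c / 2) *\<^sub>R \<alpha>v i"
  obtain g where g: "g \<in> G" "\<forall>w. g (f w) = f (x + simple_refl i (w - x))"
    using reflection_in_group[OF assms] by blast
  obtain g' where g': "g' \<in> G" "\<forall>w. g' (f w) = f (0 + simple_refl i (w - 0))"
    using reflection_in_group[OF assms] by blast
  obtain k where k: "k \<in> G" "\<forall>p\<in>\<Delta>. k p = g (g' p)"
    using BijGroup_subgroup_apply(2)[OF G(1) g(1) g'(1)] by blast
  have "k (f w) = f (w + c *\<^sub>R \<alpha>v i)" for w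
  proof -
    have xx: "c *\<^sub>R \<alpha>v i = x + x" unfolding x_def by (subst scaleR_left_distrib[symmetric]) simp
    have "\<alpha> i x = c" by (simp add: x_def root_scale root_coroot cartan_diag)
    then have "simple_refl i x = - x" by (simp add: simple_refl_def xx)
    then have "x + simple_refl i (simple_refl i w - x) = w + c *\<^sub>R \<alpha>v i"
      by (simp add: linear_diff[OF linear_refl] xx)
    then show ?thesis using k(2) g(2) g'(2) frame_in_masure[OF A] by simp
  qed
  then show ?thesis using k(1) by blast
qed

section \<open>A strongly regular hyperbolic element\<close>

text \<open>The vector \<open>- d\<close> lies in the fundamental chamber, where no real root has a zero.\<close>

lemma antidominant_strongly_regular:
  assumes neg: "\<And>j. \<alpha> j d < 0" shows "strongly_regular_direction d"
proof -
  have mem: "- d \<in> Fv {}" using neg by (simp add: fundamental_chamber_mem root_minus)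
  have "Fv {} = id ` Fv {}" by simp
  then have "Fv {} \<in> positive_faces {}" unfolding positive_faces_def using id_in_Wv by blast
  then have "- d \<in> open_tits_cone" unfolding open_tits_cone_def using mem empty_spherical by blast
  then have "d \<in> uminus ` open_tits_cone" by (intro image_eqI[of _ _ "- d"]) simp_all
  moreover have "\<beta> d \<noteq> 0" if \<beta>: "\<beta> \<in> real_roots" for \<beta>
  proof -
    obtain w i where w: "w \<in> Wv" "\<beta> = \<alpha> i \<circ> inv_into UNIV w" using \<beta> by (auto simp: real_roots_def)
    have "\<alpha> i (inv_into UNIV w (- d)) \<noteq> 0" using root_sign_on_chamber[OF Wv_inv[OF w(1)], of i] mem by force
    then show ?thesis by (simp add: w(2) linear_neg[OF linear_Wv[OF Wv_inv[OF w(1)]]] root_minus)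
  qed
  ultimately show ?thesis unfolding strongly_regular_direction_def by blast
qed

theorem strongly_regular_hyperbolic_in_group:
  assumes thick and "\<not> has_affine_factor"
    and G: "subgroup G (BijGroup \<Delta>)" "strongly_transitive G" and Aut: "G \<subseteq> Aut_masure"
  shows "\<exists>\<gamma>\<in>G. strongly_regular_hyperbolic \<gamma>"
proof -
  obtain A where A: "A \<in> \<A>" using nonempty cover by blast
  obtain f where f: "f \<in> Isom A" using frame_exists[OF A] .
  obtain u where u: "\<And>j. \<alpha> j (\<Sum>i\<in>UNIV. u i *\<^sub>R \<alpha>v i) < 0"
    using antidominant_coroot_combination[OF assms(2)] by blast
  define d where "d = (\<Sum>i\<in>UNIV. u i *\<^sub>R \<alpha>v i)"
  have "\<exists>g\<in>G. \<forall>w. g (f w) = f (w + (\<Sum>i\<in>J. u i *\<^sub>R \<alpha>v i))" if "finite J" for J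
    using that
  proof (induction J rule: finite_induct)
    case empty
    obtain g0 where "g0 \<in> G" "\<forall>w. g0 (f w) = f (w + 0 *\<^sub>R \<alpha>v undefined)"
      using coroot_translation_in_group[OF assms(1) G A f] by blast
    then show ?case by auto
  next
    case (insert i J)
    then obtain g where g: "g \<in> G" "\<forall>w. g (f w) = f (w + (\<Sum>i\<in>J. u i *\<^sub>R \<alpha>v i))" by blast
    obtain g' where g': "g' \<in> G" "\<forall>w. g' (f w) = f (w + u i *\<^sub>R \<alpha>v i)"
      using coroot_translation_in_group[OF assms(1) G A f] by blast
    obtain k where k: "k \<in> G" "\<forall>p\<in>\<Delta>. k p = g (g' p)"
      using BijGroup_subgroup_apply(2)[OF G(1) g(1) g'(1)] by blast
    have "k (f w) = f (w + (\<Sum>i\<in>insert i J. u i *\<^sub>R \<alpha>v i))" for w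
      using k(2) g(2) g'(2) frame_in_masure[OF A f] insert by (simp add: add.assoc)
    then show ?case using k(1) by blast
  qed
  from this[of UNIV] obtain \<gamma> where \<gamma>: "\<gamma> \<in> G" "\<forall>w. \<gamma> (f w) = f (w + d)" unfolding d_def by auto
  have neg: "\<alpha> j d < 0" for j using u by (simp add: d_def)
  then have "d \<noteq> 0" using linear_0[OF linear_root] by force
  then have "translation_axis \<gamma> f 0 d" unfolding translation_axis_def using \<gamma>(2) by simp
  moreover have "strongly_regular_direction d" by (rule antidominant_strongly_regular[OF neg])
  ultimately have "strongly_regular_hyperbolic \<gamma>"
    unfolding strongly_regular_hyperbolic_def using A f \<gamma>(1) Aut by blast
  then show ?thesis using \<gamma>(1) by blast
qed

end

theorem proposition1p5:
  fixes \<alpha> :: "'i::finite \<Rightarrow> 'v::euclidean_space \<Rightarrow> real"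
    and \<alpha>v :: "'i \<Rightarrow> 'v"
    and \<Lambda> :: "('v \<Rightarrow> real) \<Rightarrow> real set"
    and \<Delta> :: "'p set"
    and \<A> :: "'p set set"
    and Isom :: "'p set \<Rightarrow> ('v \<Rightarrow> 'p) set"
    and G :: "('p \<Rightarrow> 'p) set"
  assumes "masure \<alpha> \<alpha>v \<Lambda> \<Delta> \<A> Isom"
    and "masure_data.thick \<alpha> \<alpha>v \<A> Isom"
    and "\<not> apartment_data.has_affine_factor \<alpha> \<alpha>v"
    and "subgroup G (BijGroup \<Delta>)"
    and "G \<subseteq> masure_data.Aut_masure \<alpha> \<alpha>v \<Lambda> \<Delta> \<A> Isom"
    and "G \<subseteq> masure_data.vectorially_Weyl_Aut \<alpha> \<alpha>v \<Lambda> \<Delta> \<A> Isom"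
    and "masure_data.strongly_transitive \<alpha> \<alpha>v \<Lambda> \<A> Isom G"
  shows "\<exists>\<gamma>\<in>G. masure_data.strongly_regular_hyperbolic \<alpha> \<alpha>v \<Lambda> \<Delta> \<A> Isom \<gamma>"
  by (rule masure.strongly_regular_hyperbolic_in_group[OF assms(1-4,7,5)])

end
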